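(* Let $t_1,t_2\in\mathbb{R}$ and $s_1,s_2>0$, let $\mathbf{W}_\Phi=[W_\Phi(t_1,s_1)\ W_\Phi(t_2,s_2)]^\top$, and assume that $\Gamma=\mathbb{E}[\mathbf{W}_\Phi\mathbf{W}_\Phi^*]$ is invertible. Then $$\mathbb{E}\left[e^{i(\Theta_\Phi(t_1,s_1)-\Theta_\Phi(t_2,s_2))}\right]=\frac\pi4e^{i\arg(\Gamma_{12})}\left(1-\frac{|\Gamma_{12}|^2}{\Gamma_{11}\Gamma_{22}}\right)\frac{|\Gamma_{12}|}{\sqrt{\Gamma_{11}\Gamma_{22}}}\;{}_2F_1\left(\frac32,\frac32;2;\frac{|\Gamma_{12}|^2}{\Gamma_{11}\Gamma_{22}}\right)$$ and $$\mathbb{E}\left[e^{i(\Theta_\Phi(t_1,s_1)+\Theta_\Phi(t_2,s_2))}\right]=0.$$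
   Context: The function $\psi:\mathbb{R}\to\mathbb{C}$ belongs to $L^1(\mathbb{R})\cap L^2(\mathbb{R})$, with Fourier transform $\widehat\psi(\omega)=\int_{\mathbb{R}}e^{-it\omega}\psi(t)\,dt$. It is an analytic mother wavelet: $\widehat\psi(\omega)=0$ for $\omega\le0$; moreover $|\widehat\psi|$ is unimodal with a unique maximum point in $(0,\infty)$. The noise $\Phi=\{\Phi(t)\}_{t\in\mathbb{R}}$ is a real-valued stationary Gaussian process with constant mean and covariance function $C_\Phi(t_1-t_2)=\mathrm{Cov}(\Phi(t_1),\Phi(t_2))$, which has the spectral representation $C_\Phi(t)=\int_{\mathbb{R}}e^{i\lambda t}F(d\lambda)$ with $F$ a nonnegative measure, $F(\mathbb{R})=C_\Phi(0)$. The analytic wavelet transform of $\Phi$ is $W_\Phi(t,s)=\int_{\mathbb{R}}\Phi(\tau)\frac{1}{\sqrt s}\overline{\psi\left(\frac{\tau-t}{s}\right)}d\tau$, $t\in\mathbb{R}$, $s>0$; it has mean zero because $\widehat\psi(0)=0$. The phase $\Theta_\Phi(t,s)\in[0,2\pi)$ is defined by $W_\Phi(t,s)=|W_\Phi(t,s)|e^{i\Theta_\Phi(t,s)}$. $\Gamma_{\ell\ell'}=\mathbb{E}[W_\Phi(t_\ell,s_\ell)\overline{W_\Phi(t_{\ell'},s_{\ell'})}]$; $\arg(\Gamma_{12})$ is immaterial if $\Gamma_{12}=0$. The hypergeometric function is ${}_2F_1(a,b;c;x)=\frac{\Gamma(c)}{\Gamma(a)\Gamma(b)}\sum_{k=0}^\infty\frac{\Gamma(k+a)\Gamma(k+b)}{\Gamma(k+c)}\frac{x^k}{k!}$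 for $x\in[0,1)$, $a,b,c>0$, where here $\Gamma(\cdot)$ is the Gamma function. *)

theory Defs
  imports "HOL-Probability.Probability"
begin

definition fourier :: "(real \<Rightarrow> complex) \<Rightarrow> real \<Rightarrow> complex" where
  "fourier f \<omega> = (LINT t|lborel. exp (- \<i> * complex_of_real (t * \<omega>)) * f t)"

definition unimodal_with_unique_max :: "(real \<Rightarrow> real) \<Rightarrow> real \<Rightarrow> bool" where
  "unimodal_with_unique_max g p \<longleftrightarrow>
     mono_on {..p} g \<and> antimono_on {p..} g \<and> (\<forall>\<omega>. \<omega> \<noteq> p \<longrightarrow> g \<omega> < g p)"

definition analytic_mother_wavelet :: "(real \<Rightarrow> complex) \<Rightarrow> bool" where
  "analytic_mother_wavelet \<psi> \<longleftrightarrow>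
     integrable lborel \<psi> \<and>
     integrable lborel (\<lambda>t. (cmod (\<psi> t))\<^sup>2) \<and>
     (\<forall>\<omega>\<le>0. fourier \<psi> \<omega> = 0) \<and>
     (\<exists>p>0. unimodal_with_unique_max (\<lambda>\<omega>. cmod (fourier \<psi> \<omega>)) p)"

text \<open>Almost surely constant variables count as (degenerate) Gaussian variables.\<close>

definition gaussian_rv :: "'w measure \<Rightarrow> ('w \<Rightarrow> real) \<Rightarrow> bool" where
  "gaussian_rv M X \<longleftrightarrow>
     X \<in> borel_measurable M \<and>
     ((\<exists>\<mu> \<sigma>. \<sigma> > 0 \<and> distributed M lborel X (\<lambda>x. ennreal (normal_density \<mu> \<sigma> x))) \<or>
      (\<exists>\<mu>. AE w in M. X w = \<mu>))"

definition gaussian_process :: "'w measure \<Rightarrow> (real \<Rightarrow> 'w \<Rightarrow> real) \<Rightarrow> bool" where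
  "gaussian_process M \<Phi> \<longleftrightarrow>
     (\<forall>I a. finite I \<longrightarrow> gaussian_rv M (\<lambda>w. \<Sum>t\<in>I. a t * \<Phi> t w))"

definition measurable_process :: "'w measure \<Rightarrow> (real \<Rightarrow> 'w \<Rightarrow> real) \<Rightarrow> bool" where
  "measurable_process M \<Phi> \<longleftrightarrow> (\<lambda>(t, w). \<Phi> t w) \<in> borel_measurable (borel \<Otimes>\<^sub>M M)"

definition covar :: "'w measure \<Rightarrow> ('w \<Rightarrow> real) \<Rightarrow> ('w \<Rightarrow> real) \<Rightarrow> real" where
  "covar M X Y =
     (LINT w|M. (X w - (LINT v|M. X v)) * (Y w - (LINT v|M. Y v)))"

definition stationary_with_covariance ::
    "'w measure \<Rightarrow> (real \<Rightarrow> 'w \<Rightarrow> real) \<Rightarrow> (real \<Rightarrow> real) \<Rightarrow> bool" where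
  "stationary_with_covariance M \<Phi> C \<longleftrightarrow>
     (\<exists>m. \<forall>t. (LINT w|M. \<Phi> t w) = m) \<and>
     (\<forall>t1 t2. covar M (\<Phi> t1) (\<Phi> t2) = C (t1 - t2))"

definition spectral_measure :: "real measure \<Rightarrow> (real \<Rightarrow> real) \<Rightarrow> bool" where
  "spectral_measure F C \<longleftrightarrow>
     sets F = sets borel \<and>
     emeasure F UNIV = ennreal (C 0) \<and>
     (\<forall>t. complex_of_real (C t) = (LINT \<xi>|F. exp (\<i> * complex_of_real (\<xi> * t))))"

text \<open>
  The transform is the pathwise Lebesgue integral. For a measurable process with bounded
  second moments and an integrable wavelet it converges absolutely for almost every path;
  on the exceptional null set the Bochner integral has the default value 0.
\<close>

definition wavelet_transform ::
    "(real \<Rightarrow> complex) \<Rightarrow> (real \<Rightarrow> 'w \<Rightarrow> real) \<Rightarrow> real \<Rightarrow> real \<Rightarrow> 'w \<Rightarrow> complex" where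
  "wavelet_transform \<psi> \<Phi> t s w =
     (LINT \<tau>|lborel. complex_of_real (\<Phi> \<tau> w) * complex_of_real (1 / sqrt s)
                      * cnj (\<psi> ((\<tau> - t) / s)))"

text \<open>\<^const>\<open>Arg2pi\<close> takes values in \<open>[0, 2\<pi>)\<close>, and is 0 at the origin.\<close>

definition wavelet_phase ::
    "(real \<Rightarrow> complex) \<Rightarrow> (real \<Rightarrow> 'w \<Rightarrow> real) \<Rightarrow> real \<Rightarrow> real \<Rightarrow> 'w \<Rightarrow> real" where
  "wavelet_phase \<psi> \<Phi> t s w = Arg2pi (wavelet_transform \<psi> \<Phi> t s w)"

text \<open>Not centred: no mean is subtracted.\<close>

definition second_moment_matrix :: "'w measure \<Rightarrow> ('w \<Rightarrow> complex ^ 'n) \<Rightarrow> complex ^ 'n ^ 'n" where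
  "second_moment_matrix M W = (\<chi> i j. LINT w|M. W w $ i * cnj (W w $ j))"

definition hypergeom_2F1 :: "real \<Rightarrow> real \<Rightarrow> real \<Rightarrow> real \<Rightarrow> real" where
  "hypergeom_2F1 a b c x =
     Gamma c / (Gamma a * Gamma b) *
       (\<Sum>k. Gamma (real k + a) * Gamma (real k + b) / Gamma (real k + c) * (x ^ k / fact k))"

end

theory Submission
  imports Defs
begin

text \<open>
  Write \<open>W\<^sub>1\<close>, \<open>W\<^sub>2\<close> for the two wavelet coefficients. The proof has two independent halves.

  The first half shows that \<open>(W\<^sub>1, W\<^sub>2)\<close> is a circular complex Gaussian pair. A path integral
  \<open>\<integral> \<Phi>(\<tau>) h(\<tau>) d\<tau>\<close> with integrable real \<open>h\<close> is a mean-square limit of finite Riemann sums of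
  the process, because the spectral representation makes the covariance continuous at the origin
  (\<open>path_integral_charfun\<close>); such limits have Gaussian characteristic functions. By Fubini and the spectral
  representation, the pseudo-covariance of two path integrals with weights \<open>g\<close> and \<open>h\<close> is
  \<open>\<integral> fourier h (-\<xi>) * fourier g \<xi> F(d\<xi>)\<close>. The weights of wavelet coefficients have Fourier transforms
  that vanish on the nonnegative half-line, so the integrand is zero for every \<open>\<xi>\<close>
  (\<open>pseudo_covariance_zero\<close>). Hence the real part of \<open>Z = a W\<^sub>1 + b W\<^sub>2\<close> has variance
  \<open>E|Z|\<^sup>2 / 2\<close>, and the characteristic function of the pair depends only on its covariance
  matrix \<open>\<Gamma>\<close> (\<open>circular_pair_charfun\<close>).

  The second half evaluates the phase expectations for such a pair. Characteristic functions determine the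
  joint law (\<open>complex_pair_law_unique\<close>), so after a rotation of \<open>W\<^sub>1\<close> by \<open>-arg \<Gamma>\<^sub>1\<^sub>2\<close> and
  a normalisation one may replace the pair by \<open>(U, \<rho> U + \<gamma> V)\<close>, where \<open>U\<close>, \<open>V\<close> are independent
  standard complex normal variables, \<open>\<rho> = |\<Gamma>\<^sub>1\<^sub>2| / sqrt (\<Gamma>\<^sub>1\<^sub>1 \<Gamma>\<^sub>2\<^sub>2)\<close> and \<open>\<gamma>\<^sup>2 = 1 - \<rho>\<^sup>2\<close>.
  Phases do not notice a common positive factor, which turns the correlation into the density
  \<open>(1 - \<rho>\<^sup>2) exp (2 \<rho> Re (u cnj v))\<close> relative to the independent pair (\<open>correlated_pair_tilt\<close>). Expand
  the exponential: with \<open>z = u cnj v\<close>, the factor \<open>sgn z\<close> and rotation invariance kill every monomial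
  except \<open>sgn z * z^j * cnj z^(j+1) = |z|^(2j+1)\<close>, whose mean is \<open>Gamma (j + 3/2)\<^sup>2\<close>. The
  resulting series is the hypergeometric one (\<open>correlated_phase_expectation\<close>). The phase
  factor of the sum has mean zero because the common rotation by \<open>\<i>\<close> preserves the law and changes the sign of the
  product of the phase factors.
\<close>

section \<open>Joint laws and characteristic functions\<close>

lemma borel_measurable_cnj [measurable]: "cnj \<in> borel_measurable borel"
  by (intro borel_measurable_continuous_onI continuous_intros)

text \<open>
  Reweighting by a nonnegative density and normalising gives a probability law on the line, so that the
  one-dimensional uniqueness theorem of Levy becomes applicable to weighted characteristic functions.
\<close>

lemma (in prob_space) tilted_distribution:
  fixes Y h :: "'a \<Rightarrow> real"
  assumes Y [measurable]: "Y \<in> borel_measurable M" "h \<in> borel_measurable M"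
    and h0: "\<And>w. 0 \<le> h w" and inth: "integrable M h" and c: "c = expectation h" "c > 0"
  shows "\<exists>P. real_distribution P
      \<and> (\<forall>u. char P u = (LINT w|M. exp (\<i> * complex_of_real (u * Y w)) * complex_of_real (h w)) / c)
      \<and> (\<forall>A\<in>sets borel. measure P A = (LINT w|M. indicator A (Y w) * h w) / c)"
proof -
  define D where "D = density M (\<lambda>w. ennreal (h w / c))"
  have [measurable_cong]: "sets D = sets M" by (simp add: D_def)
  have "prob_space D"
  proof
    have "emeasure D (space D) = (\<integral>\<^sup>+ w. ennreal (h w / c) \<partial>M)"
      unfolding D_def by (simp add: emeasure_density cong: nn_integral_cong)
    also have "\<dots> = ennreal (LINT w|M. h w / c)"
      by (rule nn_integral_eq_integral) (use inth h0 c in auto)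
    finally show "emeasure D (space D) = 1" using c by simp
  qed
  then interpret D: prob_space D .
  have YD [measurable]: "Y \<in> borel_measurable D" by measurable
  have "real_distribution (distr D borel Y)" by simp
  moreover have "char (distr D borel Y) u = (LINT w|M. exp (\<i> * complex_of_real (u * Y w)) * complex_of_real (h w)) / c" for u
  proof -
    have "char (distr D borel Y) u = (LINT w|D. exp (\<i> * complex_of_real (u * Y w)))"
      unfolding char_def by (subst integral_distr) (auto)
    also have "\<dots> = (LINT w|M. (h w / c) *\<^sub>R exp (\<i> * complex_of_real (u * Y w)))"
      unfolding D_def by (subst integral_density) (use h0 c in auto)
    also have "\<dots> = (LINT w|M. exp (\<i> * complex_of_real (u * Y w)) * complex_of_real (h w) / c)"
      by (rule Bochner_Integration.integral_cong) (auto simp: scaleR_conv_of_real)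
    finally show ?thesis by simp
  qed
  moreover have "measure (distr D borel Y) A = (LINT w|M. indicator A (Y w) * h w) / c"
    if [measurable]: "A \<in> sets borel" for A
  proof -
    have "measure (distr D borel Y) A = (LINT x|distr D borel Y. indicator A x)" by simp
    also have "\<dots> = (LINT w|D. indicator A (Y w))"
      by (subst integral_distr) auto
    also have "\<dots> = (LINT w|M. (h w / c) *\<^sub>R indicator A (Y w))"
      unfolding D_def by (subst integral_density) (use h0 c in auto)
    also have "\<dots> = (LINT w|M. indicator A (Y w) * h w / c)"
      by (rule Bochner_Integration.integral_cong) auto
    finally show ?thesis by simp
  qed
  ultimately show ?thesis by blast
qed

lemma weighted_law_unique_real:
  fixes X :: "'a \<Rightarrow> real" and X' :: "'b \<Rightarrow> real" and g :: "'a \<Rightarrow> real" and g' :: "'b \<Rightarrow> real"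
  assumes "prob_space M" "prob_space N"
    and [measurable]: "X \<in> borel_measurable M" "X' \<in> borel_measurable N"
      "g \<in> borel_measurable M" "g' \<in> borel_measurable N"
    and g: "\<And>w. 1 \<le> g w" "\<And>w. g w \<le> 3" and g': "\<And>w. 1 \<le> g' w" "\<And>w. g' w \<le> 3"
    and eq: "\<And>u. (LINT w|M. exp (\<i> * complex_of_real (u * X w)) * complex_of_real (g w))
                = (LINT w|N. exp (\<i> * complex_of_real (u * X' w)) * complex_of_real (g' w))"
    and A [measurable]: "A \<in> sets borel"
  shows "(LINT w|M. indicator A (X w) * g w) = (LINT w|N. indicator A (X' w) * g' w)"
proof -
  interpret M: prob_space M by fact
  interpret N: prob_space N by fact
  define c where "c = (LINT w|M. g w)"
  have ag: "\<bar>g w\<bar> \<le> 3" for w using g[of w] by linarith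
  have ag': "\<bar>g' w\<bar> \<le> 3" for w using g'[of w] by linarith
  have int_g: "integrable M g"
    by (rule M.integrable_const_bound[where B=3]) (use ag in auto)
  have int_g': "integrable N g'"
    by (rule N.integrable_const_bound[where B=3]) (use ag' in auto)
  have c': "c = (LINT w|N. g' w)"
    using eq[of 0] unfolding c_def by simp
  have c1: "1 \<le> c"
    unfolding c_def using integral_mono[OF _ int_g, of "\<lambda>_. 1"] g by (simp add: M.prob_space)
  have g0: "0 \<le> g w" for w using g(1)[of w] by linarith
  have g0': "0 \<le> g' w" for w using g'(1)[of w] by linarith
  obtain P where P: "real_distribution P"
    "\<And>u. char P u = (LINT w|M. exp (\<i> * complex_of_real (u * X w)) * complex_of_real (g w)) / c"
    "measure P A = (LINT w|M. indicator A (X w) * g w) / c"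
    using M.tilted_distribution[of X g c] g0 int_g c_def c1 A by auto
  obtain P' where P': "real_distribution P'"
    "\<And>u. char P' u = (LINT w|N. exp (\<i> * complex_of_real (u * X' w)) * complex_of_real (g' w)) / c"
    "measure P' A = (LINT w|N. indicator A (X' w) * g' w) / c"
    using N.tilted_distribution[of X' g' c] g0' int_g' c' c1 A by auto
  have "P = P'"
    by (rule Levy_uniqueness[OF P(1) P'(1)]) (simp only: P(2) P'(2) eq fun_eq_iff simp_thms)
  then show ?thesis using P(3) P'(3) c1 by auto
qed

text \<open>
  The step from one variable to several. A bounded complex weight \<open>G\<close> carries the remaining variables: if
  \<open>E exp (i u X) G\<close> is known for all \<open>u\<close>, then so is \<open>E 1_A(X) G\<close>. The conjugate weight is
  covered by replacing \<open>u\<close> with \<open>-u\<close>, hence so are the real and the imaginary part of \<open>G\<close>.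
\<close>

lemma weighted_law_unique:
  fixes X :: "'a \<Rightarrow> real" and X' :: "'b \<Rightarrow> real" and G :: "'a \<Rightarrow> complex" and G' :: "'b \<Rightarrow> complex"
  assumes M: "prob_space M" and N: "prob_space N"
    and X [measurable]: "X \<in> borel_measurable M" "X' \<in> borel_measurable N"
      "G \<in> borel_measurable M" "G' \<in> borel_measurable N"
    and G: "\<And>w. cmod (G w) \<le> 1" "\<And>w. cmod (G' w) \<le> 1"
    and eq: "\<And>u. (LINT w|M. exp (\<i> * complex_of_real (u * X w)) * G w)
                = (LINT w|N. exp (\<i> * complex_of_real (u * X' w)) * G' w)"
    and eq1: "\<And>u. (LINT w|M. exp (\<i> * complex_of_real (u * X w)))
                = (LINT w|N. exp (\<i> * complex_of_real (u * X' w)))"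
    and A [measurable]: "A \<in> sets borel"
  shows "(LINT w|M. indicator A (X w) * G w) = (LINT w|N. indicator A (X' w) * G' w)"
proof -
  interpret M: prob_space M by fact
  interpret N: prob_space N by fact
  have intM: "integrable M f" if [measurable]: "f \<in> borel_measurable M" and "\<And>w. cmod (f w) \<le> 1" for f
    by (rule M.integrable_const_bound[where B=1]) (use that in auto)
  have intN: "integrable N f" if [measurable]: "f \<in> borel_measurable N" and "\<And>w. cmod (f w) \<le> 1" for f
    by (rule N.integrable_const_bound[where B=1]) (use that in auto)
  have intMr: "integrable M f" if [measurable]: "f \<in> borel_measurable M" and "\<And>w. \<bar>f w\<bar> \<le> 1" for f :: "'a \<Rightarrow> real"
    by (rule M.integrable_const_bound[where B=1]) (use that in auto)
  have intNr: "integrable N f" if [measurable]: "f \<in> borel_measurable N" and "\<And>w. \<bar>f w\<bar> \<le> 1" for f :: "'b \<Rightarrow> real"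
    by (rule N.integrable_const_bound[where B=1]) (use that in auto)
  have eqc: "(LINT w|M. exp (\<i> * complex_of_real (u * X w)) * cnj (G w))
           = (LINT w|N. exp (\<i> * complex_of_real (u * X' w)) * cnj (G' w))" for u
  proof -
    have *: "exp (\<i> * complex_of_real (u * x)) * cnj z = cnj (exp (\<i> * complex_of_real (- u * x)) * z)" for x z
      by (simp add: exp_cnj)
    have "(LINT w|M. exp (\<i> * complex_of_real (u * X w)) * cnj (G w))
        = cnj (LINT w|M. exp (\<i> * complex_of_real (- u * X w)) * G w)"
      unfolding * by (rule Bochner_Integration.integral_cnj)
    also have "\<dots> = cnj (LINT w|N. exp (\<i> * complex_of_real (- u * X' w)) * G' w)"
      by (simp only: eq)
    also have "\<dots> = (LINT w|N. exp (\<i> * complex_of_real (u * X' w)) * cnj (G' w))"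
      unfolding * by (rule Bochner_Integration.integral_cnj[symmetric])
    finally show ?thesis .
  qed
  \<comment> \<open>Real and imaginary part of the weight are shifted by 2 to become positive weights.\<close>
  have lin: "(LINT w|M. indicator A (X w) * l (G w)) = (LINT w|N. indicator A (X' w) * l (G' w))"
    if l: "\<And>z. complex_of_real (l z) = p * z + q * cnj z" "\<And>z. \<bar>l z\<bar> \<le> cmod z"
      and [measurable]: "l \<in> borel_measurable borel"
    for l :: "complex \<Rightarrow> real" and p q :: complex
  proof -
    have lM: "\<bar>l (G w)\<bar> \<le> 1" for w using l(2)[of "G w"] G(1)[of w] by linarith
    have lN: "\<bar>l (G' w)\<bar> \<le> 1" for w using l(2)[of "G' w"] G(2)[of w] by linarith
    have b: "1 \<le> 2 + l (G w)" "2 + l (G w) \<le> 3" for w using lM[of w] by linarith+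
    have b': "1 \<le> 2 + l (G' w)" "2 + l (G' w) \<le> 3" for w using lN[of w] by linarith+
    have iM: "integrable M (\<lambda>w. exp (\<i> * complex_of_real (u * X w)))"
       "integrable M (\<lambda>w. exp (\<i> * complex_of_real (u * X w)) * G w)"
       "integrable M (\<lambda>w. exp (\<i> * complex_of_real (u * X w)) * cnj (G w))" for u
      by (rule intM, measurable, use G in \<open>simp add: norm_mult\<close>)+
    have iN: "integrable N (\<lambda>w. exp (\<i> * complex_of_real (u * X' w)))"
       "integrable N (\<lambda>w. exp (\<i> * complex_of_real (u * X' w)) * G' w)"
       "integrable N (\<lambda>w. exp (\<i> * complex_of_real (u * X' w)) * cnj (G' w))" for u
      by (rule intN, measurable, use G in \<open>simp add: norm_mult\<close>)+
    have ex: "e * complex_of_real (2 + l z) = 2 * e + p * (e * z) + q * (e * cnj z)" for e z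
      using l(1)[of z] by (simp add: algebra_simps)
    have "(LINT w|M. exp (\<i> * complex_of_real (u * X w)) * complex_of_real (2 + l (G w)))
        = (LINT w|N. exp (\<i> * complex_of_real (u * X' w)) * complex_of_real (2 + l (G' w)))" for u
      unfolding ex using iM iN eq eqc eq1 by simp
    from weighted_law_unique_real[OF M N X(1,2) _ _ b b' this A]
    have "(LINT w|M. indicator A (X w) * (2 + l (G w))) = (LINT w|N. indicator A (X' w) * (2 + l (G' w)))"
      by simp
    moreover have "(LINT w|M. indicator A (X w) * (2::real)) = (LINT w|N. indicator A (X' w) * 2)"
      by (rule weighted_law_unique_real[OF M N X(1,2)]) (use A eq1 in auto)
    moreover have iI: "integrable M (\<lambda>w. indicator A (X w) * l (G w))" "integrable N (\<lambda>w. indicator A (X' w) * l (G' w))"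
       "integrable M (\<lambda>w. indicator A (X w) :: real)" "integrable N (\<lambda>w. indicator A (X' w) :: real)"
      by (intro intMr intNr; use lM lN in \<open>auto simp: indicator_def\<close>)+
    ultimately show ?thesis by (simp add: ring_distribs)
  qed
  have ReA: "(LINT w|M. indicator A (X w) * Re (G w)) = (LINT w|N. indicator A (X' w) * Re (G' w))"
    by (rule lin[of Re "1/2" "1/2"]) (auto simp: complex_eq_iff abs_Re_le_cmod)
  have ImA: "(LINT w|M. indicator A (X w) * Im (G w)) = (LINT w|N. indicator A (X' w) * Im (G' w))"
    by (rule lin[of Im "-\<i>/2" "\<i>/2"]) (auto simp: complex_eq_iff abs_Im_le_cmod)
  have i1: "integrable M (\<lambda>w. indicator A (X w) * G w)"
    by (intro intM) (use G in \<open>auto simp: indicator_def\<close>)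
  have i2: "integrable N (\<lambda>w. indicator A (X' w) * G' w)"
    by (intro intN) (use G in \<open>auto simp: indicator_def\<close>)
  have r: "Re (indicator A x) = indicator A x" "Im (indicator A x) = 0" for x :: real
    by (auto simp: indicator_def)
  show ?thesis
    by (rule complex_eqI) (use i1 i2 ReA ImA in \<open>simp_all add: r flip: integral_Re integral_Im\<close>)
qed

text \<open>
  The probability of a box as an expectation of a product, in the form in which the induction over
  coordinates delivers it.
\<close>

lemma measure_box_eq:
  fixes Y :: "nat \<Rightarrow> 'a \<Rightarrow> real"
  assumes [measurable]: "\<And>i. Y i \<in> borel_measurable K" "\<And>i. B i \<in> sets borel"
  shows "complex_of_real (measure (distr K (Pi\<^sub>M {..<n} (\<lambda>_. borel)) (\<lambda>w. \<lambda>i\<in>{..<n}. Y i w)) (Pi\<^sub>E {..<n} B))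
      = (LINT w|K. (\<Prod>i<n. indicator (B i) (Y i w)))"
proof -
  have ind: "(\<Prod>i<n. indicator (B i) (y i)) = complex_of_real (indicator (Pi\<^sub>E {..<n} B) (\<lambda>i\<in>{..<n}. y i))"
    for y :: "nat \<Rightarrow> real"
  proof (cases "\<forall>i<n. y i \<in> B i")
    case False
    then obtain i where i: "i < n" "y i \<notin> B i" by blast
    then have "(\<Prod>i<n. indicator (B i) (y i) :: complex) = 0"
      by (intro prod_zero) (auto intro!: bexI[of _ i])
    moreover have "(\<lambda>i\<in>{..<n}. y i) \<notin> Pi\<^sub>E {..<n} B" using i by (auto simp: PiE_iff)
    ultimately show ?thesis by simp
  qed (auto simp: PiE_iff)
  have [measurable]: "Pi\<^sub>E {..<n} B \<in> sets (Pi\<^sub>M {..<n} (\<lambda>_. borel))"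
    by (rule sets_PiM_I_finite) auto
  let ?D = "distr K (Pi\<^sub>M {..<n} (\<lambda>_. borel)) (\<lambda>w. \<lambda>i\<in>{..<n}. Y i w)"
  have "measure ?D (Pi\<^sub>E {..<n} B) = (LINT x|?D. indicator (Pi\<^sub>E {..<n} B) x)" by simp
  also have "\<dots> = (LINT w|K. indicator (Pi\<^sub>E {..<n} B) (\<lambda>i\<in>{..<n}. Y i w))"
    by (subst integral_distr) auto
  finally show ?thesis unfolding ind by simp
qed

text \<open>
  Uniqueness for random vectors, by trading the factors \<open>exp (i u_k X_k)\<close> for indicators
  \<open>1_{A_k}(X_k)\<close> one coordinate at a time; boxes then determine the law.
\<close>

theorem law_unique_vector:
  fixes X :: "nat \<Rightarrow> 'a \<Rightarrow> real" and X' :: "nat \<Rightarrow> 'b \<Rightarrow> real"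
  assumes M: "prob_space M" and N: "prob_space N"
    and X [measurable]: "\<And>i. X i \<in> borel_measurable M" "\<And>i. X' i \<in> borel_measurable N"
    and eq: "\<And>u. (LINT w|M. exp (\<i> * complex_of_real (\<Sum>i<n. u i * X i w)))
                = (LINT w|N. exp (\<i> * complex_of_real (\<Sum>i<n. u i * X' i w)))"
  shows "distr M (Pi\<^sub>M {..<n} (\<lambda>_. borel)) (\<lambda>w. \<lambda>i\<in>{..<n}. X i w)
       = distr N (Pi\<^sub>M {..<n} (\<lambda>_. borel)) (\<lambda>w. \<lambda>i\<in>{..<n}. X' i w)"
proof -
  interpret M: prob_space M by fact
  interpret N: prob_space N by fact
  \<comment> \<open>The first \<open>k\<close> coordinates are already indicators, the others still exponentials.\<close>
  have step: "(LINT w|M. (\<Prod>i<k. indicator (A i) (X i w)) * exp (\<i> * complex_of_real (\<Sum>i=k..<n. u i * X i w)))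
     = (LINT w|N. (\<Prod>i<k. indicator (A i) (X' i w)) * exp (\<i> * complex_of_real (\<Sum>i=k..<n. u i * X' i w)))"
    if "k \<le> n" and A: "\<And>i. A i \<in> sets borel" for k A u
    using that(1)
  proof (induction k arbitrary: u)
    case 0
    then show ?case using eq[of u] by (simp add: atLeast0LessThan)
  next
    case (Suc k)
    note [measurable] = A
    have ex: "exp (\<i> * complex_of_real (a * x)) * (p * exp (\<i> * complex_of_real b)) = p * exp (\<i> * complex_of_real (a * x + b))"
      for a x p b by (simp add: exp_add ring_distribs)
    have sp: "(\<Sum>i=k..<n. (u(k:=a)) i * f i) = a * f k + (\<Sum>i=Suc k..<n. u i * f i)" for a f
      using Suc.prems by (simp add: sum.atLeast_Suc_lessThan)
    have "(LINT w|M. indicator (A k) (X k w) * ((\<Prod>i<k. indicator (A i) (X i w)) * exp (\<i> * complex_of_real (\<Sum>i=Suc k..<n. u i * X i w))))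
     = (LINT w|N. indicator (A k) (X' k w) * ((\<Prod>i<k. indicator (A i) (X' i w)) * exp (\<i> * complex_of_real (\<Sum>i=Suc k..<n. u i * X' i w))))"
    proof (rule weighted_law_unique[OF M N])
      have "norm (\<Prod>i<k. indicator (B i) (y i) :: complex) \<le> 1" for B and y :: "nat \<Rightarrow> real"
        unfolding prod_norm[symmetric] by (rule prod_le_1) (auto simp: indicator_def)
      then show "cmod ((\<Prod>i<k. indicator (A i) (X i w)) * exp (\<i> * complex_of_real (\<Sum>i=Suc k..<n. u i * X i w))) \<le> 1"
         "cmod ((\<Prod>i<k. indicator (A i) (X' i w')) * exp (\<i> * complex_of_real (\<Sum>i=Suc k..<n. u i * X' i w'))) \<le> 1"
         for w w'
        unfolding norm_mult norm_exp_i_times by simp_all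
      show "(LINT w|M. exp (\<i> * complex_of_real (a * X k w)) * ((\<Prod>i<k. indicator (A i) (X i w)) * exp (\<i> * complex_of_real (\<Sum>i=Suc k..<n. u i * X i w)))) =
         (LINT w|N. exp (\<i> * complex_of_real (a * X' k w)) * ((\<Prod>i<k. indicator (A i) (X' i w)) * exp (\<i> * complex_of_real (\<Sum>i=Suc k..<n. u i * X' i w))))" for a
        using Suc.IH[of "u(k:=a)"] Suc.prems unfolding ex sp by simp
      have "(\<Sum>i<n. (if i = k then a else 0) * f i) = a * f k" for a :: real and f
        using Suc.prems by (subst sum.cong[where h="\<lambda>i. if i = k then a * f i else 0", OF refl]) auto
      then show "(LINT w|M. exp (\<i> * complex_of_real (a * X k w))) = (LINT w|N. exp (\<i> * complex_of_real (a * X' k w)))" for a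
        using eq[of "\<lambda>i. if i = k then a else 0"] by simp
    qed (use A in measurable)
    then show ?case by (simp add: mult_ac)
  qed
  interpret D: prob_space "distr M (Pi\<^sub>M {..<n} (\<lambda>_. borel)) (\<lambda>w. \<lambda>i\<in>{..<n}. X i w)"
    by (rule M.prob_space_distr) measurable
  interpret E: prob_space "distr N (Pi\<^sub>M {..<n} (\<lambda>_. borel)) (\<lambda>w. \<lambda>i\<in>{..<n}. X' i w)"
    by (rule N.prob_space_distr) measurable
  show ?thesis
  proof (rule measure_eqI_PiM_finite)
    fix A :: "nat \<Rightarrow> real set" assume A: "\<And>i. i \<in> {..<n} \<Longrightarrow> A i \<in> sets borel"
    define B where "B i = (if i < n then A i else {})" for i
    have B [measurable]: "B i \<in> sets borel" for i using A by (auto simp: B_def)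
    have AB: "Pi\<^sub>E {..<n} A = Pi\<^sub>E {..<n} B" by (rule PiE_cong) (auto simp: B_def)
    show "emeasure (distr M (Pi\<^sub>M {..<n} (\<lambda>_. borel)) (\<lambda>w. \<lambda>i\<in>{..<n}. X i w)) (Pi\<^sub>E {..<n} A)
      = emeasure (distr N (Pi\<^sub>M {..<n} (\<lambda>_. borel)) (\<lambda>w. \<lambda>i\<in>{..<n}. X' i w)) (Pi\<^sub>E {..<n} A)"
      unfolding AB D.emeasure_eq_measure E.emeasure_eq_measure
      using step[of n B "\<lambda>_. 0"] by (simp add: measure_box_eq B flip: of_real_eq_iff[where 'a=complex])
  next
    show "range (\<lambda>_::nat. Pi\<^sub>E {..<n} (\<lambda>_. UNIV :: real set)) \<subseteq> prod_algebra {..<n} (\<lambda>_. borel)"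
      by (auto intro!: prod_algebraI_finite)
    show "(\<Union>i::nat. Pi\<^sub>E {..<n} (\<lambda>_. UNIV :: real set)) = space (Pi\<^sub>M {..<n} (\<lambda>_. borel))"
      by (simp add: space_PiM)
    show "emeasure (distr M (Pi\<^sub>M {..<n} (\<lambda>_. borel)) (\<lambda>w. \<lambda>i\<in>{..<n}. X i w)) (Pi\<^sub>E {..<n} (\<lambda>_. UNIV)) \<noteq> \<infinity>"
      by simp
  qed auto
qed

text \<open>
  The real linear functionals on pairs of complex numbers are the maps \<open>Re (a z\<^sub>1 + b z\<^sub>2)\<close>, so this
  is the four-dimensional case of the preceding theorem.
\<close>

corollary complex_pair_law_unique:
  fixes Z1 Z2 :: "'a \<Rightarrow> complex" and Z1' Z2' :: "'b \<Rightarrow> complex"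
    and F :: "complex \<Rightarrow> complex \<Rightarrow> complex"
  assumes M: "prob_space M" and N: "prob_space N"
    and [measurable]: "Z1 \<in> borel_measurable M" "Z2 \<in> borel_measurable M"
      "Z1' \<in> borel_measurable N" "Z2' \<in> borel_measurable N"
    and eq: "\<And>a b. (LINT w|M. exp (\<i> * complex_of_real (Re (a * Z1 w + b * Z2 w))))
                = (LINT w|N. exp (\<i> * complex_of_real (Re (a * Z1' w + b * Z2' w))))"
    and F [measurable]: "case_prod F \<in> borel_measurable (borel \<Otimes>\<^sub>M borel)"
  shows "(LINT w|M. F (Z1 w) (Z2 w)) = (LINT w|N. F (Z1' w) (Z2' w))"
proof -
  define coords :: "complex \<Rightarrow> complex \<Rightarrow> nat \<Rightarrow> real"
    where "coords z1 z2 = (\<lambda>i. if i = 0 then Re z1 else if i = 1 then Im z1 else if i = 2 then Re z2 else Im z2)" for z1 z2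
  have sum4: "(\<Sum>i<4. u i * coords z1 z2 i) = Re (Complex (u 0) (- u 1) * z1 + Complex (u 2) (- u 3) * z2)" for u z1 z2
    by (simp add: coords_def eval_nat_numeral)
  let ?P = "Pi\<^sub>M {..<4::nat} (\<lambda>_. borel :: real measure)"
  let ?G = "\<lambda>f. F (Complex (f 0) (f (Suc 0))) (Complex (f 2) (f 3))"
  have law: "distr M ?P (\<lambda>w. \<lambda>i\<in>{..<4}. coords (Z1 w) (Z2 w) i) = distr N ?P (\<lambda>w. \<lambda>i\<in>{..<4}. coords (Z1' w) (Z2' w) i)"
    by (rule law_unique_vector[OF M N]) (simp_all only: sum4 eq, simp_all add: coords_def)
  have meas_coords [measurable]: "(\<lambda>w. coords (Y1 w) (Y2 w) i) \<in> borel_measurable K"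
    if "Y1 \<in> borel_measurable K" "Y2 \<in> borel_measurable K" for Y1 Y2 i and K :: "'c measure"
    using that unfolding coords_def by simp
  have comp: "(\<lambda>f. f i) \<in> borel_measurable ?P" if "i < 4" for i
    by (rule measurable_component_singleton) (use that in simp)
  have [measurable]: "?G \<in> borel_measurable ?P"
  proof -
    have "(\<lambda>f. (Complex (f 0) (f (Suc 0)), Complex (f 2) (f 3))) \<in> measurable ?P (borel \<Otimes>\<^sub>M borel)"
      unfolding Complex_eq by (intro measurable_Pair borel_measurable_add borel_measurable_times
        borel_measurable_const measurable_compose[OF comp borel_measurable_of_real]) simp_all
    from measurable_compose[OF this F] show ?thesis by (simp only: prod.case)
  qed
  have "(LINT w|M. F (Z1 w) (Z2 w)) = (LINT f|distr M ?P (\<lambda>w. \<lambda>i\<in>{..<4}. coords (Z1 w) (Z2 w) i). ?G f)"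
    by (subst integral_distr) (auto simp: coords_def)
  also have "\<dots> = (LINT w|N. F (Z1' w) (Z2' w))"
    unfolding law by (subst integral_distr) (auto simp: coords_def)
  finally show ?thesis .
qed

section \<open>The standard complex normal law\<close>

lemma lborel_complex: "(lborel :: complex measure) = distr (lborel \<Otimes>\<^sub>M lborel) borel (\<lambda>(x, y). Complex x y)"
proof (rule lborel_eqI)
  fix l u :: complex
  assume le: "\<And>b. b \<in> Basis \<Longrightarrow> l \<bullet> b \<le> u \<bullet> b"
  have le': "Re l \<le> Re u" "Im l \<le> Im u"
    using le[of 1] le[of \<i>] by (auto simp: Basis_complex_def)
  have [measurable]: "(\<lambda>(x, y). Complex x y) \<in> (lborel \<Otimes>\<^sub>M lborel) \<rightarrow>\<^sub>M borel"
    unfolding Complex_eq by measurable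
  have "(\<lambda>(x, y). Complex x y) -` box l u \<inter> space (lborel \<Otimes>\<^sub>M lborel) = {Re l<..<Re u} \<times> {Im l<..<Im u}"
    by (auto simp: space_pair_measure box_def Basis_complex_def)
  then have "emeasure (distr (lborel \<Otimes>\<^sub>M lborel) borel (\<lambda>(x, y). Complex x y)) (box l u)
      = emeasure lborel {Re l<..<Re u} * emeasure lborel {Im l<..<Im u}"
    by (simp add: emeasure_distr lborel.emeasure_pair_measure_Times)
  also have "\<dots> = (\<Prod>b\<in>Basis. (u - l) \<bullet> b)"
    using le' by (simp add: Basis_complex_def ennreal_mult)
  finally show "emeasure (distr (lborel \<Otimes>\<^sub>M lborel) borel (\<lambda>(x, y). Complex x y)) (box l u) = (\<Prod>b\<in>Basis. (u - l) \<bullet> b)" .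
qed simp

lemma (in prob_space) normal_charfun:
  assumes s: "0 < \<sigma>" and X: "distributed M lborel X (\<lambda>x. ennreal (normal_density \<mu> \<sigma> x))"
  shows "expectation (\<lambda>w. exp (\<i> * complex_of_real (t * X w)))
       = exp (\<i> * complex_of_real (t * \<mu>) - complex_of_real (\<sigma>\<^sup>2 * t\<^sup>2 / 2))"
proof -
  let ?Y = "\<lambda>w. (X w - \<mu>) / \<sigma>"
  have [measurable]: "X \<in> borel_measurable M"
    using X by (auto dest: distributed_measurable)
  have Y: "distributed M lborel ?Y std_normal_density"
    using X normal_standard_normal_convert[OF s] by blast
  have "expectation (\<lambda>w. exp (\<i> * complex_of_real (t * X w)))
      = expectation (\<lambda>w. exp (\<i> * complex_of_real (t * \<mu>)) * exp (\<i> * complex_of_real ((t * \<sigma>) * ?Y w)))"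
    proof (intro Bochner_Integration.integral_cong refl)
    fix w
    have "t * X w = t * \<mu> + (t * \<sigma>) * ?Y w" using s by (simp add: field_simps)
    then show "exp (\<i> * complex_of_real (t * X w)) = exp (\<i> * complex_of_real (t * \<mu>)) * exp (\<i> * complex_of_real ((t * \<sigma>) * ?Y w))"
      by (simp only: of_real_add distrib_left exp_add)
  qed
  also have "\<dots> = exp (\<i> * complex_of_real (t * \<mu>)) * char std_normal_distribution (t * \<sigma>)"
    unfolding distributed_distr_eq_density[OF Y, symmetric] char_def
    by (subst integral_distr) auto
  also have "\<dots> = exp (\<i> * complex_of_real (t * \<mu>) - complex_of_real (\<sigma>\<^sup>2 * t\<^sup>2 / 2))"
  proof -
    have "- ((t * \<sigma>)\<^sup>2) / 2 = - (\<sigma>\<^sup>2 * t\<^sup>2 / 2)" by (simp add: power_mult_distrib)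
    then show ?thesis
      unfolding char_std_normal_distribution
      by (simp only: exp_of_real[symmetric] of_real_minus exp_add[symmetric] diff_conv_add_uminus)
  qed
  finally show ?thesis .
qed

text \<open>
  Normalised so that \<open>E|Z|\<^sup>2 = 1\<close>; real and imaginary part then have variance \<open>1/2\<close>.
\<close>

definition std_complex_normal :: "complex measure" where
  "std_complex_normal = density lborel (\<lambda>z. ennreal (exp (- (cmod z)\<^sup>2) / pi))"

lemma std_complex_normal_distr:
  "std_complex_normal = distr (density lborel (normal_density 0 (1 / sqrt 2)) \<Otimes>\<^sub>M density lborel (normal_density 0 (1 / sqrt 2)))
     borel (\<lambda>(x, y). Complex x y)"
proof -
  interpret P: prob_space "density lborel (normal_density 0 (1 / sqrt 2))"
    by (rule prob_space_normal_density) simp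
  have [measurable]: "(\<lambda>(x, y). Complex x y) \<in> (lborel \<Otimes>\<^sub>M lborel) \<rightarrow>\<^sub>M borel"
    unfolding Complex_eq by measurable
  have d: "ennreal (exp (- (cmod (Complex x y))\<^sup>2) / pi) = ennreal (normal_density 0 (1 / sqrt 2) x) * ennreal (normal_density 0 (1 / sqrt 2) y)" for x y
    by (simp add: normal_density_def ennreal_mult'[symmetric] cmod_power2 power_divide real_sqrt_mult mult_exp_exp)
  show ?thesis
    unfolding std_complex_normal_def lborel_complex
    by (subst density_distr, simp, simp, subst pair_measure_density)
       (simp_all add: P.sigma_finite_measure_axioms lborel.sigma_finite_measure_axioms split_beta' d)
qed

abbreviation std_complex_normal_pair :: "(complex \<times> complex) measure" where
  "std_complex_normal_pair \<equiv> std_complex_normal \<Otimes>\<^sub>M std_complex_normal"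

lemma sets_std_complex_normal [simp, measurable_cong]: "sets std_complex_normal = sets borel"
  by (simp add: std_complex_normal_def)

lemma space_std_complex_normal [simp]: "space std_complex_normal = UNIV"
  by (simp add: std_complex_normal_def)

lemma measurable_Complex_pair [measurable]: "(\<lambda>(x, y). Complex x y) \<in> (borel \<Otimes>\<^sub>M borel) \<rightarrow>\<^sub>M borel"
  unfolding Complex_eq by measurable

interpretation std_complex_normal: prob_space std_complex_normal
proof -
  interpret P: prob_space "density lborel (normal_density 0 (1 / sqrt 2))"
    by (rule prob_space_normal_density) simp
  interpret PP: pair_prob_space "density lborel (normal_density 0 (1 / sqrt 2))" "density lborel (normal_density 0 (1 / sqrt 2))" ..
  show "prob_space std_complex_normal"
    unfolding std_complex_normal_distr by (rule PP.prob_space_distr) measurable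
qed

interpretation std_complex_normal_pair: pair_prob_space std_complex_normal std_complex_normal ..

lemma std_complex_normal_charfun:
  "(LINT z|std_complex_normal. exp (\<i> * complex_of_real (Re (a * z)))) = complex_of_real (exp (- (cmod a)\<^sup>2 / 4))"
proof -
  let ?\<nu> = "density lborel (normal_density 0 (1 / sqrt 2))"
  interpret P: prob_space ?\<nu>
    by (rule prob_space_normal_density) simp
  interpret PP: pair_prob_space ?\<nu> ?\<nu> ..
  have nu: "(LINT x|?\<nu>. exp (\<i> * complex_of_real (t * x))) = complex_of_real (exp (- t\<^sup>2 / 4))" for t
  proof -
    have "distributed ?\<nu> lborel (\<lambda>x. x) (\<lambda>x. ennreal (normal_density 0 (1 / sqrt 2) x))"
      unfolding distributed_def by (auto intro!: distr_id2)
    from P.normal_charfun[OF _ this, of t] show ?thesis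
      by (simp add: power_divide exp_of_real[symmetric])
  qed
  have int: "integrable (?\<nu> \<Otimes>\<^sub>M ?\<nu>) (\<lambda>(x, y). exp (\<i> * complex_of_real (Re a * x)) * exp (\<i> * complex_of_real (- Im a * y)))"
    by (rule PP.integrable_const_bound[where B=1]) (auto simp: norm_mult)
  have "(LINT z|std_complex_normal. exp (\<i> * complex_of_real (Re (a * z))))
      = (LINT p|(?\<nu> \<Otimes>\<^sub>M ?\<nu>). exp (\<i> * complex_of_real (Re (a * (case p of (x, y) \<Rightarrow> Complex x y)))))"
    unfolding std_complex_normal_distr by (rule integral_distr) measurable
  also have "\<dots> = (LINT p|(?\<nu> \<Otimes>\<^sub>M ?\<nu>). (case p of (x, y) \<Rightarrow> exp (\<i> * complex_of_real (Re a * x)) * exp (\<i> * complex_of_real (- Im a * y))))"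
    by (intro Bochner_Integration.integral_cong) (auto simp: exp_add[symmetric] algebra_simps)
  also have "\<dots> = (LINT x|?\<nu>. (LINT y|?\<nu>. exp (\<i> * complex_of_real (Re a * x)) * exp (\<i> * complex_of_real (- Im a * y))))"
    by (rule PP.integral_fst[OF int, symmetric])
  also have "\<dots> = complex_of_real (exp (- (Re a)\<^sup>2 / 4)) * complex_of_real (exp (- (Im a)\<^sup>2 / 4))"
    by (simp only: integral_mult_right_zero integral_mult_left_zero nu power2_minus)
  also have "\<dots> = complex_of_real (exp (- (cmod a)\<^sup>2 / 4))"
    by (simp add: cmod_power2 mult_exp_exp add_divide_distrib diff_divide_distrib flip: of_real_mult)
  finally show ?thesis .
qed

lemma std_complex_normal_pair_charfun:
  "(LINT p|std_complex_normal_pair. exp (\<i> * complex_of_real (Re (a * fst p + b * snd p))))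
     = complex_of_real (exp (- ((cmod a)\<^sup>2 + (cmod b)\<^sup>2) / 4))"
proof -
  have int: "integrable std_complex_normal_pair (\<lambda>(u, v). exp (\<i> * complex_of_real (Re (a * u))) * exp (\<i> * complex_of_real (Re (b * v))))"
    by (rule std_complex_normal_pair.integrable_const_bound[where B=1]) (auto simp: norm_mult)
  have "(LINT p|std_complex_normal_pair. exp (\<i> * complex_of_real (Re (a * fst p + b * snd p))))
     = (LINT p|std_complex_normal_pair. (case p of (u, v) \<Rightarrow> exp (\<i> * complex_of_real (Re (a * u))) * exp (\<i> * complex_of_real (Re (b * v)))))"
    by (intro Bochner_Integration.integral_cong) (auto simp: exp_add[symmetric] algebra_simps)
  also have "\<dots> = (LINT u|std_complex_normal. (LINT v|std_complex_normal. exp (\<i> * complex_of_real (Re (a * u))) * exp (\<i> * complex_of_real (Re (b * v)))))"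
    by (rule std_complex_normal_pair.integral_fst[OF int, symmetric])
  also have "\<dots> = complex_of_real (exp (- (cmod a)\<^sup>2 / 4)) * complex_of_real (exp (- (cmod b)\<^sup>2 / 4))"
    by (simp only: integral_mult_right_zero integral_mult_left_zero std_complex_normal_charfun)
  also have "\<dots> = complex_of_real (exp (- ((cmod a)\<^sup>2 + (cmod b)\<^sup>2) / 4))"
    by (simp add: mult_exp_exp add_divide_distrib diff_divide_distrib flip: of_real_mult)
  finally show ?thesis .
qed

lemma std_complex_normal_nonzero: "AE z in std_complex_normal. z \<noteq> 0"
  unfolding std_complex_normal_def by (subst AE_density) (auto intro: AE_mp[OF AE_lborel_singleton[of 0]])

text \<open>
  Polar coordinates without angles: discs of squared radius \<open>a\<close> have area \<open>\<pi> a\<close>, so under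
  \<open>z \<mapsto> |z|\<^sup>2\<close> planar Lebesgue measure becomes \<open>\<pi>\<close> times length. Integrals of radial functions
  against the normal law are thus one-dimensional.
\<close>

lemma distr_lborel_cmod_square:
  "distr (lborel :: complex measure) borel (\<lambda>z. (cmod z)\<^sup>2) = density lborel (\<lambda>t. ennreal (pi * indicator {0..} t))"
proof (rule measure_eqI_generator_eq[where E="range (\<lambda>a::real. {..a})" and \<Omega>=UNIV and A="\<lambda>n. {..real n}"])
  show "Int_stable (range (\<lambda>a::real. {..a}))" by (auto simp: Int_stable_def)
  show "range (\<lambda>a::real. {..a}) \<subseteq> Pow UNIV" by auto
  have em: "emeasure (distr (lborel :: complex measure) borel (\<lambda>z. (cmod z)\<^sup>2)) {..a} = ennreal (pi * max 0 a)" for a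
  proof (cases "a \<ge> 0")
    case True
    have "(\<lambda>z. (cmod z)\<^sup>2) -` {..a} = cball 0 (sqrt a)"
      using True by (auto intro: real_le_rsqrt dest: sqrt_ge_absD[OF order_trans[OF eq_refl[OF abs_norm_cancel]]])
    then show ?thesis using True
      by (simp add: emeasure_distr emeasure_cball unit_ball_vol_2)
  next
    case False
    then have "(\<lambda>z. (cmod z)\<^sup>2) -` {..a} = {}"
      by (auto intro: order_trans[OF zero_le_power2])
    then show ?thesis using False by (simp add: emeasure_distr)
  qed
  fix X assume "X \<in> range (\<lambda>a::real. {..a})"
  then obtain a where X: "X = {..a}" by blast
  have "emeasure (density lborel (\<lambda>t. ennreal (pi * indicator {0..} t))) {..a} = (\<integral>\<^sup>+ t. ennreal pi * indicator {0..max 0 a} t \<partial>lborel)" if "a \<ge> 0"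
    using that by (subst emeasure_density) (auto intro!: nn_integral_cong simp: indicator_def)
  moreover have "emeasure (density lborel (\<lambda>t. ennreal (pi * indicator {0..} t))) {..a} = 0" if "a < 0"
    using that by (subst emeasure_density) (auto intro!: nn_integral_zero' AE_I2 simp: indicator_def)
  ultimately have "emeasure (density lborel (\<lambda>t. ennreal (pi * indicator {0..} t))) {..a} = ennreal (pi * max 0 a)"
    by (cases "a \<ge> 0") (auto simp: nn_integral_cmult ennreal_mult)
  with em X show "emeasure (distr (lborel :: complex measure) borel (\<lambda>z. (cmod z)\<^sup>2)) X = emeasure (density lborel (\<lambda>t. ennreal (pi * indicator {0..} t))) X"
    by simp
next
  fix n show "emeasure (distr (lborel :: complex measure) borel (\<lambda>z. (cmod z)\<^sup>2)) {..real n} \<noteq> \<infinity>"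
  proof -
    have "(\<lambda>z. (cmod z)\<^sup>2) -` {..real n} = cball 0 (sqrt n)"
      by (auto intro: real_le_rsqrt dest: sqrt_ge_absD[OF order_trans[OF eq_refl[OF abs_norm_cancel]]])
    then show ?thesis by (simp add: emeasure_distr emeasure_cball)
  qed
qed (auto simp: borel_eq_atMost real_arch_simple)

text \<open>
  In other words, \<open>|Z|\<^sup>2\<close> is exponentially distributed with mean 1.
\<close>

lemma std_complex_normal_radial:
  assumes [measurable]: "f \<in> borel_measurable borel"
  shows "(\<integral>\<^sup>+ z. f ((cmod z)\<^sup>2) \<partial>std_complex_normal) = (\<integral>\<^sup>+ t. ennreal (indicator {0..} t * exp (- t)) * f t \<partial>lborel)"
proof -
  have "(\<integral>\<^sup>+ z. f ((cmod z)\<^sup>2) \<partial>std_complex_normal) = (\<integral>\<^sup>+ z. ennreal (exp (- (cmod z)\<^sup>2) / pi) * f ((cmod z)\<^sup>2) \<partial>lborel)"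
    unfolding std_complex_normal_def by (rule nn_integral_density) auto
  also have "\<dots> = (\<integral>\<^sup>+ t. ennreal (exp (- t) / pi) * f t \<partial>distr (lborel :: complex measure) borel (\<lambda>z. (cmod z)\<^sup>2))"
    by (subst nn_integral_distr) auto
  also have "\<dots> = (\<integral>\<^sup>+ t. ennreal (pi * indicator {0..} t) * (ennreal (exp (- t) / pi) * f t) \<partial>lborel)"
    unfolding distr_lborel_cmod_square by (rule nn_integral_density) auto
  also have "\<dots> = (\<integral>\<^sup>+ t. ennreal (indicator {0..} t * exp (- t)) * f t \<partial>lborel)"
    by (intro nn_integral_cong) (simp add: mult.assoc[symmetric] ennreal_mult'[symmetric])
  finally show ?thesis .
qed

lemma std_complex_normal_odd_moment:
  "integrable std_complex_normal (\<lambda>z. cmod z ^ (2 * k + 1))"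
  "(LINT z|std_complex_normal. cmod z ^ (2 * k + 1)) = Gamma (real k + 3 / 2)"
proof -
  have p: "cmod z ^ (2 * k + 1) = ((cmod z)\<^sup>2) powr (real k + 1 / 2)" for z
  proof (cases "z = 0")
    case False
    then have "((cmod z)\<^sup>2) powr (real k + 1 / 2) = (cmod z powr 2) powr (real k + 1/2)" by simp
    also have "\<dots> = cmod z powr (real (2 * k + 1))" unfolding powr_powr by (simp add: algebra_simps)
    also have "\<dots> = cmod z ^ (2 * k + 1)" using False by (subst powr_realpow) auto
    finally show ?thesis by simp
  qed simp
  have "(\<integral>\<^sup>+ z. ennreal (cmod z ^ (2 * k + 1)) \<partial>std_complex_normal)
      = (\<integral>\<^sup>+ t. ennreal (indicator {0..} t * exp (- t)) * ennreal (t powr (real k + 1 / 2)) \<partial>lborel)"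
    unfolding p by (rule std_complex_normal_radial[of "\<lambda>t. ennreal (t powr (real k + 1 / 2))"]) measurable
  also have "\<dots> = (\<integral>\<^sup>+ t. ennreal (indicator {0..} t * t powr ((real k + 3 / 2) - 1) / exp t) \<partial>lborel)"
    by (intro nn_integral_cong) (auto simp: indicator_def ennreal_mult'[symmetric] exp_minus field_simps)
  also have "\<dots> = ennreal (Gamma (real k + 3 / 2))"
    by (rule Gamma_conv_nn_integral_real[symmetric]) simp
  finally have *: "(\<integral>\<^sup>+ z. ennreal (cmod z ^ (2 * k + 1)) \<partial>std_complex_normal) = ennreal (Gamma (real k + 3 / 2))" .
  have "Gamma (real k + 3 / 2) \<ge> 0" by (intro less_imp_le Gamma_real_pos) simp
  then have "integrable std_complex_normal (\<lambda>z. cmod z ^ (2 * k + 1)) \<and>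
     (LINT z|std_complex_normal. cmod z ^ (2 * k + 1)) = Gamma (real k + 3 / 2)"
    using nn_integral_eq_integrable[of "\<lambda>z. cmod z ^ (2 * k + 1)" std_complex_normal "Gamma (real k + 3 / 2)"] * by simp
  then show "integrable std_complex_normal (\<lambda>z. cmod z ^ (2 * k + 1))"
  "(LINT z|std_complex_normal. cmod z ^ (2 * k + 1)) = Gamma (real k + 3 / 2)" by auto
qed

text \<open>
  This exponential moment, finite exactly for \<open>\<rho> < 1\<close>, dominates the series expansion of the tilting
  density below.
\<close>

lemma std_complex_normal_exp_square_integrable:
  assumes "\<rho> < 1"
  shows "integrable std_complex_normal (\<lambda>z. exp (\<rho> * (cmod z)\<^sup>2))"
proof (rule integrableI_bounded)
  have "(\<integral>\<^sup>+ z. ennreal (exp (\<rho> * (cmod z)\<^sup>2)) \<partial>std_complex_normal)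
      = (\<integral>\<^sup>+ t. ennreal (indicator {0..} t * exp (- t)) * ennreal (exp (\<rho> * t)) \<partial>lborel)"
    by (rule std_complex_normal_radial[of "\<lambda>t. ennreal (exp (\<rho> * t))"]) measurable
  also have "\<dots> = (\<integral>\<^sup>+ t. ennreal (exp (- (1 - \<rho>) * t)) * indicator {0..} t \<partial>lborel)"
    by (intro nn_integral_cong) (auto simp: indicator_def ennreal_mult'[symmetric] mult_exp_exp algebra_simps)
  also have "\<dots> = (\<integral>\<^sup>+ t. ennreal (1 / (1 - \<rho>)) * ennreal (exponential_density (1 - \<rho>) t) \<partial>lborel)"
  proof (intro nn_integral_cong)
    fix t :: real
    have "- (1 - \<rho>) * t = - t * (1 - \<rho>)" by (simp add: algebra_simps)
    then have "exp (- (1 - \<rho>) * t) = 1 / (1 - \<rho>) * ((1 - \<rho>) * exp (- t * (1 - \<rho>)))"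
      using assms by simp
    then show "ennreal (exp (- (1 - \<rho>) * t)) * indicator {0..} t = ennreal (1 / (1 - \<rho>)) * ennreal (exponential_density (1 - \<rho>) t)"
      using assms by (auto simp: indicator_def exponential_density_def ennreal_mult'[symmetric])
  qed
  also have "\<dots> = ennreal (1 / (1 - \<rho>)) * emeasure (density lborel (exponential_density (1 - \<rho>))) UNIV"
    by (subst nn_integral_cmult) (auto simp: emeasure_density)
  also have "\<dots> = ennreal (1 / (1 - \<rho>))"
    using prob_space.emeasure_space_1[OF prob_space_exponential_density[of "1 - \<rho>"]] assms by simp
  also have "\<dots> < \<infinity>" by simp
  finally show "(\<integral>\<^sup>+ z. ennreal (norm (exp (\<rho> * (cmod z)\<^sup>2))) \<partial>std_complex_normal) < \<infinity>" by simp
qed measurable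

section \<open>Phases of a correlated pair\<close>

text \<open>
  The substitution \<open>u = \<gamma> u'\<close>, \<open>v = w' - \<rho> u'\<close> carries \<open>(u, \<rho> u + \<gamma> v)\<close> to
  \<open>\<gamma> (u', w')\<close>: it removes the correlation up to a common positive factor. Its Jacobian is
  \<open>\<gamma>\<^sup>2\<close>, since only \<open>u\<close>, of real dimension 2, is rescaled.
\<close>

lemma nn_integral_scale_shear:
  fixes \<rho> \<gamma> :: real
  assumes [measurable]: "f \<in> borel_measurable (borel \<Otimes>\<^sub>M borel)" and "\<gamma> > 0"
  shows "(\<integral>\<^sup>+ p. f p \<partial>(lborel \<Otimes>\<^sub>M (lborel :: complex measure)))
       = (\<integral>\<^sup>+ p. ennreal (\<gamma>\<^sup>2) * f (\<gamma> *\<^sub>R fst p, snd p - \<rho> *\<^sub>R fst p) \<partial>(lborel \<Otimes>\<^sub>M (lborel :: complex measure)))"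
proof -
  have [measurable]: "(\<lambda>u. \<integral>\<^sup>+ v. f (u, v) \<partial>(lborel :: complex measure)) \<in> borel_measurable (borel :: complex measure)"
    by measurable
  have shear: "(\<integral>\<^sup>+ w. f (u, w - c) \<partial>lborel) = (\<integral>\<^sup>+ w. f (u, w) \<partial>lborel)" for u c :: complex
  proof -
    have "(\<integral>\<^sup>+ w. f (u, w) \<partial>lborel) = (\<integral>\<^sup>+ w. f (u, w) \<partial>distr lborel borel ((+) (- c)))"
      by (simp only: lborel_distr_plus)
    also have "\<dots> = (\<integral>\<^sup>+ w. f (u, - c + w) \<partial>lborel)" by (rule nn_integral_distr) auto
    finally show ?thesis by simp
  qed
  have scale: "(\<integral>\<^sup>+ u. h u \<partial>lborel) = (\<integral>\<^sup>+ u. ennreal (\<gamma>\<^sup>2) * h (\<gamma> *\<^sub>R u) \<partial>lborel)"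
    if [measurable]: "h \<in> borel_measurable borel" for h :: "complex \<Rightarrow> ennreal"
  proof -
    have "(\<integral>\<^sup>+ u. h u \<partial>lborel) = (\<integral>\<^sup>+ u. h u \<partial>density (distr lborel borel (\<lambda>x::complex. 0 + \<gamma> *\<^sub>R x)) (\<lambda>_. ennreal (\<bar>\<gamma>\<bar> ^ DIM(complex))))"
      using lborel_affine[of \<gamma> "0::complex"] \<open>\<gamma> > 0\<close> by simp
    also have "\<dots> = (\<integral>\<^sup>+ u. ennreal (\<gamma>\<^sup>2) * h (\<gamma> *\<^sub>R u) \<partial>lborel)"
      using \<open>\<gamma> > 0\<close> by (subst nn_integral_density) (auto simp: nn_integral_distr)
    finally show ?thesis .
  qed
  have "(\<integral>\<^sup>+ p. f p \<partial>(lborel \<Otimes>\<^sub>M (lborel :: complex measure))) = (\<integral>\<^sup>+ u. \<integral>\<^sup>+ v. f (u, v) \<partial>(lborel :: complex measure) \<partial>lborel)"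
    by (subst lborel.nn_integral_fst) auto
  also have "\<dots> = (\<integral>\<^sup>+ u. ennreal (\<gamma>\<^sup>2) * (\<integral>\<^sup>+ v. f (\<gamma> *\<^sub>R u, v) \<partial>(lborel :: complex measure)) \<partial>lborel)"
    by (rule scale) simp
  also have "\<dots> = (\<integral>\<^sup>+ u. (\<integral>\<^sup>+ w. ennreal (\<gamma>\<^sup>2) * f (\<gamma> *\<^sub>R u, w - \<rho> *\<^sub>R u) \<partial>(lborel :: complex measure)) \<partial>lborel)"
    by (subst nn_integral_cmult) (simp_all add: shear)
  also have "\<dots> = (\<integral>\<^sup>+ p. ennreal (\<gamma>\<^sup>2) * f (\<gamma> *\<^sub>R fst p, snd p - \<rho> *\<^sub>R fst p) \<partial>(lborel \<Otimes>\<^sub>M (lborel :: complex measure)))"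
    by (subst lborel.nn_integral_fst[symmetric]) auto
  finally show ?thesis .
qed

lemma lborel_scale_shear:
  fixes \<rho> \<gamma> :: real
  assumes "\<gamma> > 0"
  shows "lborel \<Otimes>\<^sub>M (lborel :: complex measure)
    = density (distr (lborel \<Otimes>\<^sub>M lborel) (lborel \<Otimes>\<^sub>M lborel) (\<lambda>p. (\<gamma> *\<^sub>R fst p, snd p - \<rho> *\<^sub>R fst p))) (\<lambda>_. ennreal (\<gamma>\<^sup>2))"
    (is "?L = density (distr _ _ ?T) _")
proof (rule measure_eqI)
  have [measurable]: "?T \<in> ?L \<rightarrow>\<^sub>M ?L" by measurable
  fix A assume "A \<in> sets ?L"
  then have A [measurable]: "A \<in> sets (borel \<Otimes>\<^sub>M borel)" by (simp cong: sets_pair_measure_cong)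
  have [measurable]: "A \<in> sets ?L" by fact
  have "emeasure ?L A = (\<integral>\<^sup>+ p. indicator A p \<partial>?L)" by simp
  also have "\<dots> = (\<integral>\<^sup>+ p. ennreal (\<gamma>\<^sup>2) * indicator A (?T p) \<partial>?L)"
    by (rule nn_integral_scale_shear) (use assms in auto)
  also have "\<dots> = emeasure (density (distr ?L ?L ?T) (\<lambda>_. ennreal (\<gamma>\<^sup>2))) A"
    by (subst emeasure_density) (auto simp: nn_integral_distr)
  finally show "emeasure ?L A = emeasure (density (distr ?L ?L ?T) (\<lambda>_. ennreal (\<gamma>\<^sup>2))) A" .
qed simp

lemma std_complex_normal_pair_density:
  "std_complex_normal_pair = density (lborel \<Otimes>\<^sub>M lborel) (\<lambda>p. ennreal (exp (- ((cmod (fst p))\<^sup>2 + (cmod (snd p))\<^sup>2)) / pi\<^sup>2))"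
proof -
  have d: "ennreal (exp (- (cmod u)\<^sup>2) / pi) * ennreal (exp (- (cmod v)\<^sup>2) / pi)
      = ennreal (exp (- ((cmod u)\<^sup>2 + (cmod v)\<^sup>2)) / pi\<^sup>2)" for u v
    by (simp add: ennreal_mult'[symmetric] mult_exp_exp power2_eq_square)
  have "std_complex_normal_pair = density (lborel \<Otimes>\<^sub>M lborel) (\<lambda>(u, v). ennreal (exp (- (cmod u)\<^sup>2) / pi) * ennreal (exp (- (cmod v)\<^sup>2) / pi))"
    unfolding std_complex_normal_def
    by (rule pair_measure_density)
       (simp_all add: lborel.sigma_finite_measure_axioms std_complex_normal.sigma_finite_measure_axioms[unfolded std_complex_normal_def])
  then show ?thesis unfolding d split_beta' .
qed

text \<open>
  After the scaling and shearing substitution the exponent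
  \<open>\<gamma>\<^sup>2 |u|\<^sup>2 + |w - \<rho> u|\<^sup>2\<close> equals \<open>|u|\<^sup>2 + |w|\<^sup>2 - 2 \<rho> Re (u cnj w)\<close>. So, for functions of
  the directions only, correlation acts as an exponential weight on an independent pair.
\<close>

lemma correlated_pair_tilt:
  fixes F :: "complex \<Rightarrow> complex \<Rightarrow> complex"
  assumes [measurable]: "case_prod F \<in> borel_measurable (borel \<Otimes>\<^sub>M borel)"
    and hom: "\<And>c u v. c > 0 \<Longrightarrow> F (c *\<^sub>R u) (c *\<^sub>R v) = F u v"
    and \<rho>: "0 \<le> \<rho>" "\<rho> < 1" and \<gamma>: "\<gamma> = sqrt (1 - \<rho>\<^sup>2)"
  shows "(LINT p|std_complex_normal_pair. F (fst p) (\<rho> *\<^sub>R fst p + \<gamma> *\<^sub>R snd p))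
       = (1 - \<rho>\<^sup>2) *\<^sub>R (LINT p|std_complex_normal_pair. exp (2 * \<rho> * Re (fst p * cnj (snd p))) *\<^sub>R F (fst p) (snd p))"
proof -
  have r1: "\<rho>\<^sup>2 < 1" using \<rho> by (simp add: power_less_one_iff abs_square_less_1)
  then have g0: "\<gamma> > 0" and g2: "\<gamma>\<^sup>2 = 1 - \<rho>\<^sup>2" unfolding \<gamma> by simp_all
  define D where "D p = exp (- ((cmod (fst p))\<^sup>2 + (cmod (snd p))\<^sup>2)) / pi\<^sup>2" for p :: "complex \<times> complex"
  have D0: "D p \<ge> 0" for p by (simp add: D_def)
  have [measurable]: "D \<in> borel_measurable (borel \<Otimes>\<^sub>M borel)" unfolding D_def by measurable
  let ?L = "lborel \<Otimes>\<^sub>M lborel :: (complex \<times> complex) measure"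
  let ?T = "\<lambda>p. (\<gamma> *\<^sub>R fst p, snd p - \<rho> *\<^sub>R fst p) :: complex \<times> complex"
  have [measurable]: "(\<lambda>p. F (f p) (g p)) \<in> borel_measurable K"
    if "f \<in> borel_measurable K" "g \<in> borel_measurable K" for f g and K :: "(complex \<times> complex) measure"
    using measurable_compose[OF measurable_Pair[OF that] assms(1)] by simp
  let ?H = "\<lambda>p. F (fst p) (\<rho> *\<^sub>R fst p + \<gamma> *\<^sub>R snd p)"
  have DT: "D (?T p) = exp (2 * \<rho> * Re (fst p * cnj (snd p))) * D p" for p
  proof -
    have "(cmod (\<gamma> *\<^sub>R fst p))\<^sup>2 + (cmod (snd p - \<rho> *\<^sub>R fst p))\<^sup>2 = \<gamma>\<^sup>2 * (cmod (fst p))\<^sup>2 + (cmod (snd p - \<rho> *\<^sub>R fst p))\<^sup>2"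
      by (simp add: power_mult_distrib)
    also have "\<dots> = (cmod (fst p))\<^sup>2 + (cmod (snd p))\<^sup>2 - 2 * \<rho> * Re (fst p * cnj (snd p))"
      unfolding g2 cmod_power2 by (simp add: power2_eq_square algebra_simps)
    finally show ?thesis unfolding D_def by (simp add: mult_exp_exp)
  qed
  have HT: "?H (?T p) = F (fst p) (snd p)" for p
  proof -
    have "?H (?T p) = F (\<gamma> *\<^sub>R fst p) (\<gamma> *\<^sub>R snd p)" by (simp add: algebra_simps)
    then show ?thesis using hom g0 by simp
  qed
  have "(LINT p|std_complex_normal_pair. ?H p) = (LINT p|?L. D p *\<^sub>R ?H p)"
    unfolding std_complex_normal_pair_density by (subst integral_density) (auto simp: D_def)
  also have "\<dots> = (LINT p|density (distr ?L ?L ?T) (\<lambda>_. ennreal (\<gamma>\<^sup>2)). D p *\<^sub>R ?H p)"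
    using lborel_scale_shear[OF g0, of \<rho>] by simp
  also have "\<dots> = (LINT p|?L. \<gamma>\<^sup>2 *\<^sub>R (D (?T p) *\<^sub>R ?H (?T p)))"
    by (subst integral_density) (auto simp: integral_distr)
  also have "\<dots> = (LINT p|?L. (1 - \<rho>\<^sup>2) *\<^sub>R (D p *\<^sub>R (exp (2 * \<rho> * Re (fst p * cnj (snd p))) *\<^sub>R F (fst p) (snd p))))"
    unfolding HT DT g2 by (simp add: mult.commute)
  also have "\<dots> = (1 - \<rho>\<^sup>2) *\<^sub>R (LINT p|?L. D p *\<^sub>R (exp (2 * \<rho> * Re (fst p * cnj (snd p))) *\<^sub>R F (fst p) (snd p)))"
    by (rule integral_scaleR_right)
  also have "(LINT p|?L. D p *\<^sub>R (exp (2 * \<rho> * Re (fst p * cnj (snd p))) *\<^sub>R F (fst p) (snd p)))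
      = (LINT p|std_complex_normal_pair. exp (2 * \<rho> * Re (fst p * cnj (snd p))) *\<^sub>R F (fst p) (snd p))"
    unfolding std_complex_normal_pair_density by (subst integral_density) (auto simp: D_def)
  finally show ?thesis .
qed

text \<open>
  The two components may be rotated independently, because the characteristic function sees only
  \<open>|a|\<close> and \<open>|b|\<close>.
\<close>

lemma std_complex_normal_pair_rotate:
  fixes F :: "complex \<Rightarrow> complex \<Rightarrow> complex"
  assumes F [measurable]: "case_prod F \<in> borel_measurable (borel \<Otimes>\<^sub>M borel)" and ab: "cmod \<alpha> = 1" "cmod \<beta> = 1"
  shows "(LINT p|std_complex_normal_pair. F (\<alpha> * fst p) (\<beta> * snd p)) = (LINT p|std_complex_normal_pair. F (fst p) (snd p))"
proof (rule complex_pair_law_unique[where F=F and M=std_complex_normal_pair and N=std_complex_normal_pair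
      and ?Z1.0="\<lambda>p. \<alpha> * fst p" and ?Z2.0="\<lambda>p. \<beta> * snd p" and Z1'=fst and Z2'=snd])
  show "(LINT p|std_complex_normal_pair. exp (\<i> * complex_of_real (Re (a * (\<alpha> * fst p) + b * (\<beta> * snd p)))))
      = (LINT p|std_complex_normal_pair. exp (\<i> * complex_of_real (Re (a * fst p + b * snd p))))" for a b
    using std_complex_normal_pair_charfun[of "a * \<alpha>" "b * \<beta>"] std_complex_normal_pair_charfun[of a b] ab
    by (simp only: mult.assoc norm_mult mult_1_right)
qed (use std_complex_normal_pair.prob_space_axioms in \<open>auto\<close>)

lemma borel_measurable_sgn_complex [measurable]: "(sgn :: complex \<Rightarrow> complex) \<in> borel_measurable borel"
  unfolding sgn_div_norm by measurable

text \<open>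
  With \<open>z = u cnj v\<close>, rotating \<open>u\<close> by an angle \<open>\<phi>\<close> multiplies \<open>sgn z * z^k * cnj z^m\<close> by
  \<open>exp (i (k + 1 - m) \<phi>)\<close>. Unless \<open>m = k + 1\<close> an angle can be chosen that makes this factor
  \<open>-1\<close>, and the mean vanishes; otherwise the monomial is \<open>|z|^(2k+1)\<close>, and the means of the two
  moduli multiply.
\<close>

lemma std_complex_normal_pair_phase_moment:
  "(LINT p|std_complex_normal_pair. sgn (fst p * cnj (snd p)) * (fst p * cnj (snd p)) ^ k * cnj (fst p * cnj (snd p)) ^ m)
   = (if m = Suc k then complex_of_real ((Gamma (real k + 3 / 2))\<^sup>2) else 0)"
proof -
  let ?F = "\<lambda>u v. sgn (u * cnj v) * (u * cnj v) ^ k * cnj (u * cnj v) ^ m"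
  have [measurable]: "case_prod ?F \<in> borel_measurable (borel \<Otimes>\<^sub>M borel)" by measurable
  show ?thesis
  proof (cases "m = Suc k")
    case True
    have eq: "?F u v = complex_of_real (cmod u ^ (2 * k + 1) * cmod v ^ (2 * k + 1))" for u v
    proof -
      define z where "z = u * cnj v"
      have "sgn z * z ^ k * cnj z ^ m = (sgn z * cnj z) * (z * cnj z) ^ k"
        unfolding True by (simp add: power_mult_distrib)
      also have "sgn z * cnj z = complex_of_real (cmod z)"
        by (cases "z = 0") (auto simp: sgn_eq complex_norm_square[symmetric] power2_eq_square)
      also have "(z * cnj z) ^ k = complex_of_real (cmod z ^ (2 * k))"
        by (simp add: complex_norm_square[symmetric] power_mult)
      finally show ?thesis unfolding z_def by (simp add: norm_mult power_mult_distrib mult_ac)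
    qed
    have int: "integrable std_complex_normal_pair (\<lambda>(u, v). complex_of_real (cmod u ^ (2 * k + 1) * cmod v ^ (2 * k + 1)))"
    proof (rule std_complex_normal_pair.Fubini_integrable)
      show "AE u in std_complex_normal. integrable std_complex_normal (\<lambda>v. case (u, v) of (u, v) \<Rightarrow> complex_of_real (cmod u ^ (2 * k + 1) * cmod v ^ (2 * k + 1)))"
        unfolding prod.case of_real_mult
        by (intro AE_I2 integrable_mult_right integrable_of_real std_complex_normal_odd_moment)
      show "integrable std_complex_normal (\<lambda>u. LINT v|std_complex_normal. norm (case (u, v) of (u, v) \<Rightarrow> complex_of_real (cmod u ^ (2 * k + 1) * cmod v ^ (2 * k + 1))))"
        unfolding prod.case of_real_mult norm_mult norm_of_real power_abs abs_norm_cancel integral_mult_right_zero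
        by (intro integrable_mult_left std_complex_normal_odd_moment)
    qed measurable
    have "(LINT p|std_complex_normal_pair. ?F (fst p) (snd p))
        = (LINT p|std_complex_normal_pair. (case p of (u, v) \<Rightarrow> complex_of_real (cmod u ^ (2 * k + 1) * cmod v ^ (2 * k + 1))))"
      unfolding eq by (simp add: split_beta')
    also have "\<dots> = (LINT u|std_complex_normal. (LINT v|std_complex_normal. complex_of_real (cmod u ^ (2 * k + 1) * cmod v ^ (2 * k + 1))))"
      by (rule std_complex_normal_pair.integral_fst[OF int, symmetric])
    also have "\<dots> = complex_of_real (Gamma (real k + 3 / 2)) * complex_of_real (Gamma (real k + 3 / 2))"
      by (simp only: of_real_mult integral_mult_right_zero integral_mult_left_zero integral_complex_of_real std_complex_normal_odd_moment(2))
    finally show ?thesis using True by (simp add: power2_eq_square)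
  next
    case False
    \<comment> \<open>Rotation by the angle \<open>\<pi> / n\<close> multiplies the integrand by \<open>-1\<close>.\<close>
    define n where "n = 1 + real k - real m"
    have n0: "n \<noteq> 0" using False unfolding n_def by linarith
    define \<alpha> where "\<alpha> = cis (pi / n)"
    have a1: "cmod \<alpha> = 1" by (simp add: \<alpha>_def)
    have rot: "?F (\<alpha> * u) v = - ?F u v" for u v
    proof -
      have "?F (\<alpha> * u) v = (\<alpha> * \<alpha> ^ k * cnj \<alpha> ^ m) * ?F u v"
        using a1 by (simp add: sgn_mult sgn_eq[of \<alpha>] power_mult_distrib mult_ac)
      also have "\<alpha> * \<alpha> ^ k * cnj \<alpha> ^ m = cis (pi / n + real k * (pi / n) + real m * - (pi / n))"
        unfolding \<alpha>_def cis_cnj Complex.DeMoivre cis_mult by simp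
      also have "pi / n + real k * (pi / n) + real m * - (pi / n) = n * (pi / n)"
        unfolding n_def by (simp only: ring_distribs mult_minus_right)
      also have "\<dots> = pi" using n0 by simp
      finally show ?thesis by simp
    qed
    have "(LINT p|std_complex_normal_pair. ?F (\<alpha> * fst p) (1 * snd p)) = (LINT p|std_complex_normal_pair. ?F (fst p) (snd p))"
      by (rule std_complex_normal_pair_rotate) (use a1 in auto)
    then have "- (LINT p|std_complex_normal_pair. ?F (fst p) (snd p)) = (LINT p|std_complex_normal_pair. ?F (fst p) (snd p))"
      unfolding rot mult_1_left by (simp only: Bochner_Integration.integral_minus)
    moreover have "- x = x \<Longrightarrow> x = 0" for x :: complex
      by (simp add: complex_eq_iff)
    ultimately show ?thesis using False by simp
  qed
qed

text \<open>
  By \<open>2 |u| |v| \<le> |u|\<^sup>2 + |v|\<^sup>2\<close> this reduces to the exponential moment of a single squared modulus.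
\<close>

lemma std_complex_normal_pair_exp_integrable:
  assumes "0 \<le> \<rho>" "\<rho> < 1"
  shows "integrable std_complex_normal_pair (\<lambda>p. exp (2 * \<rho> * cmod (fst p * cnj (snd p))))"
proof (rule Bochner_Integration.integrable_bound)
  show "integrable std_complex_normal_pair (\<lambda>(u, v). exp (\<rho> * (cmod u)\<^sup>2) * exp (\<rho> * (cmod v)\<^sup>2))"
  proof (rule std_complex_normal_pair.Fubini_integrable)
    show "AE u in std_complex_normal. integrable std_complex_normal (\<lambda>v. case (u, v) of (u, v) \<Rightarrow> exp (\<rho> * (cmod u)\<^sup>2) * exp (\<rho> * (cmod v)\<^sup>2))"
      unfolding prod.case
      by (intro AE_I2 integrable_mult_right std_complex_normal_exp_square_integrable assms)
    show "integrable std_complex_normal (\<lambda>u. LINT v|std_complex_normal. norm (case (u, v) of (u, v) \<Rightarrow> exp (\<rho> * (cmod u)\<^sup>2) * exp (\<rho> * (cmod v)\<^sup>2)))"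
      unfolding prod.case norm_mult norm_exp real_norm_def abs_mult abs_exp_cancel integral_mult_right_zero
      by (intro integrable_mult_left std_complex_normal_exp_square_integrable assms)
  qed measurable
  show "AE p in std_complex_normal_pair. norm (exp (2 * \<rho> * cmod (fst p * cnj (snd p)))) \<le> norm (case p of (u, v) \<Rightarrow> exp (\<rho> * (cmod u)\<^sup>2) * exp (\<rho> * (cmod v)\<^sup>2))"
  proof (rule AE_I2)
    fix p :: "complex \<times> complex"
    have "2 * (cmod (fst p) * cmod (snd p)) \<le> (cmod (fst p))\<^sup>2 + (cmod (snd p))\<^sup>2"
      using sum_squares_bound[of "cmod (fst p)" "cmod (snd p)"] by simp
    then have "\<rho> * (2 * (cmod (fst p) * cmod (snd p))) \<le> \<rho> * ((cmod (fst p))\<^sup>2 + (cmod (snd p))\<^sup>2)"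
      by (rule mult_left_mono) (rule assms)
    then show "norm (exp (2 * \<rho> * cmod (fst p * cnj (snd p)))) \<le> norm (case p of (u, v) \<Rightarrow> exp (\<rho> * (cmod u)\<^sup>2) * exp (\<rho> * (cmod v)\<^sup>2))"
      by (simp add: split_beta' mult_exp_exp norm_mult algebra_simps)
  qed
qed measurable

lemma power_le_fact_exp:
  fixes x :: real
  assumes "0 \<le> x"
  shows "x ^ n \<le> fact n * exp x"
proof -
  have "x ^ n / fact n \<le> exp x"
    using sum_le_suminf[OF summable_exp[of x], of "{n}"] assms
    by (simp add: exp_def divide_inverse mult.commute)
  then show ?thesis by (simp add: divide_le_eq mult.commute)
qed

text \<open>
  Expand \<open>exp (2 \<rho> Re z) = \<Sum>\<^sub>n \<rho>\<^sup>n (z + cnj z)\<^sup>n / n!\<close> with \<open>z = u cnj v\<close>, and each power by the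
  binomial theorem. Only odd \<open>n = 2j + 1\<close> contribute, through the single term \<open>z^j * cnj z^(j+1)\<close>,
  and \<open>(2j+1 choose j) / (2j+1)! = 1 / (j! (j+1)!)\<close>. All partial sums are dominated by
  \<open>exp (2 \<rho> |z|)\<close>, which justifies integrating termwise.
\<close>

lemma phase_exp_sums:
  assumes \<rho>: "0 \<le> \<rho>" "\<rho> < 1"
  shows "(\<lambda>j. complex_of_real (\<rho> ^ (2 * j + 1) * (Gamma (real j + 3 / 2))\<^sup>2 / (fact j * fact (Suc j))))
    sums (LINT p|std_complex_normal_pair. exp (2 * \<rho> * Re (fst p * cnj (snd p))) *\<^sub>R sgn (fst p * cnj (snd p)))"
proof -
  let ?z = "\<lambda>p::complex \<times> complex. fst p * cnj (snd p)"
  let ?t = "\<lambda>n p. complex_of_real ((2 * \<rho> * Re (?z p)) ^ n / fact n) * sgn (?z p)"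
  let ?m = "\<lambda>k m p. sgn (?z p) * ?z p ^ k * cnj (?z p) ^ m"
  define c where "c n = (LINT p|std_complex_normal_pair. ?t n p)" for n
  have dom: "integrable std_complex_normal_pair (\<lambda>p. exp (2 * \<rho> * cmod (?z p)))"
    by (rule std_complex_normal_pair_exp_integrable[OF \<rho>])
  have bnd: "\<bar>2 * \<rho> * Re (?z p)\<bar> \<le> 2 * \<rho> * cmod (?z p)" for p
    using abs_Re_le_cmod[of "?z p"] \<rho> by (simp only: abs_mult) (intro mult_mono; simp)
  have ps: "cmod (\<Sum>i<n. ?t i p) \<le> exp (2 * \<rho> * cmod (?z p))" for n p
  proof -
    have "cmod (\<Sum>i<n. ?t i p) \<le> (\<Sum>i<n. \<bar>2 * \<rho> * Re (?z p)\<bar> ^ i / fact i)"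
    proof (rule sum_norm_le)
      fix i
      have "cmod (?t i p) = \<bar>2 * \<rho> * Re (?z p)\<bar> ^ i / fact i * cmod (sgn (?z p))"
        by (simp only: norm_mult norm_of_real abs_divide power_abs) simp
      also have "\<dots> \<le> \<bar>2 * \<rho> * Re (?z p)\<bar> ^ i / fact i * 1"
        by (intro mult_left_mono) (auto simp: norm_sgn)
      finally show "cmod (?t i p) \<le> \<bar>2 * \<rho> * Re (?z p)\<bar> ^ i / fact i" by simp
    qed
    also have "\<dots> \<le> exp \<bar>2 * \<rho> * Re (?z p)\<bar>"
      using sum_le_suminf[OF summable_exp[of "\<bar>2 * \<rho> * Re (?z p)\<bar>"], of "{..<n}"]
      by (simp add: exp_def divide_inverse mult.commute)
    also have "\<dots> \<le> exp (2 * \<rho> * cmod (?z p))" using bnd by simp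
    finally show ?thesis .
  qed
  have tint: "integrable std_complex_normal_pair (?t n)" for n
  proof (rule Bochner_Integration.integrable_bound[OF integrable_mult_right[OF dom, of 2]])
    show "AE p in std_complex_normal_pair. norm (?t n p) \<le> norm (2 * exp (2 * \<rho> * cmod (?z p)))"
    proof (rule AE_I2)
      fix p
      have "cmod (?t n p) = cmod ((\<Sum>i<Suc n. ?t i p) - (\<Sum>i<n. ?t i p))"
        by (simp only: sum.lessThan_Suc add_diff_cancel_left')
      also have "\<dots> \<le> cmod (\<Sum>i<Suc n. ?t i p) + cmod (\<Sum>i<n. ?t i p)"
        by (rule norm_triangle_ineq4)
      also have "\<dots> \<le> 2 * exp (2 * \<rho> * cmod (?z p))" using ps[where n="Suc n" and p=p] ps[where n=n and p=p] by linarith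
      finally show "norm (?t n p) \<le> norm (2 * exp (2 * \<rho> * cmod (?z p)))" by simp
    qed
  qed measurable
  have "(\<lambda>n. LINT p|std_complex_normal_pair. (\<Sum>i<n. ?t i p)) \<longlonglongrightarrow>
     (LINT p|std_complex_normal_pair. exp (2 * \<rho> * Re (?z p)) *\<^sub>R sgn (?z p))"
  proof (rule integral_dominated_convergence[OF _ _ dom])
    show "AE p in std_complex_normal_pair. (\<lambda>n. \<Sum>i<n. ?t i p) \<longlonglongrightarrow> exp (2 * \<rho> * Re (?z p)) *\<^sub>R sgn (?z p)"
    proof (rule AE_I2)
      fix p
      have "(\<lambda>i. (2 * \<rho> * Re (?z p)) ^ i / fact i) sums exp (2 * \<rho> * Re (?z p))"
        using exp_converges[of "2 * \<rho> * Re (?z p)"] by (simp add: divide_inverse mult.commute)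
      from sums_mult2[OF sums_of_real[OF this], of "sgn (?z p)"]
      show "(\<lambda>n. \<Sum>i<n. ?t i p) \<longlonglongrightarrow> exp (2 * \<rho> * Re (?z p)) *\<^sub>R sgn (?z p)"
        unfolding sums_def scaleR_conv_of_real .
    qed
    show "AE p in std_complex_normal_pair. norm (\<Sum>i<n. ?t i p) \<le> exp (2 * \<rho> * cmod (?z p))" for n
      using ps by (intro AE_I2)
  qed measurable
  moreover have "(LINT p|std_complex_normal_pair. (\<Sum>i<n. ?t i p)) = (\<Sum>i<n. c i)" for n
    unfolding c_def by (rule Bochner_Integration.integral_sum) (rule tint)
  ultimately have c_sums: "c sums (LINT p|std_complex_normal_pair. exp (2 * \<rho> * Re (?z p)) *\<^sub>R sgn (?z p))"
    unfolding sums_def by (simp only:)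
  \<comment> \<open>The monomials are dominated by the exponential for the admissible parameter \<open>1/2\<close>.\<close>
  have mint: "integrable std_complex_normal_pair (?m k m)" for k m
  proof (rule Bochner_Integration.integrable_bound)
    show "integrable std_complex_normal_pair (\<lambda>p. fact (k + m) * exp (2 * (1 / 2) * cmod (?z p)))"
      by (intro integrable_mult_right std_complex_normal_pair_exp_integrable) auto
    show "AE p in std_complex_normal_pair. norm (?m k m p) \<le> norm (fact (k + m) * exp (2 * (1 / 2) * cmod (?z p)))"
    proof (rule AE_I2)
      fix p
      have "norm (?m k m p) = cmod (sgn (?z p)) * cmod (?z p) ^ (k + m)"
        by (simp only: norm_mult norm_power complex_mod_cnj power_add mult.assoc)
      also have "\<dots> \<le> 1 * cmod (?z p) ^ (k + m)"
        by (intro mult_right_mono) (auto simp: norm_sgn)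
      also have "1 * cmod (?z p) ^ (k + m) \<le> fact (k + m) * exp (cmod (?z p))"
        using power_le_fact_exp[of "cmod (?z p)" "k + m"] by simp
      finally show "norm (?m k m p) \<le> norm (fact (k + m) * exp (2 * (1 / 2) * cmod (?z p)))" by simp
    qed
  qed measurable
  have c_val: "c n = complex_of_real (\<rho> ^ n / fact n) * (\<Sum>k\<le>n. of_nat (n choose k) * (if n - k = Suc k then complex_of_real ((Gamma (real k + 3 / 2))\<^sup>2) else 0))" for n
  proof -
    have "?t n p = complex_of_real (\<rho> ^ n / fact n) * (\<Sum>k\<le>n. of_nat (n choose k) * ?m k (n - k) p)" for p
    proof -
      have "complex_of_real (2 * \<rho> * Re (?z p)) = complex_of_real \<rho> * (?z p + cnj (?z p))"
        unfolding complex_add_cnj by (simp only: of_real_mult[symmetric] mult.assoc mult.left_commute)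
      then have "complex_of_real (2 * \<rho> * Re (?z p)) ^ n = complex_of_real \<rho> ^ n * (?z p + cnj (?z p)) ^ n"
        by (simp only: power_mult_distrib)
      then have "complex_of_real ((2 * \<rho> * Re (?z p)) ^ n / fact n) = complex_of_real (\<rho> ^ n / fact n) * (?z p + cnj (?z p)) ^ n"
        by (simp only: of_real_divide of_real_power times_divide_eq_left)
      then have "?t n p = complex_of_real (\<rho> ^ n / fact n) * ((?z p + cnj (?z p)) ^ n * sgn (?z p))"
        by (simp only: mult.assoc)
      also have "(?z p + cnj (?z p)) ^ n * sgn (?z p) = (\<Sum>k\<le>n. of_nat (n choose k) * ?m k (n - k) p)"
        unfolding binomial_ring sum_distrib_right by (intro sum.cong refl) (simp only: mult_ac)
      finally show ?thesis .
    qed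
    then have "c n = complex_of_real (\<rho> ^ n / fact n) * (\<Sum>k\<le>n. of_nat (n choose k) * (LINT p|std_complex_normal_pair. ?m k (n - k) p))"
      unfolding c_def
      by (simp only: integral_mult_right_zero Bochner_Integration.integral_sum[OF integrable_mult_right[OF mint]])
    then show ?thesis by (simp only: std_complex_normal_pair_phase_moment)
  qed
  have c_odd: "c (2 * j + 1) = complex_of_real (\<rho> ^ (2 * j + 1) * (Gamma (real j + 3 / 2))\<^sup>2 / (fact j * fact (Suc j)))" for j
  proof -
    have "(\<Sum>k\<le>2*j+1. of_nat (2*j+1 choose k) * (if 2*j+1 - k = Suc k then complex_of_real ((Gamma (real k + 3 / 2))\<^sup>2) else 0))
       = (\<Sum>k\<le>2*j+1. if k = j then of_nat (2*j+1 choose k) * complex_of_real ((Gamma (real k + 3 / 2))\<^sup>2) else 0)"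
      by (intro sum.cong) auto
    also have "\<dots> = of_nat (2*j+1 choose j) * complex_of_real ((Gamma (real j + 3 / 2))\<^sup>2)" by simp
    finally have "c (2 * j + 1) = complex_of_real (\<rho> ^ (2*j+1) / fact (2*j+1)) * (of_nat (2*j+1 choose j) * complex_of_real ((Gamma (real j + 3 / 2))\<^sup>2))"
      unfolding c_val by simp
    moreover have "real (2*j+1 choose j) = fact (2*j+1) / (fact j * fact (Suc j))"
      using binomial_fact[of j "2*j+1", where 'a=real] by (simp add: algebra_simps)
    moreover have "r / f * (f / d * g) = r * g / d" if "f \<noteq> 0" for r f d g :: real
      using that by simp
    from this[OF fact_nonzero]
    have "complex_of_real (\<rho> ^ (2*j+1) / fact (2*j+1) * (fact (2*j+1) / (fact j * fact (Suc j)) * (Gamma (real j + 3 / 2))\<^sup>2))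
        = complex_of_real (\<rho> ^ (2 * j + 1) * (Gamma (real j + 3 / 2))\<^sup>2 / (fact j * fact (Suc j)))"
      by (rule arg_cong)
    ultimately show ?thesis
      by (metis of_real_mult of_real_of_nat_eq)
  qed
  have c_even: "c n = 0" if "n \<notin> range (\<lambda>j. 2 * j + 1)" for n
  proof -
    have "n - k \<noteq> Suc k" if "k \<le> n" for k
    proof
      assume "n - k = Suc k"
      then have "n = 2 * k + 1" using that by linarith
      then show False using \<open>n \<notin> range (\<lambda>j. 2 * j + 1)\<close> by blast
    qed
    then show ?thesis unfolding c_val by (auto intro!: sum.neutral)
  qed
  have "strict_mono (\<lambda>j::nat. 2 * j + 1)" by (auto simp: strict_mono_def)
  then have "(\<lambda>j. c (2 * j + 1)) sums (LINT p|std_complex_normal_pair. exp (2 * \<rho> * Re (?z p)) *\<^sub>R sgn (?z p))"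
    using c_even c_sums by (subst sums_mono_reindex) auto
  then show ?thesis by (simp only: c_odd)
qed

text \<open>
  The series of the previous lemma is \<open>\<rho>\<close> times the hypergeometric series, as \<open>Gamma (j + 2) = (j+1)!\<close>;
  the constant \<open>\<pi>/4\<close> is \<open>Gamma (3/2)\<^sup>2\<close>.
\<close>

theorem correlated_phase_expectation:
  assumes \<rho>: "0 \<le> \<rho>" "\<rho> < 1" and \<gamma>: "\<gamma> = sqrt (1 - \<rho>\<^sup>2)"
  shows "(LINT p|std_complex_normal_pair. sgn (fst p) * cnj (sgn (\<rho> *\<^sub>R fst p + \<gamma> *\<^sub>R snd p)))
    = complex_of_real (pi / 4 * (1 - \<rho>\<^sup>2) * \<rho> * hypergeom_2F1 (3/2) (3/2) 2 (\<rho>\<^sup>2))"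
proof -
  have cs: "cnj (sgn z) = sgn (cnj z)" for z by (simp add: sgn_eq)
  have "(LINT p|std_complex_normal_pair. sgn (fst p) * cnj (sgn (\<rho> *\<^sub>R fst p + \<gamma> *\<^sub>R snd p)))
      = (1 - \<rho>\<^sup>2) *\<^sub>R (LINT p|std_complex_normal_pair. exp (2 * \<rho> * Re (fst p * cnj (snd p))) *\<^sub>R (sgn (fst p) * cnj (sgn (snd p))))"
    by (rule correlated_pair_tilt[OF _ _ \<rho> \<gamma>]) (auto simp: sgn_scaleR)
  also have "\<dots> = (1 - \<rho>\<^sup>2) *\<^sub>R (LINT p|std_complex_normal_pair. exp (2 * \<rho> * Re (fst p * cnj (snd p))) *\<^sub>R sgn (fst p * cnj (snd p)))"
    by (simp only: sgn_mult cs)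
  also have "(LINT p|std_complex_normal_pair. exp (2 * \<rho> * Re (fst p * cnj (snd p))) *\<^sub>R sgn (fst p * cnj (snd p)))
      = complex_of_real (pi / 4 * \<rho> * hypergeom_2F1 (3/2) (3/2) 2 (\<rho>\<^sup>2))" (is "?E = _")
  proof -
    let ?a = "\<lambda>j. \<rho> ^ (2 * j + 1) * (Gamma (real j + 3 / 2))\<^sup>2 / (fact j * fact (Suc j))"
    let ?b = "\<lambda>k. Gamma (real k + 3/2) * Gamma (real k + 3/2) / Gamma (real k + 2) * ((\<rho>\<^sup>2) ^ k / fact k)"
    have ab: "?a k = \<rho> * ?b k" for k
      using Gamma_fact[of "Suc k", where 'a=real]
      by (simp add: power2_eq_square power_mult field_simps)
    have E: "?E = (\<Sum>j. complex_of_real (?a j))"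
      using phase_exp_sums[OF \<rho>] by (simp only: sums_unique)
    have "summable ?a"
      using phase_exp_sums[OF \<rho>] by (simp only: sums_summable summable_complex_of_real[symmetric])
    have "(1/2 :: real) \<notin> \<int>\<^sub>\<le>\<^sub>0" by (auto dest: nonpos_Ints_nonpos)
    from Gamma_plus1[OF this] have "Gamma (3/2 :: real) = sqrt pi / 2"
      using Gamma_one_half_real by simp
    then have G32: "Gamma (3/2 :: real) * Gamma (3/2) = pi / 4"
      by (simp only: times_divide_times_eq real_sqrt_mult_self) simp
    have "(\<Sum>j. ?a j) = \<rho> * (\<Sum>k. ?b k)"
    proof (cases "\<rho> = 0")
      case False
      then have "summable ?b" using \<open>summable ?a\<close> unfolding ab
        by (simp only: summable_cmult_iff simp_thms)
      then show ?thesis unfolding ab by (rule suminf_mult)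
    qed simp
    also have "\<dots> = pi / 4 * \<rho> * hypergeom_2F1 (3/2) (3/2) 2 (\<rho>\<^sup>2)"
      unfolding hypergeom_2F1_def G32 using Gamma_fact[of 1, where 'a=real] by simp
    finally show ?thesis unfolding E by (simp only: suminf_of_real[OF \<open>summable ?a\<close>, symmetric])
  qed
  finally show ?thesis by (simp add: scaleR_conv_of_real mult_ac)
qed

text \<open>
  The common rotation by \<open>\<i>\<close> preserves the law of the pair but multiplies the integrand by
  \<open>\<i> * \<i> = -1\<close>.
\<close>

lemma std_complex_normal_pair_sum_phase:
  "(LINT p|std_complex_normal_pair. sgn (fst p) * sgn (complex_of_real a * fst p + complex_of_real b * snd p)) = 0"
proof -
  let ?F = "\<lambda>u v. sgn u * sgn (complex_of_real a * u + complex_of_real b * v)"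
  have "?F (\<i> * u) (\<i> * v) = - ?F u v" for u v
  proof -
    have "complex_of_real a * (\<i> * u) + complex_of_real b * (\<i> * v) = \<i> * (complex_of_real a * u + complex_of_real b * v)"
      by (simp add: algebra_simps)
    moreover have "sgn \<i> = \<i>" by (simp add: sgn_eq)
    moreover have "\<i> * x * (\<i> * y) = - (x * y)" for x y by (simp add: algebra_simps)
    ultimately show ?thesis by (simp only: sgn_mult)
  qed
  moreover have "(LINT p|std_complex_normal_pair. ?F (\<i> * fst p) (\<i> * snd p)) = (LINT p|std_complex_normal_pair. ?F (fst p) (snd p))"
    by (rule std_complex_normal_pair_rotate) auto
  ultimately have "- (LINT p|std_complex_normal_pair. ?F (fst p) (snd p)) = (LINT p|std_complex_normal_pair. ?F (fst p) (snd p))"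
    by (simp only: Bochner_Integration.integral_minus)
  moreover have "- x = x \<Longrightarrow> x = 0" for x :: complex
    by (simp add: complex_eq_iff)
  ultimately show ?thesis by blast
qed

section \<open>Mean-square limits of Gaussian variables\<close>

lemma gaussian_rv_square_integrable:
  assumes "prob_space M" and X: "gaussian_rv M X"
  shows "integrable M (\<lambda>w. (X w)\<^sup>2)"
proof -
  interpret prob_space M by fact
  have [measurable]: "X \<in> borel_measurable M" using X by (simp add: gaussian_rv_def)
  from X consider \<mu> \<sigma> where "\<sigma> > 0" "distributed M lborel X (\<lambda>x. ennreal (normal_density \<mu> \<sigma> x))"
    | \<mu> where "AE w in M. X w = \<mu>"
    unfolding gaussian_rv_def by blast
  then show ?thesis
  proof cases
    case 1
    have "integrable lborel (\<lambda>x. normal_density \<mu> \<sigma> x * (x - \<mu>)\<^sup>2)"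
      "integrable lborel (\<lambda>x. normal_density \<mu> \<sigma> x * x)" "integrable lborel (normal_density \<mu> \<sigma>)"
      using integrable_normal_moment[OF 1(1), of \<mu> 2] integrable_normal_moment_nz_1[OF 1(1), of \<mu>] 1(1) by simp_all
    then have "integrable lborel (\<lambda>x. normal_density \<mu> \<sigma> x * (x - \<mu>)\<^sup>2 + 2 * \<mu> * (normal_density \<mu> \<sigma> x * x) - \<mu>\<^sup>2 * normal_density \<mu> \<sigma> x)"
      by (intro Bochner_Integration.integrable_diff Bochner_Integration.integrable_add integrable_mult_right)
    also have "(\<lambda>x. normal_density \<mu> \<sigma> x * (x - \<mu>)\<^sup>2 + 2 * \<mu> * (normal_density \<mu> \<sigma> x * x) - \<mu>\<^sup>2 * normal_density \<mu> \<sigma> x)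
        = (\<lambda>x. normal_density \<mu> \<sigma> x * x\<^sup>2)"
      by (simp add: fun_eq_iff power2_eq_square algebra_simps)
    finally show ?thesis
      using distributed_integrable[OF 1(2), of "\<lambda>x. x\<^sup>2"] 1(1) by simp
  next
    case 2
    have "integrable M (\<lambda>w. \<mu>\<^sup>2)" by simp
    then show ?thesis
      by (rule integrable_cong_AE_imp) (use 2 in auto)
  qed
qed

lemma gaussian_rv_charfun:
  assumes "prob_space M" and X: "gaussian_rv M X"
  shows "(LINT w|M. exp (\<i> * complex_of_real (X w)))
    = exp (\<i> * complex_of_real (LINT w|M. X w) - complex_of_real (((LINT w|M. (X w)\<^sup>2) - (LINT w|M. X w)\<^sup>2) / 2))"
proof -
  interpret prob_space M by fact
  have [measurable]: "X \<in> borel_measurable M" using X by (simp add: gaussian_rv_def)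
  have sq: "integrable M (\<lambda>w. (X w)\<^sup>2)" by (rule gaussian_rv_square_integrable[OF assms])
  then have i1: "integrable M X" by (rule square_integrable_imp_integrable[rotated]) simp
  have var: "variance X = (LINT w|M. (X w)\<^sup>2) - (LINT w|M. X w)\<^sup>2"
    by (rule variance_eq[OF i1 sq])
  from X consider \<mu> \<sigma> where "\<sigma> > 0" "distributed M lborel X (\<lambda>x. ennreal (normal_density \<mu> \<sigma> x))"
    | \<mu> where "AE w in M. X w = \<mu>"
    unfolding gaussian_rv_def by blast
  then show ?thesis
  proof cases
    case 1
    have v: "(LINT w|M. (X w)\<^sup>2) - (LINT w|M. X w)\<^sup>2 = \<sigma>\<^sup>2"
      using normal_distributed_variance[OF 1] var by simp
    have e: "(LINT w|M. X w) = \<mu>" by (rule normal_distributed_expectation[OF 1])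
    show ?thesis unfolding v unfolding e using normal_charfun[OF 1, of 1] by simp
  next
    case 2
    have "(LINT w|M. exp (\<i> * complex_of_real (X w))) = (LINT w|M. exp (\<i> * complex_of_real \<mu>))"
      by (rule integral_cong_AE) (use 2 in auto)
    moreover have "(LINT w|M. X w) = (LINT w|M. \<mu>)"
      by (rule integral_cong_AE) (use 2 in auto)
    moreover have "(LINT w|M. (X w)\<^sup>2) = (LINT w|M. \<mu>\<^sup>2)"
      by (rule integral_cong_AE) (use 2 in auto)
    ultimately show ?thesis by (simp add: prob_space)
  qed
qed

lemma integrable_mult_square_integrable:
  fixes X Y :: "'a \<Rightarrow> 'b::{real_normed_field, second_countable_topology, banach}"
  assumes [measurable]: "X \<in> borel_measurable M" "Y \<in> borel_measurable M"
    and "integrable M (\<lambda>w. (norm (X w))\<^sup>2)" "integrable M (\<lambda>w. (norm (Y w))\<^sup>2)"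
  shows "integrable M (\<lambda>w. X w * Y w)"
proof (rule Bochner_Integration.integrable_bound)
  show "integrable M (\<lambda>w. (norm (X w))\<^sup>2 + (norm (Y w))\<^sup>2)" using assms by simp
  show "AE w in M. norm (X w * Y w) \<le> norm ((norm (X w))\<^sup>2 + (norm (Y w))\<^sup>2)"
  proof (rule AE_I2)
    fix w
    have "2 * norm (X w) * norm (Y w) \<le> (norm (X w))\<^sup>2 + (norm (Y w))\<^sup>2" by (rule sum_squares_bound)
    moreover have "0 \<le> norm (X w) * norm (Y w)" by simp
    ultimately have "norm (X w * Y w) \<le> (norm (X w))\<^sup>2 + (norm (Y w))\<^sup>2"
      unfolding norm_mult by linarith
    then show "norm (X w * Y w) \<le> norm ((norm (X w))\<^sup>2 + (norm (Y w))\<^sup>2)" by simp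
  qed
qed measurable

lemma Cauchy_Schwarz_integral:
  fixes X Y :: "'a \<Rightarrow> real"
  assumes [measurable]: "X \<in> borel_measurable M" "Y \<in> borel_measurable M"
    and iX: "integrable M (\<lambda>w. (X w)\<^sup>2)" and iY: "integrable M (\<lambda>w. (Y w)\<^sup>2)"
  shows "(LINT w|M. X w * Y w)\<^sup>2 \<le> (LINT w|M. (X w)\<^sup>2) * (LINT w|M. (Y w)\<^sup>2)"
proof -
  have int: "integrable M (\<lambda>w. X w * Y w)"
    by (rule integrable_mult_square_integrable) (use iX iY in auto)
  have "ennreal \<bar>LINT w|M. X w * Y w\<bar> \<le> (\<integral>\<^sup>+w. norm (X w * Y w) \<partial>M)"
    using integral_norm_bound_ennreal[OF int] by simp
  also have "\<dots> = (\<integral>\<^sup>+w. ennreal \<bar>X w\<bar> * ennreal \<bar>Y w\<bar> \<partial>M)"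
    by (simp add: abs_mult ennreal_mult)
  finally have "(ennreal \<bar>LINT w|M. X w * Y w\<bar>)\<^sup>2 \<le> (\<integral>\<^sup>+w. ennreal \<bar>X w\<bar> * ennreal \<bar>Y w\<bar> \<partial>M)\<^sup>2"
    by (rule power_mono) simp
  also have "\<dots> \<le> (\<integral>\<^sup>+w. (ennreal \<bar>X w\<bar>)\<^sup>2 \<partial>M) * (\<integral>\<^sup>+w. (ennreal \<bar>Y w\<bar>)\<^sup>2 \<partial>M)"
    by (rule Cauchy_Schwarz_nn_integral) auto
  also have "\<dots> = ennreal (LINT w|M. (X w)\<^sup>2) * ennreal (LINT w|M. (Y w)\<^sup>2)"
    using iX iY by (simp add: ennreal_power nn_integral_eq_integral)
  also have "\<dots> = ennreal ((LINT w|M. (X w)\<^sup>2) * (LINT w|M. (Y w)\<^sup>2))"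
    by (simp add: ennreal_mult)
  finally show ?thesis
    by (simp add: ennreal_power)
qed

text \<open>
  Mean-square convergence transports mean, second moment and characteristic function at once, so the
  Gaussian formula for the characteristic function passes to the limit. This form of closedness is all that
  later arguments require; degenerate limits are included.
\<close>

lemma gaussian_L2_limit_charfun:
  fixes Y :: "'a \<Rightarrow> real" and S :: "nat \<Rightarrow> 'a \<Rightarrow> real"
  assumes M: "prob_space M" and S: "\<And>n. gaussian_rv M (S n)"
    and [measurable]: "Y \<in> borel_measurable M" and Y2: "integrable M (\<lambda>w. (Y w)\<^sup>2)"
    and lim: "(\<lambda>n. LINT w|M. (Y w - S n w)\<^sup>2) \<longlonglongrightarrow> 0"
  shows "(LINT w|M. exp (\<i> * complex_of_real (Y w)))
    = exp (\<i> * complex_of_real (LINT w|M. Y w) - complex_of_real (((LINT w|M. (Y w)\<^sup>2) - (LINT w|M. Y w)\<^sup>2) / 2))"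
proof -
  interpret prob_space M by fact
  have [measurable]: "S n \<in> borel_measurable M" for n using S[of n] by (simp add: gaussian_rv_def)
  have S2: "integrable M (\<lambda>w. (S n w)\<^sup>2)" for n by (rule gaussian_rv_square_integrable[OF M S])
  have S1: "integrable M (S n)" for n by (rule square_integrable_imp_integrable[OF _ S2]) simp
  have Y1: "integrable M Y" by (rule square_integrable_imp_integrable[OF _ Y2]) simp
  have YS: "integrable M (\<lambda>w. Y w * S n w)" for n
    by (rule integrable_mult_square_integrable) (use Y2 S2 in auto)
  let ?D = "\<lambda>n w. Y w - S n w"
  have D2: "integrable M (\<lambda>w. (?D n w)\<^sup>2)" for n
    unfolding power2_diff using Y2 S2 YS by (simp add: mult.assoc)
  have D1: "integrable M (\<lambda>w. \<bar>?D n w\<bar>)" for n using Y1 S1 by simp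
  have sq_le: "\<bar>x\<bar> \<le> sqrt a" if "x\<^sup>2 \<le> a" for x a :: real
    using that real_sqrt_le_mono[OF that] by simp
  have lim_sqrt: "(\<lambda>n. sqrt (c * (LINT w|M. (?D n w)\<^sup>2))) \<longlonglongrightarrow> 0" for c
    using tendsto_real_sqrt[OF tendsto_mult_right_zero[OF lim, of c]] by simp
  have L1: "(LINT w|M. \<bar>?D n w\<bar>) \<le> sqrt (1 * (LINT w|M. (?D n w)\<^sup>2))" for n
  proof -
    have "(LINT w|M. \<bar>?D n w\<bar> * 1)\<^sup>2 \<le> (LINT w|M. \<bar>?D n w\<bar>\<^sup>2) * (LINT w|M. 1\<^sup>2)"
      by (rule Cauchy_Schwarz_integral) (use D2 in auto)
    then show ?thesis using sq_le by (auto simp: prob_space intro: order_trans[OF abs_ge_self])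
  qed
  have "(\<lambda>n. LINT w|M. S n w) \<longlonglongrightarrow> (LINT w|M. Y w)"
  proof (rule LIM_zero_cancel, rule Lim_null_comparison[OF always_eventually lim_sqrt[of 1]], rule allI)
    fix n
    have "(LINT w|M. S n w) - (LINT w|M. Y w) = (LINT w|M. - ?D n w)" using S1 Y1 by simp
    then have "norm ((LINT w|M. S n w) - (LINT w|M. Y w)) \<le> (LINT w|M. norm (- ?D n w))"
      by (simp only: integral_norm_bound)
    then have "norm ((LINT w|M. S n w) - (LINT w|M. Y w)) \<le> (LINT w|M. \<bar>?D n w\<bar>)"
      by (simp only: real_norm_def abs_minus_cancel)
    with L1[of n] show "norm ((LINT w|M. S n w) - (LINT w|M. Y w)) \<le> sqrt (1 * (LINT w|M. (?D n w)\<^sup>2))" by simp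
  qed
  moreover have "(\<lambda>n. LINT w|M. (S n w)\<^sup>2) \<longlonglongrightarrow> (LINT w|M. (Y w)\<^sup>2)"
  proof -
    have YD: "(\<lambda>n. LINT w|M. Y w * ?D n w) \<longlonglongrightarrow> 0"
    proof (rule Lim_null_comparison[OF always_eventually lim_sqrt[of "LINT w|M. (Y w)\<^sup>2"]], rule allI)
      fix n show "norm (LINT w|M. Y w * ?D n w) \<le> sqrt ((LINT w|M. (Y w)\<^sup>2) * (LINT w|M. (?D n w)\<^sup>2))"
        unfolding real_norm_def by (rule sq_le, rule Cauchy_Schwarz_integral) (use D2 Y2 in auto)
    qed
    have eq: "(LINT w|M. (S n w)\<^sup>2) = (LINT w|M. (Y w)\<^sup>2) + (LINT w|M. (?D n w)\<^sup>2) - 2 * (LINT w|M. Y w * ?D n w)" for n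
    proof -
      have iYD: "integrable M (\<lambda>w. Y w * ?D n w)"
        by (rule integrable_mult_square_integrable) (use D2 Y2 in auto)
      have "(LINT w|M. (S n w)\<^sup>2) = (LINT w|M. (Y w)\<^sup>2 + (?D n w)\<^sup>2 - 2 * (Y w * ?D n w))"
        by (intro Bochner_Integration.integral_cong) (auto simp: power2_eq_square algebra_simps)
      then show ?thesis using iYD D2 Y2 by simp
    qed
    show ?thesis unfolding eq using tendsto_diff[OF tendsto_add[OF tendsto_const lim] tendsto_mult_left[OF YD]] by simp
  qed
  ultimately have "(\<lambda>n. exp (\<i> * complex_of_real (LINT w|M. S n w) - complex_of_real (((LINT w|M. (S n w)\<^sup>2) - (LINT w|M. S n w)\<^sup>2) / 2)))
     \<longlonglongrightarrow> exp (\<i> * complex_of_real (LINT w|M. Y w) - complex_of_real (((LINT w|M. (Y w)\<^sup>2) - (LINT w|M. Y w)\<^sup>2) / 2))"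
    by (intro tendsto_intros) simp_all
  then have a: "(\<lambda>n. LINT w|M. exp (\<i> * complex_of_real (S n w)))
     \<longlonglongrightarrow> exp (\<i> * complex_of_real (LINT w|M. Y w) - complex_of_real (((LINT w|M. (Y w)\<^sup>2) - (LINT w|M. Y w)\<^sup>2) / 2))"
    by (simp only: gaussian_rv_charfun[OF M S])
  have b: "(\<lambda>n. LINT w|M. exp (\<i> * complex_of_real (S n w))) \<longlonglongrightarrow> (LINT w|M. exp (\<i> * complex_of_real (Y w)))"
  proof (rule LIM_zero_cancel, rule Lim_null_comparison[OF always_eventually lim_sqrt[of 1]], rule allI)
    fix n
    have iS: "integrable M (\<lambda>w. exp (\<i> * complex_of_real (S n w)))" and iY: "integrable M (\<lambda>w. exp (\<i> * complex_of_real (Y w)))"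
      by (rule integrable_const_bound[where B=1]; simp)+
    have "norm ((LINT w|M. exp (\<i> * complex_of_real (S n w))) - (LINT w|M. exp (\<i> * complex_of_real (Y w))))
        = norm (LINT w|M. exp (\<i> * complex_of_real (S n w)) - exp (\<i> * complex_of_real (Y w)))"
      using iS iY by simp
    also have "\<dots> \<le> (LINT w|M. norm (exp (\<i> * complex_of_real (S n w)) - exp (\<i> * complex_of_real (Y w))))"
      by (rule integral_norm_bound)
    also have "\<dots> \<le> (LINT w|M. \<bar>?D n w\<bar>)"
    proof (rule integral_mono)
      show "integrable M (\<lambda>w. norm (exp (\<i> * complex_of_real (S n w)) - exp (\<i> * complex_of_real (Y w))))"
        using iS iY by simp
      fix w
      have "exp (\<i> * complex_of_real (S n w)) - exp (\<i> * complex_of_real (Y w))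
          = exp (\<i> * complex_of_real (Y w)) * (exp (\<i> * complex_of_real (S n w - Y w)) - 1)"
        by (simp add: ring_distribs exp_add[symmetric])
      then have "norm (exp (\<i> * complex_of_real (S n w)) - exp (\<i> * complex_of_real (Y w)))
          = norm (exp (\<i> * complex_of_real (S n w - Y w)) - 1)" by (simp add: norm_mult)
      also have "\<dots> \<le> \<bar>S n w - Y w\<bar>"
        using iexp_approx1[of "S n w - Y w" 0] by simp
      finally show "norm (exp (\<i> * complex_of_real (S n w)) - exp (\<i> * complex_of_real (Y w))) \<le> \<bar>?D n w\<bar>"
        by simp
    qed (rule D1)
    also note L1[of n]
    finally show "norm ((LINT w|M. exp (\<i> * complex_of_real (S n w))) - (LINT w|M. exp (\<i> * complex_of_real (Y w))))
      \<le> sqrt (1 * (LINT w|M. (?D n w)\<^sup>2))" .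
  qed
  from LIMSEQ_unique[OF b a] show ?thesis .
qed

section \<open>Path integrals of a stationary Gaussian process\<close>

locale stationary_gaussian_process = prob_space M
  for M :: "'w measure" and \<Phi> :: "real \<Rightarrow> 'w \<Rightarrow> real" and C :: "real \<Rightarrow> real" and F :: "real measure" +
  assumes gaussian: "gaussian_process M \<Phi>"
    and measurable_process: "measurable_process M \<Phi>"
    and stationary: "stationary_with_covariance M \<Phi> C"
    and spectral: "spectral_measure F C"
begin

definition mean :: real where "mean = expectation (\<Phi> 0)"

definition path_integral :: "(real \<Rightarrow> 'b::{banach, second_countable_topology}) \<Rightarrow> 'w \<Rightarrow> 'b" where
  "path_integral h w = (LINT \<tau>|lborel. \<Phi> \<tau> w *\<^sub>R h \<tau>)"

lemma measurable_process' [measurable (raw)]: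
  assumes "f \<in> borel_measurable N" "g \<in> N \<rightarrow>\<^sub>M M"
  shows "(\<lambda>x. \<Phi> (f x) (g x)) \<in> borel_measurable N"
proof -
  have "(\<lambda>x. (f x, g x)) \<in> N \<rightarrow>\<^sub>M borel \<Otimes>\<^sub>M M" using assms by measurable
  from measurable_compose[OF this measurable_process[unfolded measurable_process_def]]
  show ?thesis by simp
qed

lemma measurable_at [measurable]: "\<Phi> t \<in> borel_measurable M"
  by (rule measurable_process'[of "\<lambda>_. t" M "\<lambda>w. w"]) simp_all

lemma gaussian_at: "gaussian_rv M (\<Phi> t)"
proof -
  have "gaussian_rv M (\<lambda>w. \<Sum>t\<in>{t}. 1 * \<Phi> t w)"
    by (rule gaussian[unfolded gaussian_process_def, rule_format]) simp
  then show ?thesis by simp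
qed

lemma square_integrable_at: "integrable M (\<lambda>w. (\<Phi> t w)\<^sup>2)"
  by (rule gaussian_rv_square_integrable[OF prob_space_axioms gaussian_at])

lemma integrable_at: "integrable M (\<Phi> t)"
  by (rule square_integrable_imp_integrable[OF measurable_at square_integrable_at])

lemma integrable_at_mult: "integrable M (\<lambda>w. \<Phi> s w * \<Phi> t w)"
  by (rule integrable_mult_square_integrable) (simp_all add: square_integrable_at)

lemma expectation_at: "expectation (\<Phi> t) = mean"
  using stationary unfolding stationary_with_covariance_def mean_def by metis

lemma expectation_at_mult: "expectation (\<lambda>w. \<Phi> s w * \<Phi> t w) = C (s - t) + mean\<^sup>2"
proof -
  have "C (s - t) = expectation (\<lambda>w. (\<Phi> s w - mean) * (\<Phi> t w - mean))"
    using stationary unfolding stationary_with_covariance_def covar_def expectation_at by metis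
  also have "\<dots> = expectation (\<lambda>w. \<Phi> s w * \<Phi> t w - mean * \<Phi> s w - mean * \<Phi> t w + mean\<^sup>2)"
    by (intro Bochner_Integration.integral_cong) (auto simp: power2_eq_square algebra_simps)
  also have "\<dots> = expectation (\<lambda>w. \<Phi> s w * \<Phi> t w) - mean * mean - mean * mean + mean\<^sup>2"
    using integrable_at_mult[of s t] integrable_at by (simp add: expectation_at prob_space)
  finally show ?thesis by (simp add: power2_eq_square)
qed

lemma expectation_at_square: "expectation (\<lambda>w. (\<Phi> t w)\<^sup>2) = C 0 + mean\<^sup>2"
  using expectation_at_mult[of t t] by (simp add: power2_eq_square)

lemma spectral_finite: "finite_measure F"
proof
  have "space F = UNIV" using spectral sets_eq_imp_space_eq[of F borel] by (simp add: spectral_measure_def)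
  then show "emeasure F (space F) \<noteq> \<infinity>" using spectral by (simp add: spectral_measure_def)
qed

lemma spectral_sets [measurable_cong, simp]: "sets F = sets borel"
  using spectral by (simp add: spectral_measure_def)

lemma covariance_spectral: "complex_of_real (C t) = (LINT \<xi>|F. exp (\<i> * complex_of_real (\<xi> * t)))"
  using spectral by (simp add: spectral_measure_def)

text \<open>
  Dominated convergence in the spectral representation. Together with stationarity this gives mean-square
  continuity of the process, and hence convergence of Riemann sums.
\<close>

lemma covariance_continuous:
  assumes "x \<longlonglongrightarrow> 0"
  shows "(\<lambda>n. C (x n)) \<longlonglongrightarrow> C 0"
proof -
  interpret F: finite_measure F by (rule spectral_finite)
  have "(\<lambda>n. LINT \<xi>|F. exp (\<i> * complex_of_real (\<xi> * x n))) \<longlonglongrightarrow> (LINT \<xi>|F. exp (\<i> * complex_of_real (\<xi> * 0)))"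
  proof (rule integral_dominated_convergence[where w="\<lambda>_. 1"])
    show "AE \<xi> in F. (\<lambda>n. exp (\<i> * complex_of_real (\<xi> * x n))) \<longlonglongrightarrow> exp (\<i> * complex_of_real (\<xi> * 0))"
      by (intro AE_I2 tendsto_intros assms)
  qed auto
  then show ?thesis
    unfolding covariance_spectral[symmetric] by (simp only: tendsto_of_real_iff)
qed

lemma path_integral_measurable [measurable]:
  assumes [measurable]: "h \<in> borel_measurable borel"
  shows "path_integral h \<in> borel_measurable M"
  unfolding path_integral_def by measurable

lemma expectation_norm_mult_le:
  fixes Z :: "'w \<Rightarrow> complex"
  assumes [measurable]: "Z \<in> borel_measurable M" and Z: "integrable M (\<lambda>w. (cmod (Z w))\<^sup>2)"
  shows "integrable M (\<lambda>w. \<Phi> t w *\<^sub>R Z w)"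
    "expectation (\<lambda>w. norm (\<Phi> t w *\<^sub>R Z w)) \<le> C 0 + mean\<^sup>2 + expectation (\<lambda>w. (cmod (Z w))\<^sup>2)"
proof -
  have le: "norm (\<Phi> t w *\<^sub>R Z w) \<le> (\<Phi> t w)\<^sup>2 + (cmod (Z w))\<^sup>2" for w
  proof -
    have "2 * \<bar>\<Phi> t w\<bar> * cmod (Z w) \<le> \<bar>\<Phi> t w\<bar>\<^sup>2 + (cmod (Z w))\<^sup>2" by (rule sum_squares_bound)
    moreover have "0 \<le> \<bar>\<Phi> t w\<bar> * cmod (Z w)" by simp
    ultimately show ?thesis unfolding norm_scaleR power2_abs by linarith
  qed
  have int: "integrable M (\<lambda>w. (\<Phi> t w)\<^sup>2 + (cmod (Z w))\<^sup>2)" using square_integrable_at Z by simp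
  show 1: "integrable M (\<lambda>w. \<Phi> t w *\<^sub>R Z w)"
  proof (rule Bochner_Integration.integrable_bound[OF int])
    show "AE w in M. norm (\<Phi> t w *\<^sub>R Z w) \<le> norm ((\<Phi> t w)\<^sup>2 + (cmod (Z w))\<^sup>2)"
      using le by (intro AE_I2) (metis abs_ge_self order_trans real_norm_def)
  qed measurable
  have "expectation (\<lambda>w. norm (\<Phi> t w *\<^sub>R Z w)) \<le> expectation (\<lambda>w. (\<Phi> t w)\<^sup>2 + (cmod (Z w))\<^sup>2)"
    by (rule integral_mono[OF integrable_norm[OF 1] int le])
  then show "expectation (\<lambda>w. norm (\<Phi> t w *\<^sub>R Z w)) \<le> C 0 + mean\<^sup>2 + expectation (\<lambda>w. (cmod (Z w))\<^sup>2)"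
    using square_integrable_at Z by (simp add: expectation_at_square)
qed

text \<open>
  The one exchange of expectation and time integration from which the moments of path integrals are
  computed: \<open>Z = 1\<close> gives means and absolute convergence of almost every path integral, and a second
  path integral in the place of \<open>Z\<close> gives mixed second moments by iteration.
\<close>

lemma path_integral_Fubini:
  fixes h Z :: "_ \<Rightarrow> complex"
  assumes h: "integrable lborel h"
    and [measurable]: "Z \<in> borel_measurable M" and Z: "integrable M (\<lambda>w. (cmod (Z w))\<^sup>2)"
  shows "AE w in M. integrable lborel (\<lambda>\<tau>. Z w * (\<Phi> \<tau> w *\<^sub>R h \<tau>))"
    and "expectation (\<lambda>w. Z w * path_integral h w) = (LINT \<tau>|lborel. h \<tau> * expectation (\<lambda>w. \<Phi> \<tau> w *\<^sub>R Z w))"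
proof -
  interpret P: pair_sigma_finite lborel M ..
  have [measurable]: "h \<in> borel_measurable borel" using h by auto
  let ?f = "\<lambda>\<tau> w. Z w * (\<Phi> \<tau> w *\<^sub>R h \<tau>)"
  let ?B = "C 0 + mean\<^sup>2 + expectation (\<lambda>w. (cmod (Z w))\<^sup>2)"
  have f: "?f \<tau> w = h \<tau> * (\<Phi> \<tau> w *\<^sub>R Z w)" for \<tau> w by simp
  have int: "integrable (lborel \<Otimes>\<^sub>M M) (\<lambda>(\<tau>, w). ?f \<tau> w)"
  proof (rule P.Fubini_integrable)
    show "AE \<tau> in lborel. integrable M (\<lambda>w. case (\<tau>, w) of (\<tau>, w) \<Rightarrow> ?f \<tau> w)"
      unfolding prod.case f by (intro AE_I2 integrable_mult_right expectation_norm_mult_le Z) simp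
    have "norm (expectation (\<lambda>w. norm (?f \<tau> w))) \<le> norm (?B * cmod (h \<tau>))" for \<tau>
    proof -
      have "expectation (\<lambda>w. norm (?f \<tau> w)) = cmod (h \<tau>) * expectation (\<lambda>w. norm (\<Phi> \<tau> w *\<^sub>R Z w))"
        unfolding f norm_mult by (rule integral_mult_right_zero)
      also have "\<dots> \<le> cmod (h \<tau>) * ?B"
        by (intro mult_left_mono expectation_norm_mult_le Z) simp_all
      finally have "expectation (\<lambda>w. norm (?f \<tau> w)) \<le> ?B * cmod (h \<tau>)" by (simp only: mult.commute)
      moreover have "0 \<le> expectation (\<lambda>w. norm (?f \<tau> w))" by simp
      ultimately show ?thesis unfolding real_norm_def by linarith
    qed
    then show "integrable lborel (\<lambda>\<tau>. expectation (\<lambda>w. norm (case (\<tau>, w) of (\<tau>, w) \<Rightarrow> ?f \<tau> w)))"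
      unfolding prod.case
      by (intro Bochner_Integration.integrable_bound[OF integrable_mult_right[OF integrable_norm[OF h], of ?B]] AE_I2) measurable
  qed measurable
  show "AE w in M. integrable lborel (\<lambda>\<tau>. ?f \<tau> w)"
    by (rule P.AE_integrable_snd[OF int])
  have "expectation (\<lambda>w. Z w * path_integral h w) = expectation (\<lambda>w. LINT \<tau>|lborel. ?f \<tau> w)"
    unfolding path_integral_def by (simp only: integral_mult_right_zero)
  also have "\<dots> = (LINT \<tau>|lborel. expectation (\<lambda>w. ?f \<tau> w))"
    by (rule P.Fubini_integral[OF int])
  finally show "expectation (\<lambda>w. Z w * path_integral h w) = (LINT \<tau>|lborel. h \<tau> * expectation (\<lambda>w. \<Phi> \<tau> w *\<^sub>R Z w))"
    unfolding f by (simp only: integral_mult_right_zero)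
qed

lemma path_integrable:
  fixes h :: "real \<Rightarrow> complex"
  assumes "integrable lborel h"
  shows "AE w in M. integrable lborel (\<lambda>\<tau>. \<Phi> \<tau> w *\<^sub>R h \<tau>)"
  using path_integral_Fubini(1)[OF assms, of "\<lambda>_. 1"] by simp

lemma expectation_path_integral:
  fixes h :: "real \<Rightarrow> complex"
  assumes "integrable lborel h"
  shows "expectation (path_integral h) = mean *\<^sub>R (LINT \<tau>|lborel. h \<tau>)"
proof -
  have "expectation (\<lambda>w. complex_of_real (\<Phi> \<tau> w)) = complex_of_real mean" for \<tau>
    by (simp add: expectation_at)
  then show ?thesis
    using path_integral_Fubini(2)[OF assms, of "\<lambda>_. 1"]
    by (simp add: scaleR_conv_of_real mult.commute)
qed

end

text \<open>
  Cauchy--Schwarz along each path for the weight \<open>|h|\<close>, followed by Tonelli. Applied to the process it shows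
  that path integrals are square-integrable; applied to the error of a discretisation it bounds the error of
  the Riemann sum.
\<close>

lemma square_integral_weighted_le:
  fixes D :: "real \<Rightarrow> 'w \<Rightarrow> real" and h :: "real \<Rightarrow> 'b::{banach, second_countable_topology}"
  assumes "prob_space M" and [measurable]: "(\<lambda>(\<tau>, w). D \<tau> w) \<in> borel_measurable (borel \<Otimes>\<^sub>M M)" "h \<in> borel_measurable borel"
  shows "(\<integral>\<^sup>+ w. ennreal ((norm (LINT \<tau>|lborel. D \<tau> w *\<^sub>R h \<tau>))\<^sup>2) \<partial>M)
     \<le> (\<integral>\<^sup>+ \<tau>. ennreal (norm (h \<tau>)) \<partial>lborel) * (\<integral>\<^sup>+ \<tau>. ennreal (norm (h \<tau>)) * (\<integral>\<^sup>+ w. ennreal ((D \<tau> w)\<^sup>2) \<partial>M) \<partial>lborel)"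
proof -
  interpret prob_space M by fact
  interpret P: pair_sigma_finite lborel M ..
  let ?H = "\<integral>\<^sup>+ \<tau>. ennreal (norm (h \<tau>)) \<partial>lborel"
  have pt: "ennreal ((norm (LINT \<tau>|lborel. D \<tau> w *\<^sub>R h \<tau>))\<^sup>2) \<le> ?H * (\<integral>\<^sup>+ \<tau>. ennreal (norm (h \<tau>)) * ennreal ((D \<tau> w)\<^sup>2) \<partial>lborel)"
    if [measurable]: "w \<in> space M" for w
  proof (cases "integrable lborel (\<lambda>\<tau>. D \<tau> w *\<^sub>R h \<tau>)")
    case True
    have [measurable]: "(\<lambda>\<tau>. D \<tau> w) \<in> borel_measurable borel"
      using measurable_compose[OF measurable_Pair2'[OF that] assms(2)] by simp
    have "ennreal (norm (LINT \<tau>|lborel. D \<tau> w *\<^sub>R h \<tau>)) \<le> (\<integral>\<^sup>+ \<tau>. norm (D \<tau> w *\<^sub>R h \<tau>) \<partial>lborel)"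
      by (rule integral_norm_bound_ennreal[OF True])
    also have "\<dots> = (\<integral>\<^sup>+ \<tau>. ennreal (sqrt (norm (h \<tau>))) * ennreal (sqrt (norm (h \<tau>)) * \<bar>D \<tau> w\<bar>) \<partial>lborel)"
      by (intro nn_integral_cong) (simp add: ennreal_mult'[symmetric] mult_ac)
    finally have "(ennreal (norm (LINT \<tau>|lborel. D \<tau> w *\<^sub>R h \<tau>)))\<^sup>2
       \<le> (\<integral>\<^sup>+ \<tau>. ennreal (sqrt (norm (h \<tau>))) * ennreal (sqrt (norm (h \<tau>)) * \<bar>D \<tau> w\<bar>) \<partial>lborel)\<^sup>2"
      by (rule power_mono) simp
    also have "\<dots> \<le> (\<integral>\<^sup>+ \<tau>. (ennreal (sqrt (norm (h \<tau>))))\<^sup>2 \<partial>lborel) * (\<integral>\<^sup>+ \<tau>. (ennreal (sqrt (norm (h \<tau>)) * \<bar>D \<tau> w\<bar>))\<^sup>2 \<partial>lborel)"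
      by (rule Cauchy_Schwarz_nn_integral) auto
    also have "\<dots> = ?H * (\<integral>\<^sup>+ \<tau>. ennreal (norm (h \<tau>)) * ennreal ((D \<tau> w)\<^sup>2) \<partial>lborel)"
      by (simp add: ennreal_power power_mult_distrib ennreal_mult')
    finally show ?thesis by (simp add: ennreal_power)
  qed (simp add: not_integrable_integral_eq)
  have "(\<integral>\<^sup>+ w. ennreal ((norm (LINT \<tau>|lborel. D \<tau> w *\<^sub>R h \<tau>))\<^sup>2) \<partial>M)
     \<le> (\<integral>\<^sup>+ w. ?H * (\<integral>\<^sup>+ \<tau>. ennreal (norm (h \<tau>)) * ennreal ((D \<tau> w)\<^sup>2) \<partial>lborel) \<partial>M)"
    by (rule nn_integral_mono) (rule pt)
  also have "\<dots> = ?H * (\<integral>\<^sup>+ w. (\<integral>\<^sup>+ \<tau>. ennreal (norm (h \<tau>)) * ennreal ((D \<tau> w)\<^sup>2) \<partial>lborel) \<partial>M)"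
    by (rule nn_integral_cmult) measurable
  also have "(\<integral>\<^sup>+ w. (\<integral>\<^sup>+ \<tau>. ennreal (norm (h \<tau>)) * ennreal ((D \<tau> w)\<^sup>2) \<partial>lborel) \<partial>M)
      = (\<integral>\<^sup>+ \<tau>. (\<integral>\<^sup>+ w. ennreal (norm (h \<tau>)) * ennreal ((D \<tau> w)\<^sup>2) \<partial>M) \<partial>lborel)"
    by (rule P.Fubini') measurable
  also have "\<dots> = (\<integral>\<^sup>+ \<tau>. ennreal (norm (h \<tau>)) * (\<integral>\<^sup>+ w. ennreal ((D \<tau> w)\<^sup>2) \<partial>M) \<partial>lborel)"
  proof (intro nn_integral_cong nn_integral_cmult)
    fix \<tau>
    have [measurable]: "(\<lambda>w. D \<tau> w) \<in> borel_measurable M"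
      using measurable_compose[OF measurable_Pair1'[of \<tau> borel M] assms(2)] by simp
    show "(\<lambda>w. ennreal ((D \<tau> w)\<^sup>2)) \<in> borel_measurable M" by measurable
  qed
  finally show ?thesis .
qed

context stationary_gaussian_process begin

lemma nn_second_moment: "(\<integral>\<^sup>+ w. ennreal ((\<Phi> t w)\<^sup>2) \<partial>M) = ennreal (C 0 + mean\<^sup>2)"
  using square_integrable_at[of t] by (simp add: nn_integral_eq_integral expectation_at_square)

lemma path_integral_square_integrable:
  fixes h :: "real \<Rightarrow> 'b::{banach, second_countable_topology}"
  assumes h: "integrable lborel h"
  shows "integrable M (\<lambda>w. (norm (path_integral h w))\<^sup>2)"
proof (rule integrableI_bounded)
  have [measurable]: "h \<in> borel_measurable borel" using h by auto
  show "(\<lambda>w. (norm (path_integral h w))\<^sup>2) \<in> borel_measurable M" by measurable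
  have fin: "(\<integral>\<^sup>+ \<tau>. ennreal (norm (h \<tau>)) \<partial>lborel) < \<infinity>"
    using h by (simp add: integrable_iff_bounded)
  have "(\<integral>\<^sup>+ w. ennreal ((norm (path_integral h w))\<^sup>2) \<partial>M)
     \<le> (\<integral>\<^sup>+ \<tau>. ennreal (norm (h \<tau>)) \<partial>lborel) * (\<integral>\<^sup>+ \<tau>. ennreal (norm (h \<tau>)) * (\<integral>\<^sup>+ w. ennreal ((\<Phi> \<tau> w)\<^sup>2) \<partial>M) \<partial>lborel)"
    unfolding path_integral_def
    by (rule square_integral_weighted_le[OF prob_space_axioms]) measurable
  also have "\<dots> < \<infinity>"
    using fin unfolding nn_second_moment by (simp add: nn_integral_multc ennreal_mult_less_top)
  finally show "(\<integral>\<^sup>+ w. ennreal (norm ((norm (path_integral h w))\<^sup>2)) \<partial>M) < \<infinity>" by simp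
qed

lemma expectation_increment_square:
  "expectation (\<lambda>w. (\<Phi> s w - \<Phi> t w)\<^sup>2) = 2 * C 0 - 2 * C (s - t)"
proof -
  have "expectation (\<lambda>w. (\<Phi> s w - \<Phi> t w)\<^sup>2)
      = expectation (\<lambda>w. (\<Phi> s w)\<^sup>2 + (\<Phi> t w)\<^sup>2 - 2 * (\<Phi> s w * \<Phi> t w))"
    by (intro Bochner_Integration.integral_cong) (auto simp: power2_eq_square algebra_simps)
  also have "\<dots> = 2 * C 0 - 2 * C (s - t)"
    using square_integrable_at integrable_at_mult by (simp add: expectation_at_square expectation_at_mult)
  finally show ?thesis .
qed

lemma abs_covariance_le: "\<bar>C t\<bar> \<le> C 0"
proof -
  interpret F: finite_measure F by (rule spectral_finite)
  have "cmod (complex_of_real (C t)) \<le> (LINT \<xi>|F. norm (exp (\<i> * complex_of_real (\<xi> * t))))"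
    unfolding covariance_spectral by (rule integral_norm_bound)
  also have "\<dots> = (LINT \<xi>|F. 1)" by simp
  also have "\<dots> = C 0"
  proof -
    have "complex_of_real (C 0) = complex_of_real (measure F (space F))"
      using covariance_spectral[of 0] by (simp add: scaleR_conv_of_real)
    then show ?thesis by simp
  qed
  finally show ?thesis by simp
qed

text \<open>
  The Riemann sums use the mesh \<open>1 / (n+1)\<close>. Every time is rounded down to a multiple of the mesh, and the
  finite grid reaches up to \<open>\<plusminus> (n+1)\<close>, so each fixed time is eventually covered.
\<close>

definition grid :: "nat \<Rightarrow> real set" where
  "grid n = (\<lambda>k::int. of_int k / real (Suc n)) ` {- int (Suc n * Suc n)..int (Suc n * Suc n)}"

definition grid_point :: "nat \<Rightarrow> real \<Rightarrow> real" where
  "grid_point n \<tau> = of_int \<lfloor>real (Suc n) * \<tau>\<rfloor> / real (Suc n)"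

lemma finite_grid: "finite (grid n)"
  by (simp add: grid_def)

lemma grid_point_measurable [measurable]: "grid_point n \<in> borel_measurable borel"
  unfolding grid_point_def by measurable

lemma grid_point_tendsto: "(\<lambda>n. \<tau> - grid_point n \<tau>) \<longlonglongrightarrow> 0"
proof (rule Lim_null_comparison[OF always_eventually LIMSEQ_inverse_real_of_nat], rule allI)
  fix n
  have "\<bar>real (Suc n) * \<tau> - of_int \<lfloor>real (Suc n) * \<tau>\<rfloor>\<bar> \<le> 1" by linarith
  then have "\<bar>real (Suc n) * (\<tau> - grid_point n \<tau>)\<bar> \<le> 1"
    unfolding grid_point_def by (simp only: right_diff_distrib) simp
  then show "norm (\<tau> - grid_point n \<tau>) \<le> inverse (real (Suc n))"
    unfolding abs_mult by (simp add: field_simps)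
qed

lemma eventually_grid_point: "eventually (\<lambda>n. grid_point n \<tau> \<in> grid n) sequentially"
proof -
  obtain N where N: "\<bar>\<tau>\<bar> \<le> real N" using real_arch_simple by blast
  have "grid_point n \<tau> \<in> grid n" if "n \<ge> N" for n
  proof -
    have "\<bar>\<tau>\<bar> \<le> real (Suc n)" using N that by linarith
    then have "\<bar>real (Suc n) * \<tau>\<bar> \<le> real (Suc n) * real (Suc n)"
      unfolding abs_mult by (intro mult_mono) auto
    then have "- of_int (int (Suc n * Suc n)) \<le> real (Suc n) * \<tau>" "real (Suc n) * \<tau> \<le> of_int (int (Suc n * Suc n))"
      unfolding of_int_of_nat_eq of_nat_mult[where 'a=real] of_int_mult of_nat_mult[where 'a=int] by linarith+
    then have "\<lfloor>real (Suc n) * \<tau>\<rfloor> \<in> {- int (Suc n * Suc n)..int (Suc n * Suc n)}"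
      by (simp only: atLeastAtMost_iff le_floor_iff of_int_minus floor_le_iff simp_thms)
    then show ?thesis unfolding grid_point_def grid_def by blast
  qed
  then show ?thesis by (auto simp: eventually_sequentially)
qed

text \<open>
  A path integral is Gaussian as far as its characteristic function goes. The approximants
  \<open>S n\<close> are finite linear combinations of the process at grid points; their error is the path integral
  of \<open>D n\<close>, the process minus its value at the rounded time, whose second moment \<open>e n\<close> is bounded and
  tends to 0 by mean-square continuity.
\<close>

lemma path_integral_charfun:
  fixes h :: "real \<Rightarrow> real"
  assumes h: "integrable lborel h"
  shows "expectation (\<lambda>w. exp (\<i> * complex_of_real (path_integral h w)))
    = exp (\<i> * complex_of_real (expectation (path_integral h))
       - complex_of_real ((expectation (\<lambda>w. (path_integral h w)\<^sup>2) - (expectation (path_integral h))\<^sup>2) / 2))"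
proof -
  have [measurable]: "h \<in> borel_measurable borel" using h by auto
  define a where "a n t = (LINT \<tau>|lborel. indicator {\<tau>. grid_point n \<tau> = t} \<tau> * h \<tau>)" for n t
  define S where "S n w = (\<Sum>t\<in>grid n. a n t * \<Phi> t w)" for n w
  define D where "D n \<tau> w = \<Phi> \<tau> w - (\<Sum>t\<in>grid n. indicator {\<tau>. grid_point n \<tau> = t} \<tau> * \<Phi> t w)" for n \<tau> w
  have [measurable]: "{\<tau>. grid_point n \<tau> = t} \<in> sets borel" for n t by measurable
  have D_meas: "(\<lambda>(\<tau>, w). D n \<tau> w) \<in> borel_measurable (borel \<Otimes>\<^sub>M M)" for n
    unfolding D_def by measurable
  have D_eq: "D n \<tau> = (if grid_point n \<tau> \<in> grid n then (\<lambda>w. \<Phi> \<tau> w - \<Phi> (grid_point n \<tau>) w) else \<Phi> \<tau>)" for n \<tau>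
  proof (rule ext)
    fix w
    have "(\<Sum>t\<in>grid n. indicator {\<tau>. grid_point n \<tau> = t} \<tau> * \<Phi> t w) = (\<Sum>t\<in>grid n. if grid_point n \<tau> = t then \<Phi> t w else 0)"
      by (intro sum.cong) (auto simp: indicator_def)
    then show "D n \<tau> w = (if grid_point n \<tau> \<in> grid n then (\<lambda>w. \<Phi> \<tau> w - \<Phi> (grid_point n \<tau>) w) else \<Phi> \<tau>) w"
      by (simp add: D_def sum.delta'[OF finite_grid])
  qed
  define e where "e n \<tau> = (if grid_point n \<tau> \<in> grid n then 2 * C 0 - 2 * C (\<tau> - grid_point n \<tau>) else C 0 + mean\<^sup>2)" for n \<tau>
  have e_eq: "expectation (\<lambda>w. (D n \<tau> w)\<^sup>2) = e n \<tau>" for n \<tau>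
    unfolding D_eq e_def by (simp add: expectation_increment_square expectation_at_square)
  have De: "(\<integral>\<^sup>+ w. ennreal ((D n \<tau> w)\<^sup>2) \<partial>M) = ennreal (e n \<tau>)" for n \<tau>
  proof -
    have "integrable M (\<lambda>w. (D n \<tau> w)\<^sup>2)"
      unfolding D_eq using square_integrable_at integrable_at_mult
      by (auto simp: power2_diff mult.assoc intro!: Bochner_Integration.integrable_add Bochner_Integration.integrable_diff)
    then show ?thesis unfolding e_eq[symmetric] by (intro nn_integral_eq_integral) auto
  qed
  have e0: "0 \<le> e n \<tau>" for n \<tau> unfolding e_eq[symmetric] by simp
  have eb: "e n \<tau> \<le> 4 * C 0 + mean\<^sup>2" for n \<tau>
    unfolding e_def using abs_covariance_le[of "\<tau> - grid_point n \<tau>"] abs_covariance_le[of 0]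
    by (auto simp: abs_le_iff) (smt (verit) zero_le_power2)+
  have e_meas [measurable]: "e n \<in> borel_measurable borel" for n
  proof -
    have "(\<lambda>\<tau>. expectation (\<lambda>w. (D n \<tau> w)\<^sup>2)) \<in> borel_measurable borel"
      using D_meas[of n] by measurable
    then show ?thesis unfolding e_eq .
  qed
  have e_lim: "(\<lambda>n. e n \<tau>) \<longlonglongrightarrow> 0" for \<tau>
  proof -
    have "(\<lambda>n. 2 * C 0 - 2 * C (\<tau> - grid_point n \<tau>)) \<longlonglongrightarrow> 2 * C 0 - 2 * C 0"
      by (intro tendsto_diff tendsto_mult tendsto_const covariance_continuous grid_point_tendsto)
    moreover have "eventually (\<lambda>n. 2 * C 0 - 2 * C (\<tau> - grid_point n \<tau>) = e n \<tau>) sequentially"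
      using eventually_grid_point[of \<tau>] by eventually_elim (simp add: e_def)
    ultimately show ?thesis by (auto dest: Lim_transform_eventually)
  qed
  \<comment> \<open>Only almost surely: on a path whose product with \<open>h\<close> is not integrable, integrals have the default value 0
    and linearity fails.\<close>
  have YS: "AE w in M. path_integral h w - S n w = (LINT \<tau>|lborel. D n \<tau> w *\<^sub>R h \<tau>)" for n
  proof -
    have "AE w in M. integrable lborel (\<lambda>\<tau>. \<Phi> \<tau> w *\<^sub>R complex_of_real (h \<tau>))"
      by (rule path_integrable) (use h in simp)
    then show ?thesis
    proof eventually_elim
      case (elim w)
      then have i1: "integrable lborel (\<lambda>\<tau>. \<Phi> \<tau> w * h \<tau>)"
        by (simp only: scaleR_conv_of_real of_real_mult[symmetric] complex_of_real_integrable_eq)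
      have i2: "integrable lborel (\<lambda>\<tau>. indicator {\<tau>. grid_point n \<tau> = t} \<tau> * h \<tau>)" for t
        using integrable_mult_indicator[of "{\<tau>. grid_point n \<tau> = t}" lborel h] h by simp
      have "(LINT \<tau>|lborel. D n \<tau> w *\<^sub>R h \<tau>)
          = (LINT \<tau>|lborel. \<Phi> \<tau> w * h \<tau> - (\<Sum>t\<in>grid n. (indicator {\<tau>. grid_point n \<tau> = t} \<tau> * h \<tau>) * \<Phi> t w))"
        unfolding D_def by (intro Bochner_Integration.integral_cong) (simp_all add: left_diff_distrib sum_distrib_right mult.assoc mult.commute mult.left_commute, simp_all add: right_diff_distrib sum_distrib_left mult.left_commute)
      also have "\<dots> = path_integral h w - S n w"
        using i1 i2 by (simp add: path_integral_def S_def a_def)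
      finally show ?case by simp
    qed
  qed
  have [measurable]: "S n \<in> borel_measurable M" for n unfolding S_def by measurable
  show ?thesis
  proof (rule gaussian_L2_limit_charfun[OF prob_space_axioms])
    show "gaussian_rv M (S n)" for n
      unfolding S_def by (rule gaussian[unfolded gaussian_process_def, rule_format]) (rule finite_grid)
    show "integrable M (\<lambda>w. (path_integral h w)\<^sup>2)"
      using path_integral_square_integrable[OF h] by simp
    let ?H = "LINT \<tau>|lborel. \<bar>h \<tau>\<bar>"
    have he: "0 \<le> \<bar>h \<tau>\<bar> * e n \<tau>" "\<bar>h \<tau>\<bar> * e n \<tau> \<le> (4 * C 0 + mean\<^sup>2) * \<bar>h \<tau>\<bar>" for n \<tau>
      using mult_left_mono[OF eb[of n \<tau>], of "\<bar>h \<tau>\<bar>"] e0[of n \<tau>] by (simp_all add: mult.commute)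
    have ie: "integrable lborel (\<lambda>\<tau>. \<bar>h \<tau>\<bar> * e n \<tau>)" for n
    proof (rule Bochner_Integration.integrable_bound)
      show "integrable lborel (\<lambda>\<tau>. (4 * C 0 + mean\<^sup>2) * \<bar>h \<tau>\<bar>)" using h by simp
      show "AE \<tau> in lborel. norm (\<bar>h \<tau>\<bar> * e n \<tau>) \<le> norm ((4 * C 0 + mean\<^sup>2) * \<bar>h \<tau>\<bar>)"
        using he by (intro AE_I2) (simp only: real_norm_def, smt (verit))
    qed measurable
    have bound: "expectation (\<lambda>w. (path_integral h w - S n w)\<^sup>2) \<le> ?H * (LINT \<tau>|lborel. \<bar>h \<tau>\<bar> * e n \<tau>)" for n
    proof -
      have "ennreal (expectation (\<lambda>w. (path_integral h w - S n w)\<^sup>2)) \<le> (\<integral>\<^sup>+ w. ennreal ((path_integral h w - S n w)\<^sup>2) \<partial>M)"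
        by (cases "integrable M (\<lambda>w. (path_integral h w - S n w)\<^sup>2)") (auto simp: nn_integral_eq_integral not_integrable_integral_eq)
      also have "\<dots> = (\<integral>\<^sup>+ w. ennreal ((norm (LINT \<tau>|lborel. D n \<tau> w *\<^sub>R h \<tau>))\<^sup>2) \<partial>M)"
        by (rule nn_integral_cong_AE) (use YS[of n] in auto)
      also have "\<dots> \<le> (\<integral>\<^sup>+ \<tau>. ennreal (norm (h \<tau>)) \<partial>lborel) * (\<integral>\<^sup>+ \<tau>. ennreal (norm (h \<tau>)) * (\<integral>\<^sup>+ w. ennreal ((D n \<tau> w)\<^sup>2) \<partial>M) \<partial>lborel)"
        by (rule square_integral_weighted_le[OF prob_space_axioms D_meas]) simp
      also have "\<dots> = ennreal ?H * ennreal (LINT \<tau>|lborel. \<bar>h \<tau>\<bar> * e n \<tau>)"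
        unfolding De using h ie[of n] e0
        by (simp add: nn_integral_eq_integral ennreal_mult'[symmetric])
      also have "\<dots> = ennreal (?H * (LINT \<tau>|lborel. \<bar>h \<tau>\<bar> * e n \<tau>))"
        using e0 by (intro ennreal_mult[symmetric]) auto
      finally show ?thesis
        by (subst (asm) ennreal_le_iff) (auto intro!: mult_nonneg_nonneg integral_nonneg_AE AE_I2 e0)
    qed
    have "(\<lambda>n. LINT \<tau>|lborel. \<bar>h \<tau>\<bar> * e n \<tau>) \<longlonglongrightarrow> integral\<^sup>L lborel (\<lambda>_::real. 0::real)"
    proof (rule Bochner_Integration.integral_dominated_convergence[where w="\<lambda>\<tau>. (4 * C 0 + mean\<^sup>2) * \<bar>h \<tau>\<bar>"])
      show "integrable lborel (\<lambda>\<tau>. (4 * C 0 + mean\<^sup>2) * \<bar>h \<tau>\<bar>)" using h by simp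
      show "AE \<tau> in lborel. (\<lambda>n. \<bar>h \<tau>\<bar> * e n \<tau>) \<longlonglongrightarrow> 0"
        by (intro AE_I2 tendsto_mult_right_zero e_lim)
      show "AE \<tau> in lborel. norm (\<bar>h \<tau>\<bar> * e n \<tau>) \<le> (4 * C 0 + mean\<^sup>2) * \<bar>h \<tau>\<bar>" for n
        using he by (intro AE_I2) (simp only: real_norm_def, smt (verit))
    qed measurable
    then have "(\<lambda>n. ?H * (LINT \<tau>|lborel. \<bar>h \<tau>\<bar> * e n \<tau>)) \<longlonglongrightarrow> 0"
      by (intro tendsto_mult_right_zero) simp
    then show "(\<lambda>n. expectation (\<lambda>w. (path_integral h w - S n w)\<^sup>2)) \<longlonglongrightarrow> 0"
    proof (rule Lim_null_comparison[OF always_eventually, rotated], intro allI)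
      fix n
      have "0 \<le> expectation (\<lambda>w. (path_integral h w - S n w)\<^sup>2)" by simp
      with bound[of n] show "norm (expectation (\<lambda>w. (path_integral h w - S n w)\<^sup>2)) \<le> ?H * (LINT \<tau>|lborel. \<bar>h \<tau>\<bar> * e n \<tau>)"
        by simp
    qed
  qed measurable
qed

end

section \<open>Circularity of wavelet coefficients\<close>

lemma borel_measurable_Arg2pi [measurable]: "Arg2pi \<in> borel_measurable borel"
proof -
  have "(\<lambda>z. if z \<in> \<real>\<^sub>\<ge>\<^sub>0 then 0 else Arg2pi z) \<in> borel_measurable borel"
  proof (rule borel_measurable_continuous_on_if)
    show "\<real>\<^sub>\<ge>\<^sub>0 \<in> sets (borel :: complex measure)"
      by (intro borel_closed closed_nonneg_Reals_complex)
    show "continuous_on (- \<real>\<^sub>\<ge>\<^sub>0) Arg2pi"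
      by (intro continuous_at_imp_continuous_on ballI continuous_at_Arg2pi) simp
  qed simp
  also have "(\<lambda>z. if z \<in> \<real>\<^sub>\<ge>\<^sub>0 then 0 else Arg2pi z) = Arg2pi"
    by (auto simp: fun_eq_iff Arg2pi_eq_0 complex_nonneg_Reals_iff complex_is_Real_iff)
  finally show ?thesis .
qed

lemma borel_measurable_fourier [measurable]:
  assumes [measurable]: "h \<in> borel_measurable borel"
  shows "fourier h \<in> borel_measurable borel"
  unfolding fourier_def by measurable

lemma norm_fourier_le: "cmod (fourier h \<omega>) \<le> (LINT t|lborel. cmod (h t))"
  unfolding fourier_def using integral_norm_bound[of lborel "\<lambda>t. exp (- \<i> * complex_of_real (t * \<omega>)) * h t"]
  by (simp add: norm_mult)

lemma fourier_add:
  assumes "integrable lborel g" "integrable lborel h"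
  shows "fourier (\<lambda>t. a * g t + b * h t) \<omega> = a * fourier g \<omega> + b * fourier h \<omega>"
proof -
  have i: "integrable lborel (\<lambda>t. exp (- \<i> * complex_of_real (t * \<omega>)) * f t)" if f: "integrable lborel f" for f
  proof (rule Bochner_Integration.integrable_bound[OF f])
    show "(\<lambda>t. exp (- \<i> * complex_of_real (t * \<omega>)) * f t) \<in> borel_measurable lborel"
      using f by measurable
  qed (simp add: norm_mult)
  have "fourier (\<lambda>t. a * g t + b * h t) \<omega>
      = (LINT t|lborel. a * (exp (- \<i> * complex_of_real (t * \<omega>)) * g t) + b * (exp (- \<i> * complex_of_real (t * \<omega>)) * h t))"
    unfolding fourier_def by (intro Bochner_Integration.integral_cong) (auto simp: algebra_simps)
  also have "\<dots> = a * fourier g \<omega> + b * fourier h \<omega>"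
    unfolding fourier_def
    by (simp only: Bochner_Integration.integral_add[OF integrable_mult_right[OF i[OF assms(1)]] integrable_mult_right[OF i[OF assms(2)]]] integral_mult_right_zero)
  finally show ?thesis .
qed

text \<open>
  Both time integrations in a second moment of path integrals follow this pattern: the kernel is a
  superposition of exponentials over the spectral measure, and integrating against \<open>h\<close> produces its
  Fourier transform. The sign is carried by \<open>\<sigma>\<close>, since the two time variables enter the covariance with
  opposite signs.
\<close>

lemma fourier_Fubini:
  fixes h k :: "real \<Rightarrow> complex"
  assumes "finite_measure F" and [measurable_cong]: "sets F = sets borel"
    and h: "integrable lborel h" and [measurable]: "k \<in> borel_measurable borel"
    and k: "\<And>\<xi>. cmod (k \<xi>) \<le> B"
  shows "(LINT t|lborel. h t * (LINT \<xi>|F. exp (- \<i> * complex_of_real (t * (\<sigma> * \<xi>))) * k \<xi>))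
       = (LINT \<xi>|F. k \<xi> * fourier h (\<sigma> * \<xi>))"
proof -
  interpret F: finite_measure F by fact
  interpret P: pair_sigma_finite lborel F ..
  have [measurable]: "h \<in> borel_measurable borel" using h by auto
  let ?f = "\<lambda>t \<xi>. h t * (exp (- \<i> * complex_of_real (t * (\<sigma> * \<xi>))) * k \<xi>)"
  have n: "norm (?f t \<xi>) = cmod (h t) * cmod (k \<xi>)" for t \<xi> by (simp add: norm_mult)
  have ik: "integrable F (\<lambda>\<xi>. cmod (k \<xi>))"
    by (rule F.integrable_const_bound[where B=B]) (use k in auto)
  have int: "integrable (lborel \<Otimes>\<^sub>M F) (\<lambda>(t, \<xi>). ?f t \<xi>)"
  proof (rule P.Fubini_integrable)
    show "AE t in lborel. integrable F (\<lambda>\<xi>. case (t, \<xi>) of (t, \<xi>) \<Rightarrow> ?f t \<xi>)"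
      unfolding prod.case
    proof (intro AE_I2 integrable_mult_right)
      fix t show "integrable F (\<lambda>\<xi>. exp (- \<i> * complex_of_real (t * (\<sigma> * \<xi>))) * k \<xi>)"
        by (rule F.integrable_const_bound[where B=B]) (use k in \<open>auto simp: norm_mult\<close>)
    qed
    show "integrable lborel (\<lambda>t. LINT \<xi>|F. norm (case (t, \<xi>) of (t, \<xi>) \<Rightarrow> ?f t \<xi>))"
      unfolding prod.case n integral_mult_right_zero using h by simp
  qed measurable
  have "(LINT t|lborel. h t * (LINT \<xi>|F. exp (- \<i> * complex_of_real (t * (\<sigma> * \<xi>))) * k \<xi>)) = (LINT t|lborel. LINT \<xi>|F. ?f t \<xi>)"
    by (simp only: integral_mult_right_zero)
  also have "\<dots> = (LINT \<xi>|F. LINT t|lborel. ?f t \<xi>)"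
    by (rule P.Fubini_integral[OF int, symmetric])
  also have "\<dots> = (LINT \<xi>|F. k \<xi> * fourier h (\<sigma> * \<xi>))"
  proof (intro Bochner_Integration.integral_cong refl)
    fix \<xi>
    have "(LINT t|lborel. ?f t \<xi>) = (LINT t|lborel. k \<xi> * (exp (- \<i> * complex_of_real (t * (\<sigma> * \<xi>))) * h t))"
      by (intro Bochner_Integration.integral_cong) (auto simp: mult_ac)
    then show "(LINT t|lborel. ?f t \<xi>) = k \<xi> * fourier h (\<sigma> * \<xi>)"
      unfolding fourier_def by (simp only: integral_mult_right_zero)
  qed
  finally show ?thesis .
qed

text \<open>
  The property of the complex conjugate of an analytic wavelet, which is what the transform integrates
  against. The frequency 0 is included; it makes the path integrals centred.
\<close>

definition antianalytic :: "(real \<Rightarrow> complex) \<Rightarrow> bool" where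
  "antianalytic g \<longleftrightarrow> integrable lborel g \<and> (\<forall>\<omega>\<ge>0. fourier g \<omega> = 0)"

lemma antianalytic_linear_combination:
  "antianalytic g \<Longrightarrow> antianalytic h \<Longrightarrow> antianalytic (\<lambda>t. a * g t + b * h t)"
  unfolding antianalytic_def by (auto simp: fourier_add)

lemma antianalytic_wavelet_atom:
  assumes \<psi>: "analytic_mother_wavelet \<psi>" and s: "s > 0"
  shows "antianalytic (\<lambda>\<tau>. complex_of_real (1 / sqrt s) * cnj (\<psi> ((\<tau> - t) / s)))"
  unfolding antianalytic_def
proof (intro conjI allI impI)
  have int: "integrable lborel \<psi>" using \<psi> by (simp add: analytic_mother_wavelet_def)
  have "integrable lborel (\<lambda>\<tau>. \<psi> (- t / s + (1 / s) * \<tau>))"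
    by (rule lborel_integrable_real_affine[OF int]) (use s in simp)
  also have "(\<lambda>\<tau>. \<psi> (- t / s + (1 / s) * \<tau>)) = (\<lambda>\<tau>. \<psi> ((\<tau> - t) / s))"
    by (simp add: diff_divide_distrib)
  finally show "integrable lborel (\<lambda>\<tau>. complex_of_real (1 / sqrt s) * cnj (\<psi> ((\<tau> - t) / s)))"
    by (intro integrable_mult_right integrable_cnj)
  fix \<omega> :: real assume "0 \<le> \<omega>"
  then have z: "fourier \<psi> (- (s * \<omega>)) = 0"
    using \<psi> s by (simp add: analytic_mother_wavelet_def)
  let ?c = "exp (- \<i> * complex_of_real (t * \<omega>)) * complex_of_real (1 / sqrt s)"
  have "fourier (\<lambda>\<tau>. complex_of_real (1 / sqrt s) * cnj (\<psi> ((\<tau> - t) / s))) \<omega>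
      = \<bar>s\<bar> *\<^sub>R (LINT x|lborel. exp (- \<i> * complex_of_real ((t + s * x) * \<omega>)) * (complex_of_real (1 / sqrt s) * cnj (\<psi> ((t + s * x - t) / s))))"
    unfolding fourier_def by (rule lborel_integral_real_affine) (use s in simp)
  also have "(LINT x|lborel. exp (- \<i> * complex_of_real ((t + s * x) * \<omega>)) * (complex_of_real (1 / sqrt s) * cnj (\<psi> ((t + s * x - t) / s))))
      = (LINT x|lborel. ?c * cnj (exp (- \<i> * complex_of_real (x * - (s * \<omega>))) * \<psi> x))"
  proof (intro Bochner_Integration.integral_cong refl)
    fix x
    have e: "exp (- \<i> * complex_of_real ((t + s * x) * \<omega>)) = exp (- \<i> * complex_of_real (t * \<omega>)) * cnj (exp (- \<i> * complex_of_real (x * - (s * \<omega>))))"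
      unfolding exp_cnj exp_add[symmetric] by (simp add: algebra_simps)
    have "(t + s * x - t) / s = x" using s by simp
    then show "exp (- \<i> * complex_of_real ((t + s * x) * \<omega>)) * (complex_of_real (1 / sqrt s) * cnj (\<psi> ((t + s * x - t) / s)))
        = ?c * cnj (exp (- \<i> * complex_of_real (x * - (s * \<omega>))) * \<psi> x)"
      unfolding e by (simp only: complex_cnj_mult mult_ac)
  qed
  also have "\<dots> = ?c * cnj (fourier \<psi> (- (s * \<omega>)))"
    unfolding fourier_def by (simp only: integral_mult_right_zero Bochner_Integration.integral_cnj)
  finally show "fourier (\<lambda>\<tau>. complex_of_real (1 / sqrt s) * cnj (\<psi> ((\<tau> - t) / s))) \<omega> = 0"
    unfolding z by simp
qed

context stationary_gaussian_process begin

lemma wavelet_transform_path_integral: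
  "wavelet_transform \<psi> \<Phi> t s = path_integral (\<lambda>\<tau>. complex_of_real (1 / sqrt s) * cnj (\<psi> ((\<tau> - t) / s)))"
  unfolding wavelet_transform_def path_integral_def by (simp add: fun_eq_iff scaleR_conv_of_real mult.assoc)

lemma expectation_path_integral_antianalytic:
  assumes "antianalytic h"
  shows "expectation (path_integral h) = 0"
proof -
  have "fourier h 0 = 0" using assms by (simp add: antianalytic_def)
  then have "(LINT t|lborel. h t) = 0" by (simp add: fourier_def)
  then show ?thesis using assms by (simp add: expectation_path_integral antianalytic_def)
qed

text \<open>
  The two time integrations turn the expectation into
  \<open>\<integral> fourier h (-\<xi>) * fourier g \<xi> F(d\<xi>)\<close>. One of \<open>\<xi>\<close> and \<open>-\<xi>\<close> is nonnegative, so one of the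
  factors vanishes. The mean of the process drops out because \<open>h\<close> has integral 0.
\<close>

lemma pseudo_covariance_zero:
  assumes g: "antianalytic g" and h: "antianalytic h"
  shows "expectation (\<lambda>w. path_integral h w * path_integral g w) = 0"
proof -
  have ig: "integrable lborel g" and ih: "integrable lborel h" using g h by (auto simp: antianalytic_def)
  have [measurable]: "g \<in> borel_measurable borel" "h \<in> borel_measurable borel" using ig ih by auto
  have h0: "(LINT t|lborel. h t) = 0"
    using h unfolding antianalytic_def fourier_def by (auto dest!: spec[of _ 0])
  let ?k = "\<lambda>s \<xi>. exp (- \<i> * complex_of_real (s * (1 * \<xi>)))"
  have q: "expectation (\<lambda>w. \<Phi> s w *\<^sub>R path_integral h w) = (LINT \<xi>|F. ?k s \<xi> * fourier h (- 1 * \<xi>))" for s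
  proof -
    have "integrable M (\<lambda>w. (cmod (complex_of_real (\<Phi> s w)))\<^sup>2)" using square_integrable_at by simp
    from path_integral_Fubini(2)[OF ih _ this]
    have "expectation (\<lambda>w. \<Phi> s w *\<^sub>R path_integral h w) = (LINT t|lborel. h t * expectation (\<lambda>w. \<Phi> t w *\<^sub>R complex_of_real (\<Phi> s w)))"
      by (simp add: scaleR_conv_of_real)
    also have "(\<lambda>t. expectation (\<lambda>w. \<Phi> t w *\<^sub>R complex_of_real (\<Phi> s w))) = (\<lambda>t. complex_of_real (C (t - s)) + complex_of_real (mean\<^sup>2))"
    proof
      fix t
      have "expectation (\<lambda>w. \<Phi> t w *\<^sub>R complex_of_real (\<Phi> s w)) = complex_of_real (expectation (\<lambda>w. \<Phi> t w * \<Phi> s w))"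
        by (simp only: scaleR_conv_of_real of_real_mult[symmetric] integral_complex_of_real)
      then show "expectation (\<lambda>w. \<Phi> t w *\<^sub>R complex_of_real (\<Phi> s w)) = complex_of_real (C (t - s)) + complex_of_real (mean\<^sup>2)"
        unfolding expectation_at_mult by simp
    qed
    also have "(LINT t|lborel. h t * (complex_of_real (C (t - s)) + complex_of_real (mean\<^sup>2))) = (LINT t|lborel. h t * complex_of_real (C (t - s)))"
    proof -
      have Cm: "(\<lambda>t. complex_of_real (C (t - s))) \<in> borel_measurable borel"
      proof -
        interpret F: finite_measure F by (rule spectral_finite)
        show ?thesis unfolding covariance_spectral by measurable
      qed
      have "integrable lborel (\<lambda>t. h t * complex_of_real (C (t - s)))"
      proof (rule Bochner_Integration.integrable_bound)
        show "integrable lborel (\<lambda>t. complex_of_real (C 0) * h t)" using ih by simp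
        show "(\<lambda>t. h t * complex_of_real (C (t - s))) \<in> borel_measurable lborel"
          using Cm by measurable
        show "AE t in lborel. norm (h t * complex_of_real (C (t - s))) \<le> norm (complex_of_real (C 0) * h t)"
        proof (rule AE_I2)
          fix t
          have "\<bar>C (t - s)\<bar> * cmod (h t) \<le> \<bar>C 0\<bar> * cmod (h t)"
            using abs_covariance_le[of "t - s"] by (intro mult_right_mono) auto
          then show "norm (h t * complex_of_real (C (t - s))) \<le> norm (complex_of_real (C 0) * h t)"
            by (simp only: norm_mult norm_of_real mult.commute)
        qed
      qed
      then show ?thesis using ih h0 by (simp add: distrib_left)
    qed
    also have "\<dots> = (LINT t|lborel. h t * (LINT \<xi>|F. exp (- \<i> * complex_of_real (t * (- 1 * \<xi>))) * ?k s \<xi>))"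
      unfolding covariance_spectral
      by (intro Bochner_Integration.integral_cong arg_cong2[where f="(*)"] refl) (simp add: exp_add[symmetric] algebra_simps)
    also have "\<dots> = (LINT \<xi>|F. ?k s \<xi> * fourier h (- 1 * \<xi>))"
      by (rule fourier_Fubini[OF spectral_finite spectral_sets ih, where B=1]) auto
    finally show ?thesis .
  qed
  have "expectation (\<lambda>w. path_integral h w * path_integral g w) = (LINT s|lborel. g s * expectation (\<lambda>w. \<Phi> s w *\<^sub>R path_integral h w))"
    by (rule path_integral_Fubini(2)[OF ig _ path_integral_square_integrable[OF ih]]) measurable
  also have "\<dots> = (LINT \<xi>|F. fourier h (- 1 * \<xi>) * fourier g (1 * \<xi>))"
    unfolding q by (rule fourier_Fubini[OF spectral_finite spectral_sets ig, where B="LINT t|lborel. cmod (h t)"]) (auto intro: norm_fourier_le)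
  also have "\<dots> = (LINT \<xi>|F. 0)"
  proof (intro Bochner_Integration.integral_cong refl)
    fix \<xi> show "fourier h (- 1 * \<xi>) * fourier g (1 * \<xi>) = 0"
      using g h unfolding antianalytic_def by (cases "\<xi> \<ge> 0") auto
  qed
  finally show ?thesis by simp
qed

text \<open>
  Since \<open>(Re z)\<^sup>2 = (|z|\<^sup>2 + Re (z\<^sup>2)) / 2\<close> and the pseudo-covariance is zero, the real part has
  variance \<open>E|Z|\<^sup>2 / 2\<close>.
\<close>

lemma circular_charfun:
  assumes g: "antianalytic g"
  shows "expectation (\<lambda>w. exp (\<i> * complex_of_real (Re (path_integral g w))))
     = complex_of_real (exp (- expectation (\<lambda>w. (cmod (path_integral g w))\<^sup>2) / 4))"
proof -
  have ig: "integrable lborel g" using g by (auto simp: antianalytic_def)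
  have [measurable]: "g \<in> borel_measurable borel" using ig by auto
  let ?h = "\<lambda>\<tau>. Re (g \<tau>)"
  have ih: "integrable lborel ?h" using ig by simp
  have re: "AE w in M. path_integral ?h w = Re (path_integral g w)"
    using path_integrable[OF ig]
  proof eventually_elim
    case (elim w)
    then show ?case unfolding path_integral_def by (subst integral_Re[symmetric]) auto
  qed
  have W2: "integrable M (\<lambda>w. (cmod (path_integral g w))\<^sup>2)" by (rule path_integral_square_integrable[OF ig])
  have WW: "integrable M (\<lambda>w. path_integral g w * path_integral g w)"
    by (rule integrable_mult_square_integrable) (use W2 in auto)
  have W1: "integrable M (path_integral g)"
    by (rule square_integrable_imp_integrable) (use WW in \<open>auto simp: power2_eq_square\<close>)
  have "expectation (path_integral ?h) = expectation (\<lambda>w. Re (path_integral g w))"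
    by (rule integral_cong_AE) (use re in auto)
  also have "\<dots> = 0"
    using expectation_path_integral_antianalytic[OF g] W1 by simp
  finally have m0: "expectation (path_integral ?h) = 0" .
  have "expectation (\<lambda>w. (path_integral ?h w)\<^sup>2) = expectation (\<lambda>w. (Re (path_integral g w))\<^sup>2)"
    by (rule integral_cong_AE) (use re in auto)
  also have "\<dots> = expectation (\<lambda>w. ((cmod (path_integral g w))\<^sup>2 + Re (path_integral g w * path_integral g w)) / 2)"
    by (intro Bochner_Integration.integral_cong refl) (simp only: cmod_power2 times_complex.sel, simp add: power2_eq_square)
  also have "\<dots> = (expectation (\<lambda>w. (cmod (path_integral g w))\<^sup>2) + Re (expectation (\<lambda>w. path_integral g w * path_integral g w))) / 2"
    using W2 WW by (simp only: integral_divide_zero Bochner_Integration.integral_add[OF W2 integrable_Re[OF WW]] integral_Re[OF WW])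
  finally have v: "expectation (\<lambda>w. (path_integral ?h w)\<^sup>2) = expectation (\<lambda>w. (cmod (path_integral g w))\<^sup>2) / 2"
    using pseudo_covariance_zero[OF g g] by simp
  have "expectation (\<lambda>w. exp (\<i> * complex_of_real (Re (path_integral g w)))) = expectation (\<lambda>w. exp (\<i> * complex_of_real (path_integral ?h w)))"
    by (rule integral_cong_AE) (use re in auto)
  also have "\<dots> = complex_of_real (exp (- expectation (\<lambda>w. (cmod (path_integral g w))\<^sup>2) / 4))"
    unfolding path_integral_charfun[OF ih] m0 v by (simp flip: exp_of_real)
  finally show ?thesis .
qed

text \<open>
  A linear combination of two path integrals is, almost surely, the path integral of the combined weight, which
  is again antianalytic.
\<close>

lemma circular_pair_charfun:
  assumes g: "antianalytic g" and h: "antianalytic h"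
  shows "expectation (\<lambda>w. exp (\<i> * complex_of_real (Re (a * path_integral g w + b * path_integral h w))))
     = complex_of_real (exp (- expectation (\<lambda>w. (cmod (a * path_integral g w + b * path_integral h w))\<^sup>2) / 4))"
proof -
  have ig: "integrable lborel g" and ih: "integrable lborel h" using g h by (auto simp: antianalytic_def)
  have [measurable]: "g \<in> borel_measurable borel" "h \<in> borel_measurable borel" using ig ih by auto
  let ?k = "\<lambda>t. a * g t + b * h t"
  have ae: "AE w in M. path_integral ?k w = a * path_integral g w + b * path_integral h w"
    using path_integrable[OF ig] path_integrable[OF ih]
  proof eventually_elim
    case (elim w)
    have "path_integral ?k w = (LINT t|lborel. a * (\<Phi> t w *\<^sub>R g t) + b * (\<Phi> t w *\<^sub>R h t))"
      unfolding path_integral_def by (intro Bochner_Integration.integral_cong) (auto simp: scaleR_conv_of_real algebra_simps)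
    also have "\<dots> = a * path_integral g w + b * path_integral h w"
      unfolding path_integral_def
      by (simp only: Bochner_Integration.integral_add[OF integrable_mult_right[OF elim(1)] integrable_mult_right[OF elim(2)]] integral_mult_right_zero)
    finally show ?case .
  qed
  have "expectation (\<lambda>w. exp (\<i> * complex_of_real (Re (a * path_integral g w + b * path_integral h w))))
      = expectation (\<lambda>w. exp (\<i> * complex_of_real (Re (path_integral ?k w))))"
    by (rule integral_cong_AE) (use ae in auto)
  moreover have "expectation (\<lambda>w. (cmod (a * path_integral g w + b * path_integral h w))\<^sup>2) = expectation (\<lambda>w. (cmod (path_integral ?k w))\<^sup>2)"
    by (rule integral_cong_AE) (use ae in auto)
  ultimately show ?thesis
    using circular_charfun[OF antianalytic_linear_combination[OF g h]] by simp
qed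

end

section \<open>Phase expectations of a circular pair\<close>

text \<open>
  Almost surely the phase factor is \<open>sgn W\<close>, whatever the phase of 0 is. The law of \<open>W\<close> is a rescaled
  standard complex normal law, which has a density.
\<close>

lemma circular_nonzero:
  assumes M: "prob_space M" and [measurable]: "W \<in> borel_measurable M" and c: "c > 0"
    and char: "\<And>a. (LINT w|M. exp (\<i> * complex_of_real (Re (a * W w)))) = complex_of_real (exp (- (c * (cmod a)\<^sup>2) / 4))"
  shows "AE w in M. W w \<noteq> 0"
proof -
  interpret prob_space M by fact
  let ?F = "\<lambda>u v::complex. complex_of_real (indicator {0} u)"
  have "(LINT w|M. ?F (complex_of_real (1 / sqrt c) * W w) 0) = (LINT z|std_complex_normal. ?F z 0)"
  proof (rule complex_pair_law_unique[where F="?F" and M=M and N=std_complex_normal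
      and ?Z1.0="\<lambda>w. complex_of_real (1 / sqrt c) * W w" and ?Z2.0="\<lambda>_. 0" and Z1'="\<lambda>z. z" and Z2'="\<lambda>_. 0"])
    fix a b
    have "(LINT w|M. exp (\<i> * complex_of_real (Re (a * (complex_of_real (1 / sqrt c) * W w) + b * 0))))
        = complex_of_real (exp (- (c * (cmod (a * complex_of_real (1 / sqrt c)))\<^sup>2) / 4))"
      using char[of "a * complex_of_real (1 / sqrt c)"] by (simp only: mult.assoc mult_zero_right add_0_right)
    also have "c * (cmod (a * complex_of_real (1 / sqrt c)))\<^sup>2 = (cmod a)\<^sup>2"
      using c by (simp add: norm_mult norm_divide power_mult_distrib power_divide)
    finally show "(LINT w|M. exp (\<i> * complex_of_real (Re (a * (complex_of_real (1 / sqrt c) * W w) + b * 0))))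
      = (LINT z|std_complex_normal. exp (\<i> * complex_of_real (Re (a * z + b * 0))))"
      by (simp only: mult_zero_right add_0_right std_complex_normal_charfun)
  qed (use M std_complex_normal.prob_space_axioms in auto)
  also have "(LINT z|std_complex_normal. ?F z 0) = (LINT z|std_complex_normal. 0)"
    by (rule integral_cong_AE) (use std_complex_normal_nonzero in \<open>auto simp: indicator_def\<close>)
  finally have "(LINT w|M. indicator {0} (complex_of_real (1 / sqrt c) * W w) :: real) = 0"
    by (simp only: integral_complex_of_real of_real_eq_0_iff Bochner_Integration.integral_zero)
  then have "(LINT w|M. indicator {w. W w = 0} w :: real) = 0"
    using c by (simp add: indicator_def)
  moreover have "integrable M (\<lambda>w. indicator {w. W w = 0} w :: real)"
    by (rule integrable_const_bound[where B=1]) (auto simp: indicator_def)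
  ultimately have "AE w in M. (indicator {w. W w = 0} w :: real) = 0"
    by (subst (asm) integral_nonneg_eq_0_iff_AE) auto
  then show ?thesis by eventually_elim (simp add: indicator_def split: if_splits)
qed

text \<open>
  Nondegeneracy gives \<open>\<rho> < 1\<close>. Rotating \<open>W1\<close> by \<open>\<kappa> = exp (-i arg c)\<close> makes the correlation
  of the normalised pair real and nonnegative; comparing characteristic functions then identifies its law with
  that of \<open>(U, \<rho> U + \<gamma> V)\<close>, and the rotation reappears as the factor \<open>exp (i arg c)\<close>.
\<close>

theorem circular_pair_phase_expectation:
  fixes W1 W2 :: "'a \<Rightarrow> complex"
  assumes M: "prob_space M" and [measurable]: "W1 \<in> borel_measurable M" "W2 \<in> borel_measurable M"
    and sq: "integrable M (\<lambda>w. (cmod (W1 w))\<^sup>2)" "integrable M (\<lambda>w. (cmod (W2 w))\<^sup>2)"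
    and char: "\<And>a b. (LINT w|M. exp (\<i> * complex_of_real (Re (a * W1 w + b * W2 w))))
         = complex_of_real (exp (- (LINT w|M. (cmod (a * W1 w + b * W2 w))\<^sup>2) / 4))"
    and g1: "g1 = (LINT w|M. (cmod (W1 w))\<^sup>2)" and g2: "g2 = (LINT w|M. (cmod (W2 w))\<^sup>2)"
    and c: "c = (LINT w|M. W1 w * cnj (W2 w))" and nondeg: "g1 * g2 \<noteq> (cmod c)\<^sup>2"
  shows "(LINT w|M. exp (\<i> * complex_of_real (Arg2pi (W1 w) - Arg2pi (W2 w)))) = complex_of_real (pi / 4) * exp (\<i> * complex_of_real (Arg c))
         * complex_of_real ((1 - (cmod c)\<^sup>2 / (g1 * g2)) * (cmod c / sqrt (g1 * g2)) * hypergeom_2F1 (3/2) (3/2) 2 ((cmod c)\<^sup>2 / (g1 * g2)))"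
    and "(LINT w|M. exp (\<i> * complex_of_real (Arg2pi (W1 w) + Arg2pi (W2 w)))) = 0"
proof -
  interpret prob_space M by fact
  have i12: "integrable M (\<lambda>w. W1 w * cnj (W2 w))"
    by (rule integrable_mult_square_integrable) (use sq in auto)
  have quad: "(LINT w|M. (cmod (a * W1 w + b * W2 w))\<^sup>2) = (cmod a)\<^sup>2 * g1 + (cmod b)\<^sup>2 * g2 + 2 * Re (a * cnj b * c)" for a b
  proof -
    have pt: "(cmod (a * W1 w + b * W2 w))\<^sup>2 = (cmod a)\<^sup>2 * (cmod (W1 w))\<^sup>2 + (cmod b)\<^sup>2 * (cmod (W2 w))\<^sup>2 + 2 * Re (a * cnj b * (W1 w * cnj (W2 w)))" for w
      by (simp only: cmod_power2 plus_complex.sel times_complex.sel cnj.sel) (simp add: power2_eq_square algebra_simps)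
    show ?thesis
      unfolding pt g1 g2 c
      by (simp only: Bochner_Integration.integral_add[OF Bochner_Integration.integrable_add[OF integrable_mult_right[OF sq(1)] integrable_mult_right[OF sq(2)]] integrable_mult_right[OF integrable_Re[OF integrable_mult_right[OF i12]]]]
        Bochner_Integration.integral_add[OF integrable_mult_right[OF sq(1)] integrable_mult_right[OF sq(2)]]
        integral_mult_right_zero integral_Re[OF integrable_mult_right[OF i12]])
  qed
  have pos: "0 \<le> (cmod a)\<^sup>2 * g1 + (cmod b)\<^sup>2 * g2 + 2 * Re (a * cnj b * c)" for a b
    unfolding quad[symmetric] by simp
  have g0: "0 \<le> g1" "0 \<le> g2" using pos[of 1 0] pos[of 0 1] by simp_all
  have tc: "complex_of_real t * cnj (- c) * c = complex_of_real (- t * (cmod c)\<^sup>2)"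
     "- cnj c * cnj (complex_of_real t) * c = complex_of_real (- t * (cmod c)\<^sup>2)" for t
    using complex_norm_square[of c] by (simp_all add: mult_ac)
  \<comment> \<open>Cauchy--Schwarz by hand: the form at \<open>(t, -c)\<close> and \<open>(-cnj c, t)\<close>. The choices \<open>t = g2 + 1\<close>
    and \<open>t = g1 + 1\<close> below exclude \<open>g1 = 0\<close> and \<open>g2 = 0\<close>, and \<open>t = g2\<close> gives the inequality.\<close>
  have qt: "0 \<le> t\<^sup>2 * g1 + (cmod c)\<^sup>2 * g2 - 2 * t * (cmod c)\<^sup>2" for t
    using pos[of "complex_of_real t" "- c"] unfolding tc Re_complex_of_real by simp
  have qt': "0 \<le> (cmod c)\<^sup>2 * g1 + t\<^sup>2 * g2 - 2 * t * (cmod c)\<^sup>2" for t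
    using pos[of "- cnj c" "complex_of_real t"] unfolding tc Re_complex_of_real by simp
  have "g1 \<noteq> 0"
  proof
    assume "g1 = 0"
    with nondeg have "cmod c \<noteq> 0" by simp
    then have "0 < (cmod c)\<^sup>2 * (g2 + 2)" using g0 by simp
    with qt[of "g2 + 1"] \<open>g1 = 0\<close> show False by (simp add: algebra_simps)
  qed
  moreover have "g2 \<noteq> 0"
  proof
    assume "g2 = 0"
    with nondeg have "cmod c \<noteq> 0" by simp
    then have "0 < (cmod c)\<^sup>2 * (g1 + 2)" using g0 by simp
    with qt'[of "g1 + 1"] \<open>g2 = 0\<close> show False by (simp add: algebra_simps)
  qed
  ultimately have gp: "0 < g1" "0 < g2" using g0 by auto
  have "0 \<le> g2 * (g1 * g2 - (cmod c)\<^sup>2)"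
    using qt[of g2] by (simp add: power2_eq_square algebra_simps)
  with gp nondeg have lt: "(cmod c)\<^sup>2 < g1 * g2" by (simp add: zero_le_mult_iff)
  define \<rho> where "\<rho> = cmod c / sqrt (g1 * g2)"
  define \<gamma> where "\<gamma> = sqrt (1 - \<rho>\<^sup>2)"
  have \<rho>2: "\<rho>\<^sup>2 = (cmod c)\<^sup>2 / (g1 * g2)" using gp by (simp add: \<rho>_def power_divide)
  have \<rho>2_lt: "\<rho>\<^sup>2 < 1" unfolding \<rho>2 using lt gp by simp
  have \<rho>: "0 \<le> \<rho>" "\<rho> < 1"
    using gp \<rho>2_lt power2_less_imp_less[of \<rho> 1] by (simp_all add: \<rho>_def)
  have \<gamma>2: "\<gamma>\<^sup>2 = 1 - \<rho>\<^sup>2" using \<rho>2_lt by (simp add: \<gamma>_def)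
  define \<kappa> where "\<kappa> = exp (- \<i> * complex_of_real (Arg c))"
  have \<kappa>1: "cmod \<kappa> = 1" by (simp add: \<kappa>_def)
  have \<kappa>c: "\<kappa> * c = complex_of_real (cmod c)"
    using rcis_cmod_Arg[of c] by (simp add: \<kappa>_def rcis_def cis_conv_exp exp_minus field_simps)
  have \<kappa>i: "exp (\<i> * complex_of_real (Arg c)) * \<kappa> = 1"
    by (simp add: \<kappa>_def exp_add[symmetric])
  define \<alpha> where "\<alpha> = \<kappa> * complex_of_real (1 / sqrt g1)"
  define \<beta> where "\<beta> = complex_of_real (1 / sqrt g2)"
  have law: "(LINT w|M. G (\<alpha> * W1 w) (\<beta> * W2 w)) = (LINT p|std_complex_normal_pair. G (fst p) (\<rho> *\<^sub>R fst p + \<gamma> *\<^sub>R snd p))"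
    if [measurable]: "case_prod G \<in> borel_measurable (borel \<Otimes>\<^sub>M borel)" for G :: "complex \<Rightarrow> complex \<Rightarrow> complex"
  proof (rule complex_pair_law_unique[where F=G and M=M and N=std_complex_normal_pair and ?Z1.0="\<lambda>w. \<alpha> * W1 w"
        and ?Z2.0="\<lambda>w. \<beta> * W2 w" and Z1'=fst and Z2'="\<lambda>p. \<rho> *\<^sub>R fst p + \<gamma> *\<^sub>R snd p"])
    fix a b
    have "(cmod (a * \<alpha>))\<^sup>2 * g1 = (cmod a)\<^sup>2" "(cmod (b * \<beta>))\<^sup>2 * g2 = (cmod b)\<^sup>2"
      using gp by (simp_all add: \<alpha>_def \<beta>_def norm_mult norm_divide \<kappa>1 power_mult_distrib power_divide)
    moreover have "a * \<alpha> * cnj (b * \<beta>) * c = complex_of_real \<rho> * (a * cnj b)"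
    proof -
      have "a * \<alpha> * cnj (b * \<beta>) * c = (a * cnj b) * (\<kappa> * c) * complex_of_real (1 / sqrt g1 * (1 / sqrt g2))"
        by (simp add: \<alpha>_def \<beta>_def)
      also have "\<dots> = complex_of_real \<rho> * (a * cnj b)"
        unfolding \<kappa>c \<rho>_def by (simp add: real_sqrt_mult)
      finally show ?thesis .
    qed
    then have "Re (a * \<alpha> * cnj (b * \<beta>) * c) = \<rho> * Re (a * cnj b)" 
      by (metis Re_complex_of_real Im_complex_of_real times_complex.sel(1) mult_zero_left diff_zero)
    ultimately have "(LINT w|M. (cmod (a * \<alpha> * W1 w + b * \<beta> * W2 w))\<^sup>2) = (cmod a)\<^sup>2 + (cmod b)\<^sup>2 + 2 * (\<rho> * Re (a * cnj b))"
      unfolding quad by (simp only:)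
    then have "(LINT w|M. exp (\<i> * complex_of_real (Re (a * (\<alpha> * W1 w) + b * (\<beta> * W2 w)))))
        = complex_of_real (exp (- ((cmod a)\<^sup>2 + (cmod b)\<^sup>2 + 2 * (\<rho> * Re (a * cnj b))) / 4))"
      using char[of "a * \<alpha>" "b * \<beta>"] by (simp only: mult.assoc)
    also have "(cmod a)\<^sup>2 + (cmod b)\<^sup>2 + 2 * (\<rho> * Re (a * cnj b)) = (cmod (a + b * complex_of_real \<rho>))\<^sup>2 + (cmod (b * complex_of_real \<gamma>))\<^sup>2"
    proof -
      have "(cmod (b * complex_of_real \<gamma>))\<^sup>2 = (cmod b)\<^sup>2 * (1 - \<rho>\<^sup>2)"
        by (simp add: norm_mult power_mult_distrib \<gamma>2)
      then show ?thesis
        by (simp only: cmod_power2) (simp add: power2_eq_square algebra_simps)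
    qed
    also have "complex_of_real (exp (- ((cmod (a + b * complex_of_real \<rho>))\<^sup>2 + (cmod (b * complex_of_real \<gamma>))\<^sup>2) / 4))
       = (LINT p|std_complex_normal_pair. exp (\<i> * complex_of_real (Re ((a + b * complex_of_real \<rho>) * fst p + (b * complex_of_real \<gamma>) * snd p))))"
      by (rule std_complex_normal_pair_charfun[symmetric])
    also have "\<dots> = (LINT p|std_complex_normal_pair. exp (\<i> * complex_of_real (Re (a * fst p + b * (\<rho> *\<^sub>R fst p + \<gamma> *\<^sub>R snd p)))))"
      by (simp only: scaleR_conv_of_real distrib_left distrib_right mult.assoc add.assoc)
    finally show "(LINT w|M. exp (\<i> * complex_of_real (Re (a * (\<alpha> * W1 w) + b * (\<beta> * W2 w)))))
      = (LINT p|std_complex_normal_pair. exp (\<i> * complex_of_real (Re (a * fst p + b * (\<rho> *\<^sub>R fst p + \<gamma> *\<^sub>R snd p)))))" .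
  qed (use M std_complex_normal_pair.prob_space_axioms in auto)
  have s\<alpha>: "sgn (\<alpha> * z) = \<kappa> * sgn z" and s\<beta>: "sgn (\<beta> * z) = sgn z" for z
    using gp \<kappa>1 by (simp_all add: \<alpha>_def \<beta>_def sgn_mult sgn_eq[of \<kappa>] sgn_of_real)
  have G1: "(LINT w|M. sgn (\<alpha> * W1 w) * cnj (sgn (\<beta> * W2 w))) = complex_of_real (pi / 4 * (1 - \<rho>\<^sup>2) * \<rho> * hypergeom_2F1 (3/2) (3/2) 2 (\<rho>\<^sup>2))"
    using law[of "\<lambda>u v. sgn u * cnj (sgn v)"] correlated_phase_expectation[OF \<rho> \<gamma>_def] by simp
  have G2: "(LINT w|M. sgn (\<alpha> * W1 w) * sgn (\<beta> * W2 w)) = 0"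
    using law[of "\<lambda>u v. sgn u * sgn v"] std_complex_normal_pair_sum_phase[of \<rho> \<gamma>] by (simp add: scaleR_conv_of_real)
  have diff: "(LINT w|M. sgn (W1 w) * cnj (sgn (W2 w))) = complex_of_real (pi / 4) * exp (\<i> * complex_of_real (Arg c))
         * complex_of_real ((1 - (cmod c)\<^sup>2 / (g1 * g2)) * (cmod c / sqrt (g1 * g2)) * hypergeom_2F1 (3/2) (3/2) 2 ((cmod c)\<^sup>2 / (g1 * g2)))"
  proof -
    have "(LINT w|M. sgn (W1 w) * cnj (sgn (W2 w))) = exp (\<i> * complex_of_real (Arg c)) * \<kappa> * (LINT w|M. sgn (W1 w) * cnj (sgn (W2 w)))"
      unfolding \<kappa>i by simp
    also have "\<dots> = exp (\<i> * complex_of_real (Arg c)) * (LINT w|M. sgn (\<alpha> * W1 w) * cnj (sgn (\<beta> * W2 w)))"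
      unfolding s\<alpha> s\<beta> by (simp only: mult.assoc integral_mult_right_zero)
    also have "\<dots> = complex_of_real (pi / 4) * exp (\<i> * complex_of_real (Arg c)) * complex_of_real ((1 - \<rho>\<^sup>2) * \<rho> * hypergeom_2F1 (3/2) (3/2) 2 (\<rho>\<^sup>2))"
      unfolding G1 by (simp only: of_real_mult mult_ac)
    finally show ?thesis unfolding \<rho>2 by (simp only: \<rho>_def)
  qed
  have "\<kappa> * (LINT w|M. sgn (W1 w) * sgn (W2 w)) = 0"
    using G2 unfolding s\<alpha> s\<beta> by (simp only: mult.assoc integral_mult_right_zero)
  then have sum: "(LINT w|M. sgn (W1 w) * sgn (W2 w)) = 0" using \<kappa>1 by auto
  have "AE w in M. W1 w \<noteq> 0"
    by (rule circular_nonzero[OF M _ gp(1)]) (use char[of _ 0] quad[of _ 0] in \<open>simp_all add: mult.commute\<close>)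
  moreover have "AE w in M. W2 w \<noteq> 0"
    by (rule circular_nonzero[OF M _ gp(2)]) (use char[of 0] quad[of 0] in \<open>simp_all add: mult.commute\<close>)
  ultimately have ne: "AE w in M. W1 w \<noteq> 0 \<and> W2 w \<noteq> 0" by simp
  have phase: "exp (\<i> * complex_of_real (Arg2pi z)) = sgn z" if "z \<noteq> 0" for z
    using Arg2pi_eq[of z] that by (simp add: sgn_eq field_simps)
  have phase_diff: "exp (\<i> * complex_of_real (Arg2pi z - Arg2pi z')) = sgn z * cnj (sgn z')" if "z \<noteq> 0" "z' \<noteq> 0" for z z'
    using that by (simp add: phase[symmetric] exp_cnj exp_add[symmetric] algebra_simps)
  have phase_sum: "exp (\<i> * complex_of_real (Arg2pi z + Arg2pi z')) = sgn z * sgn z'" if "z \<noteq> 0" "z' \<noteq> 0" for z z'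
    using that by (simp add: phase[symmetric] exp_add[symmetric] algebra_simps)
  have "(LINT w|M. exp (\<i> * complex_of_real (Arg2pi (W1 w) - Arg2pi (W2 w)))) = (LINT w|M. sgn (W1 w) * cnj (sgn (W2 w)))"
  proof (rule integral_cong_AE)
    show "AE w in M. exp (\<i> * complex_of_real (Arg2pi (W1 w) - Arg2pi (W2 w))) = sgn (W1 w) * cnj (sgn (W2 w))"
      using ne by eventually_elim (blast intro: phase_diff)
  qed measurable
  with diff show "(LINT w|M. exp (\<i> * complex_of_real (Arg2pi (W1 w) - Arg2pi (W2 w)))) = complex_of_real (pi / 4) * exp (\<i> * complex_of_real (Arg c))
         * complex_of_real ((1 - (cmod c)\<^sup>2 / (g1 * g2)) * (cmod c / sqrt (g1 * g2)) * hypergeom_2F1 (3/2) (3/2) 2 ((cmod c)\<^sup>2 / (g1 * g2)))"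
    by (rule trans[rotated])
  have "(LINT w|M. exp (\<i> * complex_of_real (Arg2pi (W1 w) + Arg2pi (W2 w)))) = (LINT w|M. sgn (W1 w) * sgn (W2 w))"
  proof (rule integral_cong_AE)
    show "AE w in M. exp (\<i> * complex_of_real (Arg2pi (W1 w) + Arg2pi (W2 w))) = sgn (W1 w) * sgn (W2 w)"
      using ne by eventually_elim (blast intro: phase_sum)
  qed measurable
  with sum show "(LINT w|M. exp (\<i> * complex_of_real (Arg2pi (W1 w) + Arg2pi (W2 w)))) = 0"
    by (rule trans[rotated])
qed

theorem corollary6:
  fixes M :: "'w measure" and \<Phi> :: "real \<Rightarrow> 'w \<Rightarrow> real" and C :: "real \<Rightarrow> real"
    and F :: "real measure" and \<psi> :: "real \<Rightarrow> complex"
    and t1 t2 s1 s2 :: real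
    and W :: "'w \<Rightarrow> complex ^ 2" and \<Gamma> :: "complex ^ 2 ^ 2" and g1 g2 :: real
  assumes "prob_space M"
    and "analytic_mother_wavelet \<psi>"
    and "gaussian_process M \<Phi>"
    and "measurable_process M \<Phi>"
    and "stationary_with_covariance M \<Phi> C"
    and "spectral_measure F C"
    and "s1 > 0" and "s2 > 0"
    and "W = (\<lambda>w. vector [wavelet_transform \<psi> \<Phi> t1 s1 w, wavelet_transform \<psi> \<Phi> t2 s2 w])"
    and "\<Gamma> = second_moment_matrix M W"
    and "invertible \<Gamma>"
    and "g1 = Re (\<Gamma> $ 1 $ 1)" and "g2 = Re (\<Gamma> $ 2 $ 2)"
  shows "((LINT w|M. exp (\<i> * complex_of_real (wavelet_phase \<psi> \<Phi> t1 s1 w - wavelet_phase \<psi> \<Phi> t2 s2 w)))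
       = complex_of_real (pi / 4) * exp (\<i> * complex_of_real (Arg (\<Gamma> $ 1 $ 2)))
         * complex_of_real ((1 - (cmod (\<Gamma> $ 1 $ 2))\<^sup>2 / (g1 * g2))
             * (cmod (\<Gamma> $ 1 $ 2) / sqrt (g1 * g2))
             * hypergeom_2F1 (3/2) (3/2) 2 ((cmod (\<Gamma> $ 1 $ 2))\<^sup>2 / (g1 * g2))))
       \<and> (LINT w|M. exp (\<i> * complex_of_real (wavelet_phase \<psi> \<Phi> t1 s1 w + wavelet_phase \<psi> \<Phi> t2 s2 w))) = 0"
proof -
  interpret stationary_gaussian_process M \<Phi> C F
    using assms(1,3-6) by (simp add: stationary_gaussian_process_def stationary_gaussian_process_axioms_def)
  let ?g1 = "\<lambda>\<tau>. complex_of_real (1 / sqrt s1) * cnj (\<psi> ((\<tau> - t1) / s1))"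
  let ?g2 = "\<lambda>\<tau>. complex_of_real (1 / sqrt s2) * cnj (\<psi> ((\<tau> - t2) / s2))"
  define W1 where "W1 = wavelet_transform \<psi> \<Phi> t1 s1"
  define W2 where "W2 = wavelet_transform \<psi> \<Phi> t2 s2"
  define c where "c = \<Gamma> $ 1 $ 2"
  have W1: "W1 = path_integral ?g1" and W2: "W2 = path_integral ?g2"
    unfolding W1_def W2_def by (rule wavelet_transform_path_integral)+
  have a1: "antianalytic ?g1" and a2: "antianalytic ?g2"
    using assms(2,7,8) by (simp_all only: antianalytic_wavelet_atom)
  then have i1: "integrable lborel ?g1" and i2: "integrable lborel ?g2" by (simp_all add: antianalytic_def)
  have meas: "W1 \<in> borel_measurable M" "W2 \<in> borel_measurable M"
    using i1 i2 unfolding W1 W2 by (auto intro!: path_integral_measurable)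
  have sq: "integrable M (\<lambda>w. (cmod (W1 w))\<^sup>2)" "integrable M (\<lambda>w. (cmod (W2 w))\<^sup>2)"
    unfolding W1 W2 by (intro path_integral_square_integrable i1 i2)+
  have char: "expectation (\<lambda>w. exp (\<i> * complex_of_real (Re (a * W1 w + b * W2 w))))
      = complex_of_real (exp (- expectation (\<lambda>w. (cmod (a * W1 w + b * W2 w))\<^sup>2) / 4))" for a b
    unfolding W1 W2 by (rule circular_pair_charfun[OF a1 a2])
  have \<Gamma>: "\<Gamma> $ 1 $ 1 = expectation (\<lambda>w. W1 w * cnj (W1 w))" "\<Gamma> $ 1 $ 2 = expectation (\<lambda>w. W1 w * cnj (W2 w))"
    "\<Gamma> $ 2 $ 1 = expectation (\<lambda>w. W2 w * cnj (W1 w))" "\<Gamma> $ 2 $ 2 = expectation (\<lambda>w. W2 w * cnj (W2 w))"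
    unfolding assms(10) assms(9) second_moment_matrix_def W1_def W2_def by simp_all
  have nsq: "expectation (\<lambda>w. V w * cnj (V w)) = complex_of_real (expectation (\<lambda>w. (cmod (V w))\<^sup>2))" for V
    by (simp only: complex_norm_square[symmetric] of_real_power[symmetric] integral_complex_of_real)
  have g1: "g1 = expectation (\<lambda>w. (cmod (W1 w))\<^sup>2)" and g2: "g2 = expectation (\<lambda>w. (cmod (W2 w))\<^sup>2)"
    using assms(12,13) unfolding \<Gamma> nsq by simp_all
  have c: "c = expectation (\<lambda>w. W1 w * cnj (W2 w))" unfolding c_def \<Gamma> ..
  have \<Gamma>21: "\<Gamma> $ 2 $ 1 = cnj c"
    unfolding c \<Gamma> Bochner_Integration.integral_cnj[symmetric] by (simp add: mult.commute)
  have "det \<Gamma> \<noteq> 0" using assms(11) invertible_det_nz by blast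
  then have "complex_of_real (g1 * g2) - c * cnj c \<noteq> 0"
    unfolding det_2 \<Gamma>21 c_def[symmetric] using \<Gamma>(1,4) unfolding nsq g1[symmetric] g2[symmetric] by simp
  moreover have "complex_of_real (g1 * g2) = c * cnj c" if "g1 * g2 = (cmod c)\<^sup>2"
    unfolding that by (rule complex_norm_square)
  ultimately have "g1 * g2 \<noteq> (cmod c)\<^sup>2" by (auto simp del: of_real_mult)
  from circular_pair_phase_expectation[OF assms(1) meas sq char g1 g2 c this]
  show ?thesis unfolding wavelet_phase_def W1_def W2_def c_def by (rule conjI)
qed

end
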